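(* Let $A,B$ be $2\times 2$ complex matrix-valued functions on $[0,\infty)$ with entries in $L^1_{\mathrm{loc}}([0,\infty))$ such that $A(t)\ge 0$, $B(t)^*=-B(t)$, $\operatorname{tr}(A(t)\mathfrak{j})=\operatorname{tr}(B(t)\mathfrak{j})=0$ (for almost every $t$), where $\mathfrak{j}=\begin{bmatrix}-1&0\\0&1\end{bmatrix}$, and $\int_0^\infty \operatorname{tr}A(t)\,dt=\infty$. Assume the A-gauge (Arov gauge) condition: $A(t)+B(t)$ is upper triangular and $\operatorname{tr}B(t)=0$ (for almost every $t$). Let $w$ be the Schur spectral function of the associated canonical system $$\partial_t\mathfrak{A}(z,t)\,\mathfrak{j}=\mathfrak{A}(z,t)\left(-izA(t)+B(t)\right),\qquad \mathfrak{A}(z,0)=I,\quad z\in\mathbb{C},$$ and let $$\mathcal{I}(w)=\frac1\pi\int_{\mathbb{R}}\log\frac{1}{1-|w(x)|^2}\,\frac{dx}{1+x^2}$$ be its entropy functional. Then $$\mathcal{I}(w)=\int_0^\infty\left(\operatorname{tr}A(t)-2\sqrt{\det A(t)}\right)dt,$$ as an equality in $[0,\infty]$.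
   Context: $\mathbb{C}_+$ is the open upper half plane. The Schur class $\mathcal{S}$ is the set of holomorphic functions $\mathcal{E}$ on $\mathbb{C}_+$ with $|\mathcal{E}(z)|\le 1$. For each $z\in\mathbb{C}$, $\mathfrak{A}(z,\cdot)$ denotes the (locally absolutely continuous) solution of the canonical system, with entries $$\mathfrak{A}(z,t)=\begin{bmatrix}\mathfrak{a}_{11}(z,t)&\mathfrak{a}_{12}(z,t)\\ \mathfrak{a}_{21}(z,t)&\mathfrak{a}_{22}(z,t)\end{bmatrix}.$$ When $\int_0^\infty\operatorname{tr}A(t)\,dt=\infty$, the Schur spectral function $w$ is defined for $z\in\mathbb{C}_+$ by $$w(z)=\lim_{t\to\infty}\frac{\mathfrak{a}_{11}(z,t)\mathcal{E}(z)+\mathfrak{a}_{12}(z,t)}{\mathfrak{a}_{21}(z,t)\mathcal{E}(z)+\mathfrak{a}_{22}(z,t)},$$ where $\mathcal{E}\in\mathcal{S}$; by a known theorem of de Branges the limit exists and does not depend on the choice of $\mathcal{E}\in\mathcal{S}$, and $w\in\mathcal{S}$. For $x\in\mathbb{R}$, $w(x)$ denotes the nontangential boundary value of $w$, which exists for almost every $x$; $\log\frac{1}{1-|w(x)|^2}$ is understood as $+\infty$ where $|w(x)|=1$. *)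

theory Defs
  imports "HOL-Analysis.Analysis"
begin

definition sig_j :: "complex^2^2"
  where "sig_j = vector [vector [-1, 0], vector [0, 1]]"

definition adj :: "complex^2^2 \<Rightarrow> complex^2^2"
  where "adj M = map_matrix cnj (transpose M)"

definition pos_semidef :: "complex^2^2 \<Rightarrow> bool"
  where "pos_semidef M \<longleftrightarrow>
    adj M = M \<and> (\<forall>v::complex^2. 0 \<le> Re (\<Sum>i\<in>UNIV. cnj (v $ i) * (M *v v) $ i))"

definition locally_integrable_entries :: "(real \<Rightarrow> complex^2^2) \<Rightarrow> bool"
  where "locally_integrable_entries M \<longleftrightarrow>
    (\<forall>i k. \<forall>T\<ge>0. (\<lambda>t. M t $ i $ k) absolutely_integrable_on {0..T})"

text \<open>The usual epsilon-delta definition. The finite families of non-overlapping compact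
  intervals are given as divisions, so each \<open>K\<close> below is the interval from \<open>Inf K\<close> to \<open>Sup K\<close>.\<close>

definition abs_continuous_on :: "real set \<Rightarrow> (real \<Rightarrow> 'a::real_normed_vector) \<Rightarrow> bool"
  where "abs_continuous_on S f \<longleftrightarrow>
    (\<forall>\<epsilon>>0. \<exists>\<delta>>0. \<forall>\<D> U. \<D> division_of U \<and> U \<subseteq> S \<and> (\<Sum>K\<in>\<D>. Sup K - Inf K) < \<delta> \<longrightarrow>
       (\<Sum>K\<in>\<D>. norm (f (Sup K) - f (Inf K))) < \<epsilon>)"

text \<open>Being a Caratheodory solution on the half-line of
  \<open>\<partial>\<^sub>t X j = X (- i z A + B)\<close>, \<open>X(0) = I\<close>.\<close>

definition canonical_solution ::
  "(real \<Rightarrow> complex^2^2) \<Rightarrow> (real \<Rightarrow> complex^2^2) \<Rightarrow> complex \<Rightarrow> (real \<Rightarrow> complex^2^2) \<Rightarrow> bool"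
  where "canonical_solution A B z X \<longleftrightarrow>
    (\<forall>T\<ge>0. abs_continuous_on {0..T} X) \<and>
    (AE t in lebesgue. 0 \<le> t \<longrightarrow>
       (\<exists>X'. (X has_vector_derivative X') (at t within {0..}) \<and>
             X' ** sig_j = X t ** (map_matrix (\<lambda>a. - \<i> * z * a) (A t) + B t))) \<and>
    X 0 = mat 1"

definition schur_class :: "(complex \<Rightarrow> complex) set"
  where "schur_class =
    {E. E holomorphic_on {z. 0 < Im z} \<and> (\<forall>z. 0 < Im z \<longrightarrow> cmod (E z) \<le> 1)}"

text \<open>Only meaningful in the open upper half plane. The limit is known not to depend on
  the parameter \<open>E\<close> of the Schur class.\<close>

definition schur_spectral_function ::
  "(complex \<Rightarrow> real \<Rightarrow> complex^2^2) \<Rightarrow> (complex \<Rightarrow> complex) \<Rightarrow> complex \<Rightarrow> complex"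
  where "schur_spectral_function \<AA> E z =
    Lim at_top (\<lambda>t. (\<AA> z t $ 1 $ 1 * E z + \<AA> z t $ 1 $ 2) / (\<AA> z t $ 2 $ 1 * E z + \<AA> z t $ 2 $ 2))"

definition stolz_cone :: "real \<Rightarrow> real \<Rightarrow> complex set"
  where "stolz_cone \<alpha> x = {z. 0 < Im z \<and> \<bar>Re z - x\<bar> < \<alpha> * Im z}"

text \<open>Arbitrary at the points (a null set for Schur functions) without a nontangential limit.\<close>

definition nontangential_value :: "(complex \<Rightarrow> complex) \<Rightarrow> real \<Rightarrow> complex"
  where "nontangential_value w x =
    (THE c. \<forall>\<alpha>>0. (w \<longlongrightarrow> c) (at (complex_of_real x) within stolz_cone \<alpha> x))"

definition log_defect :: "complex \<Rightarrow> ennreal"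
  where "log_defect c = (if cmod c < 1 then ennreal (ln (1 / (1 - (cmod c)\<^sup>2))) else \<infinity>)"

definition entropy_functional :: "(complex \<Rightarrow> complex) \<Rightarrow> ennreal"
  where "entropy_functional w = ennreal (1 / pi) *
    (\<integral>\<^sup>+ x. log_defect (nontangential_value w x) * ennreal (1 / (1 + x\<^sup>2)) \<partial>lebesgue)"

end

theory Submission
  imports Defs "HOL-Complex_Analysis.Complex_Analysis" "HOL-Real_Asymp.Real_Asymp"
begin

text \<open>In the Arov gauge the system has two scalar coefficients \<open>a\<close> and \<open>b\<close> with \<open>\<bar>b\<bar> \<le> a\<close>, and the claim reads
  \<open>\<I>(w) = 2 \<integral> (a - \<lambda>)\<close> with \<open>\<lambda> = \<surd>(a\<^sup>2 - \<bar>b\<bar>\<^sup>2)\<close>. For fixed \<open>T\<close> the function \<open>ln \<bar>a\<^sub>2\<^sub>2(z, T)\<bar>\<close> is harmonic and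
  nonnegative in the closed upper half plane, equals \<open>\<integral>\<^sub>0\<^sup>T a\<close> at \<open>z = i\<close> because there \<open>a\<^sub>2\<^sub>1\<close> vanishes, and
  grows like \<open>y \<integral>\<^sub>0\<^sup>T \<lambda>\<close> along \<open>z = i y\<close> by an analysis of the Riccati equation of \<open>a\<^sub>2\<^sub>1 / a\<^sub>2\<^sub>2\<close>. The
  Herglotz representation therefore gives \<open>ln \<bar>a\<^sub>2\<^sub>2\<bar>\<close> the Poisson mean \<open>\<integral>\<^sub>0\<^sup>T (a - \<lambda>)\<close> on the real line, where
  \<open>\<bar>a\<^sub>2\<^sub>2\<bar>\<^sup>-\<^sup>2 = 1 - \<bar>w\<^sub>T\<bar>\<^sup>2\<close> for the truncated function \<open>w\<^sub>T = a\<^sub>1\<^sub>2 / a\<^sub>2\<^sub>2\<close>.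

  The logarithmic defect of a Schur function is subharmonic, so letting \<open>T\<close> tend to infinity on horizontal
  lines and then descending to the real line, Fatou's lemma gives \<open>\<le>\<close>. Conversely,
  \<open>h = (a\<^sub>1\<^sub>1 - w a\<^sub>2\<^sub>1) a\<^sub>2\<^sub>2 + (a\<^sub>1\<^sub>2 - w a\<^sub>2\<^sub>2) a\<^sub>2\<^sub>1\<close> has nonnegative real part and \<open>h(i) = 1\<close>, hence Poisson mean at
  most 1 on the real line, and there \<open>(1 - \<bar>w\<bar>\<^sup>2) \<bar>a\<^sub>2\<^sub>2\<bar>\<^sup>2 \<le> Re h\<close>; taking logarithms and using
  \<open>ln x \<le> x - 1\<close> gives \<open>\<ge>\<close>.\<close>

section \<open>Absolutely continuous functions\<close>

text \<open>One identity carries both inequalities: along a row \<open>(p, q)\<close> of a solution,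
  \<open>|q|^2 - |p|^2\<close> is nondecreasing in \<open>t\<close> if \<open>Im z \<ge> 0\<close>
  and constant if \<open>z\<close> is real. It keeps \<open>a22\<close> away from zero, nests the
  Weyl discs, and on the real line turns \<open>1 - |w|^2\<close> into \<open>|P|^2 - |Q|^2\<close>,
  where \<open>(P, Q)\<close> is the first row minus \<open>w\<close> times the second. The gauge
  acts at the point \<open>i\<close>: there the coefficient of the system is \<open>A + B\<close>,
  which is triangular. The function \<open>h\<close> is \<open>P a22 + Q a21\<close>; as
  \<open>P a22 - Q a21\<close> is the determinant 1, \<open>Re h = |P a22|^2 - |Q a21|^2\<close>.
  The obstacle is that the truncated functions converge to \<open>w\<close> only in the open half
  plane, which says nothing about boundary values. So the upper bound is proved at positive height,
  whereas the lower bound uses the boundary values of \<open>w\<close> for one fixed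
  \<open>T\<close>, where the matrix entries are entire. A second obstacle is that the coefficients
  are merely locally integrable: the attracting root of the Riccati equation need not be
  differentiable and is replaced by averages.\<close>

lemma abs_continuous_onD:
  assumes "abs_continuous_on S f" "0 < \<epsilon>"
  obtains \<delta> where "0 < \<delta>"
    "\<And>\<D> U. \<lbrakk>\<D> division_of U; U \<subseteq> S; (\<Sum>K\<in>\<D>. Sup K - Inf K) < \<delta>\<rbrakk> \<Longrightarrow> (\<Sum>K\<in>\<D>. norm (f (Sup K) - f (Inf K))) < \<epsilon>"
proof -
  from assms obtain \<delta> where "\<delta> > 0 \<and> (\<forall>\<D> U. \<D> division_of U \<and> U \<subseteq> S \<and> (\<Sum>K\<in>\<D>. Sup K - Inf K) < \<delta> \<longrightarrow>
       (\<Sum>K\<in>\<D>. norm (f (Sup K) - f (Inf K))) < \<epsilon>)"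
    unfolding abs_continuous_on_def by meson
  then show thesis by (intro that[of \<delta>]) auto
qed

lemma division_of_real_interval:
  fixes \<D> :: "real set set"
  assumes "\<D> division_of U" "K \<in> \<D>"
  shows "K = {Inf K..Sup K}" "Inf K \<le> Sup K" "Inf K \<in> K" "Sup K \<in> K" "K \<subseteq> U"
proof -
  obtain u v where uv: "K = cbox u v" and ne: "K \<noteq> {}" and sub: "K \<subseteq> U"
    using division_ofD(2,3,4)[OF assms(1)] assms(2) by metis
  then have "u \<le> v" by auto
  then show "K = {Inf K..Sup K}" "Inf K \<le> Sup K" "Inf K \<in> K" "Sup K \<in> K" "K \<subseteq> U"
    using uv sub by auto
qed

text \<open>Lipschitz functions, sums, linear images, products, inverses and logarithms all reduce
  to this comparison of increments; unary operations take a constant for \<open>g\<close>.\<close>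

lemma abs_continuous_on_dominated:
  fixes f :: "real \<Rightarrow> 'a::real_normed_vector" and g :: "real \<Rightarrow> 'b::real_normed_vector"
    and h :: "real \<Rightarrow> 'c::real_normed_vector"
  assumes f: "abs_continuous_on S f" and g: "abs_continuous_on S g"
    and h: "\<And>x y. x \<in> S \<Longrightarrow> y \<in> S \<Longrightarrow> norm (h x - h y) \<le> C * (norm (f x - f y) + norm (g x - g y))"
  shows "abs_continuous_on S h"
  unfolding abs_continuous_on_def
proof (intro allI impI)
  fix \<epsilon> :: real assume \<epsilon>: "\<epsilon> > 0"
  define D where "D = \<bar>C\<bar> + 1"
  have D: "D > 0" "C \<le> D" by (auto simp: D_def)
  have e: "\<epsilon> / (2 * D) > 0" using \<epsilon> D by simp
  obtain \<delta>1 where \<delta>1: "0 < \<delta>1" "\<And>\<D> U. \<lbrakk>\<D> division_of U; U \<subseteq> S; (\<Sum>K\<in>\<D>. Sup K - Inf K) < \<delta>1\<rbrakk> \<Longrightarrow> (\<Sum>K\<in>\<D>. norm (f (Sup K) - f (Inf K))) < \<epsilon> / (2 * D)"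
    using abs_continuous_onD[OF f e] by metis
  obtain \<delta>2 where \<delta>2: "0 < \<delta>2" "\<And>\<D> U. \<lbrakk>\<D> division_of U; U \<subseteq> S; (\<Sum>K\<in>\<D>. Sup K - Inf K) < \<delta>2\<rbrakk> \<Longrightarrow> (\<Sum>K\<in>\<D>. norm (g (Sup K) - g (Inf K))) < \<epsilon> / (2 * D)"
    using abs_continuous_onD[OF g e] by metis
  show "\<exists>\<delta>>0. \<forall>\<D> U. \<D> division_of U \<and> U \<subseteq> S \<and> (\<Sum>K\<in>\<D>. Sup K - Inf K) < \<delta> \<longrightarrow> (\<Sum>K\<in>\<D>. norm (h (Sup K) - h (Inf K))) < \<epsilon>"
  proof (intro exI[of _ "min \<delta>1 \<delta>2"] conjI allI impI)
    show "0 < min \<delta>1 \<delta>2" using \<delta>1 \<delta>2 by simp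
    fix \<D> U assume a: "\<D> division_of U \<and> U \<subseteq> S \<and> (\<Sum>K\<in>\<D>. Sup K - Inf K) < min \<delta>1 \<delta>2"
    have "(\<Sum>K\<in>\<D>. norm (h (Sup K) - h (Inf K))) \<le> (\<Sum>K\<in>\<D>. D * (norm (f (Sup K) - f (Inf K)) + norm (g (Sup K) - g (Inf K))))"
    proof (rule sum_mono)
      fix K assume "K \<in> \<D>"
      then have "Sup K \<in> S" "Inf K \<in> S" using division_of_real_interval[of \<D> U K] a by auto
      then show "norm (h (Sup K) - h (Inf K)) \<le> D * (norm (f (Sup K) - f (Inf K)) + norm (g (Sup K) - g (Inf K)))"
        using h[of "Sup K" "Inf K"] D by (intro order_trans[OF h] mult_right_mono) auto
    qed
    also have "\<dots> = D * ((\<Sum>K\<in>\<D>. norm (f (Sup K) - f (Inf K))) + (\<Sum>K\<in>\<D>. norm (g (Sup K) - g (Inf K))))"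
      unfolding sum_distrib_left[symmetric] sum.distrib by (rule refl)
    also have "\<dots> < D * (\<epsilon> / (2 * D) + \<epsilon> / (2 * D))"
      using \<delta>1(2)[of \<D> U] \<delta>2(2)[of \<D> U] a D by (intro mult_strict_left_mono add_strict_mono) auto
    also have "\<dots> = \<epsilon>" using D by simp
    finally show "(\<Sum>K\<in>\<D>. norm (h (Sup K) - h (Inf K))) < \<epsilon>" .
  qed
qed

lemma abs_continuous_on_lipschitz:
  fixes h :: "real \<Rightarrow> 'c::real_normed_vector"
  assumes "\<And>x y. x \<in> S \<Longrightarrow> y \<in> S \<Longrightarrow> norm (h x - h y) \<le> C * \<bar>x - y\<bar>"
  shows "abs_continuous_on S h"
proof -
  have "abs_continuous_on S (\<lambda>x. x)"
    unfolding abs_continuous_on_def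
  proof (intro allI impI)
    fix \<epsilon> :: real assume \<epsilon>: "\<epsilon> > 0"
    show "\<exists>\<delta>>0. \<forall>\<D> U. \<D> division_of U \<and> U \<subseteq> S \<and> (\<Sum>K\<in>\<D>. Sup K - Inf K) < \<delta> \<longrightarrow> (\<Sum>K\<in>\<D>. norm (Sup K - Inf K)) < \<epsilon>"
    proof (intro exI[of _ \<epsilon>] conjI allI impI \<epsilon>)
      fix \<D> U assume a: "\<D> division_of U \<and> U \<subseteq> S \<and> (\<Sum>K\<in>\<D>. Sup K - Inf K) < \<epsilon>"
      have "(\<Sum>K\<in>\<D>. norm (Sup K - Inf K)) = (\<Sum>K\<in>\<D>. Sup K - Inf K)"
        using division_of_real_interval(2)[of \<D> U] a by (intro sum.cong) auto
      then show "(\<Sum>K\<in>\<D>. norm (Sup K - Inf K)) < \<epsilon>" using a by simp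
    qed
  qed
  then show ?thesis
  proof (rule abs_continuous_on_dominated)
    show "abs_continuous_on S (\<lambda>x. 0::real)" by (auto simp: abs_continuous_on_def)
    show "norm (h x - h y) \<le> C * (norm (x - y) + norm (0 - 0 :: real))" if "x \<in> S" "y \<in> S" for x y
      using assms[OF that] by simp
  qed
qed

lemma abs_continuous_on_const: "abs_continuous_on S (\<lambda>x. c)"
  by (rule abs_continuous_on_lipschitz[of _ _ 0]) simp

lemma abs_continuous_on_add:
  assumes "abs_continuous_on S f" "abs_continuous_on S g"
  shows "abs_continuous_on S (\<lambda>x. f x + g x)"
  by (rule abs_continuous_on_dominated[OF assms, of _ 1])
     (simp add: add_diff_add norm_triangle_ineq)

lemma abs_continuous_on_bounded_linear:
  assumes "bounded_linear L" "abs_continuous_on S f"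
  shows "abs_continuous_on S (\<lambda>x. L (f x))"
proof -
  obtain K where K: "\<And>x. norm (L x) \<le> norm x * K" using bounded_linear.bounded[OF assms(1)] by blast
  show ?thesis
    by (rule abs_continuous_on_dominated[OF assms(2) abs_continuous_on_const[of _ "0::real"], of _ K])
       (use K in \<open>simp add: linear_diff[OF bounded_linear.linear[OF assms(1)], symmetric] mult.commute\<close>)
qed

lemma abs_continuous_on_minus:
  "abs_continuous_on S f \<Longrightarrow> abs_continuous_on S (\<lambda>x. - f x)"
  by (rule abs_continuous_on_bounded_linear[OF bounded_linear_minus[OF bounded_linear_ident]])

lemma abs_continuous_on_diff:
  assumes "abs_continuous_on S f" "abs_continuous_on S g"
  shows "abs_continuous_on S (\<lambda>x. f x - g x)"
  using abs_continuous_on_add[OF assms(1) abs_continuous_on_minus[OF assms(2)]] by simp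

lemma abs_continuous_on_subset:
  assumes "abs_continuous_on S f" "T \<subseteq> S"
  shows "abs_continuous_on T f"
  using assms unfolding abs_continuous_on_def by (meson order_trans)

lemma abs_continuous_on_imp_continuous_on:
  assumes f: "abs_continuous_on {a..b} f"
  shows "continuous_on {a..b} f"
  unfolding continuous_on_iff
proof (intro ballI allI impI)
  fix x \<epsilon> :: real assume x: "x \<in> {a..b}" and \<epsilon>: "\<epsilon> > 0"
  obtain \<delta> where \<delta>: "0 < \<delta>" "\<And>\<D> U. \<lbrakk>\<D> division_of U; U \<subseteq> {a..b}; (\<Sum>K\<in>\<D>. Sup K - Inf K) < \<delta>\<rbrakk> \<Longrightarrow> (\<Sum>K\<in>\<D>. norm (f (Sup K) - f (Inf K))) < \<epsilon>"
    using abs_continuous_onD[OF f \<epsilon>] by metis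
  have *: "norm (f v - f u) < \<epsilon>" if "u \<le> v" "u \<in> {a..b}" "v \<in> {a..b}" "v - u < \<delta>" for u v
    using \<delta>(2)[OF division_of_self[of u v, simplified]] that by auto
  show "\<exists>d>0. \<forall>x'\<in>{a..b}. dist x' x < d \<longrightarrow> dist (f x') (f x) < \<epsilon>"
  proof (intro exI[of _ \<delta>] conjI ballI impI \<delta>(1))
    fix y assume y: "y \<in> {a..b}" "dist y x < \<delta>"
    then show "dist (f y) (f x) < \<epsilon>"
      using *[of x y] *[of y x] x by (cases "x \<le> y") (auto simp: dist_norm norm_minus_commute)
  qed
qed

lemma abs_continuous_on_imp_bounded:
  assumes f: "abs_continuous_on {a..b} f"
  obtains M where "0 < M" "\<And>x. x \<in> {a..b} \<Longrightarrow> norm (f x) \<le> M"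
proof -
  have "bounded (f ` {a..b})"
    by (intro compact_imp_bounded compact_continuous_image abs_continuous_on_imp_continuous_on f) simp
  then obtain M where "0 < M" "\<forall>x\<in>f ` {a..b}. norm x \<le> M" by (auto simp: bounded_pos)
  then show thesis by (intro that[of M]) auto
qed

lemma abs_continuous_on_mult:
  fixes f g :: "real \<Rightarrow> 'a::real_normed_algebra"
  assumes f: "abs_continuous_on {a..b} f" and g: "abs_continuous_on {a..b} g"
  shows "abs_continuous_on {a..b} (\<lambda>x. f x * g x)"
proof -
  obtain M where M: "0 < M" "\<And>x. x \<in> {a..b} \<Longrightarrow> norm (f x) \<le> M" using abs_continuous_on_imp_bounded[OF f] by blast
  obtain N where N: "0 < N" "\<And>x. x \<in> {a..b} \<Longrightarrow> norm (g x) \<le> N" using abs_continuous_on_imp_bounded[OF g] by blast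
  show ?thesis
  proof (rule abs_continuous_on_dominated[OF f g, of _ "M + N"])
    fix x y assume xy: "x \<in> {a..b}" "y \<in> {a..b}"
    have "f x * g x - f y * g y = f x * (g x - g y) + (f x - f y) * g y" by (simp add: algebra_simps)
    then have "norm (f x * g x - f y * g y) \<le> norm (f x) * norm (g x - g y) + norm (f x - f y) * norm (g y)"
      by (metis add_mono norm_mult_ineq norm_triangle_le)
    also have "\<dots> \<le> M * norm (g x - g y) + norm (f x - f y) * N"
      using M N xy by (intro add_mono mult_mono) auto
    also have "\<dots> \<le> (M + N) * (norm (f x - f y) + norm (g x - g y))"
      using M N by (simp add: algebra_simps)
    finally show "norm (f x * g x - f y * g y) \<le> (M + N) * (norm (f x - f y) + norm (g x - g y))" .
  qed
qed

lemma abs_continuous_on_inverse: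
  fixes f :: "real \<Rightarrow> 'a::real_normed_field"
  assumes f: "abs_continuous_on {a..b} f" and m: "0 < m" "\<And>x. x \<in> {a..b} \<Longrightarrow> m \<le> norm (f x)"
  shows "abs_continuous_on {a..b} (\<lambda>x. inverse (f x))"
proof (rule abs_continuous_on_dominated[OF f abs_continuous_on_const[of _ "0::real"], of _ "1 / (m * m)"])
  fix x y assume xy: "x \<in> {a..b}" "y \<in> {a..b}"
  then have p: "m \<le> norm (f x)" "m \<le> norm (f y)" using m by auto
  then have "f x \<noteq> 0" "f y \<noteq> 0" using m(1) by auto
  then have "norm (inverse (f x) - inverse (f y)) = norm (f x - f y) / (norm (f x) * norm (f y))"
    by (simp add: inverse_diff_inverse norm_mult norm_inverse norm_minus_commute divide_inverse)
  also have "\<dots> \<le> norm (f x - f y) / (m * m)"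
    using p m(1) by (intro divide_left_mono mult_mono) (auto intro!: mult_pos_pos)
  finally show "norm (inverse (f x) - inverse (f y)) \<le> 1 / (m * m) * (norm (f x - f y) + norm (0 - 0::real))" by simp
qed

text \<open>The inequality \<open>ln (u / v) \<le> u / v - 1\<close>, used for both orders of the
  two points, makes \<open>ln\<close> Lipschitz with constant \<open>1 / m\<close> above
  \<open>m\<close>.\<close>

lemma abs_continuous_on_ln:
  fixes f :: "real \<Rightarrow> real"
  assumes f: "abs_continuous_on {a..b} f" and m: "0 < m" "\<And>x. x \<in> {a..b} \<Longrightarrow> m \<le> f x"
  shows "abs_continuous_on {a..b} (\<lambda>x. ln (f x))"
proof (rule abs_continuous_on_dominated[OF f abs_continuous_on_const[of _ "0::real"], of _ "1 / m"])
  have *: "ln u - ln v \<le> 1 / m * \<bar>u - v\<bar>" if "m \<le> u" "m \<le> v" for u v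
  proof -
    have "ln u - ln v = ln (u / v)" using that m(1) by (simp add: ln_div)
    also have "\<dots> \<le> u / v - 1" using that m(1) by (intro ln_le_minus_one) auto
    also have "\<dots> = (u - v) / v" using that m(1) by (simp add: field_simps)
    also have "\<dots> \<le> \<bar>u - v\<bar> / v" using that m(1) by (intro divide_right_mono) auto
    also have "\<dots> \<le> \<bar>u - v\<bar> / m" using that m(1) by (intro divide_left_mono) auto
    finally show ?thesis by simp
  qed
  fix x y assume "x \<in> {a..b}" "y \<in> {a..b}"
  then show "norm (ln (f x) - ln (f y)) \<le> 1 / m * (norm (f x - f y) + norm (0 - 0::real))"
    using *[of "f x" "f y"] *[of "f y" "f x"] m by (simp add: abs_le_iff abs_minus_commute)
qed

section \<open>The fundamental theorem of calculus for absolutely continuous functions\<close>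

lemma division_length_le_measure:
  fixes \<D> :: "real set set"
  assumes D: "\<D> division_of V" and sub: "V \<subseteq> U" and U: "U \<in> lmeasurable"
  shows "(\<Sum>K\<in>\<D>. Sup K - Inf K) \<le> measure lebesgue U"
proof -
  have "((\<lambda>x. 1::real) has_integral (\<Sum>K\<in>\<D>. Sup K - Inf K)) V"
  proof (rule has_integral_combine_division[OF D])
    fix K assume K: "K \<in> \<D>"
    define u v where "u = Inf K" and "v = Sup K"
    have "K = {u..v}" "u \<le> v" using division_of_real_interval(1,2)[OF D K] by (simp_all add: u_def v_def)
    then have "((\<lambda>x. 1::real) has_integral v - u) K" using has_integral_const_real[of "1::real" u v] by simp
    then show "((\<lambda>x. 1::real) has_integral Sup K - Inf K) K" by (simp add: u_def v_def)
  qed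
  moreover have "V \<in> lmeasurable"
  proof (rule lmeasurable_compact)
    have "compact (\<Union>\<D>)"
    proof (rule compact_Union)
      show "finite \<D>" using D by (rule division_of_finite)
      show "compact K" if "K \<in> \<D>" for K using division_of_real_interval(1)[OF D that] by (metis compact_Icc)
    qed
    then show "compact V" using division_ofD(6)[OF D] by simp
  qed
  ultimately have "(\<Sum>K\<in>\<D>. Sup K - Inf K) = measure lebesgue V"
    by (simp add: lmeasure_integral integral_unique)
  then show ?thesis using measure_mono_fmeasurable[OF sub fmeasurableD[OF \<open>V \<in> lmeasurable\<close>] U] by simp
qed

text \<open>A Henstock-Kurzweil gauge argument: on the exceptional null set the gauge is confined to an
  open set of small measure, where absolute continuity controls the increments.\<close>

theorem fundamental_theorem_of_calculus_abs_continuous: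
  fixes f :: "real \<Rightarrow> 'a::banach"
  assumes ab: "a \<le> b" and ac: "abs_continuous_on {a..b} f" and neg: "negligible N"
    and der: "\<And>t. t \<in> {a..b} - N \<Longrightarrow> (f has_vector_derivative g t) (at t within {a..b})"
  shows "(g has_integral (f b - f a)) {a..b}"
proof -
  \<comment> \<open>With the value zero on \<open>N\<close>, the Riemann terms tagged in
    \<open>N\<close> vanish and only increments of \<open>f\<close> remain there.\<close>
  define h where "h = (\<lambda>t. if t \<in> N then 0 else g t)"
  have "(h has_integral (f b - f a)) {a..b}"
    unfolding has_integral_real
  proof (intro allI impI)
    fix e :: real assume e: "e > 0"
    \<comment> \<open>Intervals tagged outside \<open>N\<close> will contribute at most
      \<open>e1 * (b - a) \<le> e / 4\<close>; the \<open>+ 1\<close> keeps the denominator positive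
      when \<open>a = b\<close>.\<close>
    define e1 where "e1 = e / (4 * (b - a + 1))"
    have e1: "e1 > 0" using e ab by (simp add: e1_def)
    obtain \<delta> where \<delta>: "0 < \<delta>" "\<And>\<D> U. \<lbrakk>\<D> division_of U; U \<subseteq> {a..b}; (\<Sum>K\<in>\<D>. Sup K - Inf K) < \<delta>\<rbrakk> \<Longrightarrow> (\<Sum>K\<in>\<D>. norm (f (Sup K) - f (Inf K))) < e / 2"
      using abs_continuous_onD[OF ac half_gt_zero[OF e]] by metis
    have Nset: "N \<in> sets lebesgue" using neg by (simp add: negligible_imp_sets)
    obtain T where T: "open T" "N \<subseteq> T" "T - N \<in> lmeasurable" "emeasure lebesgue (T - N) < ennreal \<delta>"
      by (rule sets_lebesgue_outer_open[OF Nset \<delta>(1)])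
    have TU: "T = (T - N) \<union> N" using T(2) by auto
    have Tm: "T \<in> lmeasurable"
      by (subst TU) (intro fmeasurable.Un T(3) negligible_imp_measurable neg)
    have "measure lebesgue T = measure lebesgue (T - N)"
      by (rule measure_negligible_symdiff[OF T(3)], rule negligible_subset[OF neg]) auto
    moreover have "measure lebesgue (T - N) < \<delta>"
      using T(3,4) \<delta>(1) by (simp add: emeasure_eq_measure2 ennreal_less_iff)
    ultimately have Td: "measure lebesgue T < \<delta>" by linarith
    have "\<exists>d>0. (x \<in> N \<longrightarrow> ball x d \<subseteq> T) \<and> (x \<in> {a..b} - N \<longrightarrow>
        (\<forall>y\<in>{a..b}. norm (y - x) < d \<longrightarrow> norm (f y - f x - (y - x) *\<^sub>R g x) \<le> e1 * norm (y - x)))" for x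
    proof (cases "x \<in> N")
      case True
      then obtain d where "d > 0" "ball x d \<subseteq> T" using openE[OF T(1), of x] T(2) by (metis subsetD)
      then show ?thesis using True by (intro exI[of _ d]) auto
    next
      case False
      show ?thesis
      proof (cases "x \<in> {a..b}")
        case True
        have "(f has_derivative (\<lambda>h. h *\<^sub>R g x)) (at x within {a..b})"
          using der[of x] False True by (simp add: has_vector_derivative_def)
        then have "\<exists>d>0. \<forall>y\<in>{a..b}. norm (y - x) < d \<longrightarrow> norm (f y - f x - (y - x) *\<^sub>R g x) \<le> e1 * norm (y - x)"
          using e1 unfolding has_derivative_within_alt by blast
        then obtain d where "d > 0" "\<forall>y\<in>{a..b}. norm (y - x) < d \<longrightarrow> norm (f y - f x - (y - x) *\<^sub>R g x) \<le> e1 * norm (y - x)"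
          by (elim exE conjE)
        then show ?thesis using False by (intro exI[of _ d]) simp
      next
        case xab: False
        show ?thesis by (rule exI[of _ 1]) (use False xab in \<open>blast intro: zero_less_one\<close>)
      qed
    qed
    then obtain d where d: "\<And>x. d x > 0" "\<And>x. x \<in> N \<Longrightarrow> ball x (d x) \<subseteq> T"
      "\<And>x y. \<lbrakk>x \<in> {a..b} - N; y \<in> {a..b}; norm (y - x) < d x\<rbrakk> \<Longrightarrow> norm (f y - f x - (y - x) *\<^sub>R g x) \<le> e1 * norm (y - x)"
      by (metis (no_types, lifting))
    show "\<exists>\<gamma>. gauge \<gamma> \<and> (\<forall>\<D>. \<D> tagged_division_of {a..b} \<and> \<gamma> fine \<D> \<longrightarrow>
        norm ((\<Sum>(x, K)\<in>\<D>. measure lborel K *\<^sub>R h x) - (f b - f a)) < e)"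
    proof (intro exI[of _ "\<lambda>x. ball x (d x)"] conjI allI impI)
      show "gauge (\<lambda>x. ball x (d x))" using d(1) by (auto intro: gauge_ball_dependent)
      fix p assume p: "p tagged_division_of {a..b} \<and> (\<lambda>x. ball x (d x)) fine p"
      then have tag: "p tagged_division_of {a..b}" and fine: "(\<lambda>x. ball x (d x)) fine p" by auto
      have fin: "finite p" using tag by blast
      have pK: "K = {Inf K..Sup K}" "Inf K \<le> Sup K" "Inf K \<in> K" "Sup K \<in> K" "K \<subseteq> {a..b}" "x \<in> K" "K \<subseteq> ball x (d x)"
        if "(x, K) \<in> p" for x K
      proof -
        have "K \<in> snd ` p" using that by force
        note k = division_of_real_interval[OF division_of_tagged_division[OF tag] this]
        show "K = {Inf K..Sup K}" "Inf K \<le> Sup K" "Inf K \<in> K" "Sup K \<in> K" "K \<subseteq> {a..b}"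
          by (rule k)+
        show "x \<in> K" using tagged_division_ofD(2)[OF tag that] .
        show "K \<subseteq> ball x (d x)" using fineD[OF fine that] .
      qed
      have content: "measure lborel K = Sup K - Inf K" if "(x, K) \<in> p" for x K
        using content_real[OF pK(2)[OF that]] by (subst pK(1)[OF that])
      have ne: "(x, K) \<in> p \<Longrightarrow> K \<noteq> {}" for x K using pK(6) by blast
      define pN where "pN = {t \<in> p. fst t \<in> N}"
      define pG where "pG = {t \<in> p. fst t \<notin> N}"
      have part: "p = pN \<union> pG" "pN \<inter> pG = {}" "finite pN" "finite pG"
        using fin by (auto simp: pN_def pG_def)
      have sum_f: "f b - f a = (\<Sum>(x, K)\<in>p. f (Sup K) - f (Inf K))"
        using additive_tagged_division_1[OF ab tag, of f] by simp
      have "(\<Sum>(x, K)\<in>p. measure lborel K *\<^sub>R h x) - (f b - f a) = (\<Sum>(x, K)\<in>p. measure lborel K *\<^sub>R h x - (f (Sup K) - f (Inf K)))"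
        by (simp only: sum_f case_prod_unfold sum_subtractf)
      also have "\<dots> = (\<Sum>(x, K)\<in>pN. measure lborel K *\<^sub>R h x - (f (Sup K) - f (Inf K))) + (\<Sum>(x, K)\<in>pG. measure lborel K *\<^sub>R h x - (f (Sup K) - f (Inf K)))"
        unfolding part(1) by (rule sum.union_disjoint[OF part(3,4,2)])
      finally have split: "norm ((\<Sum>(x, K)\<in>p. measure lborel K *\<^sub>R h x) - (f b - f a)) \<le>
          norm (\<Sum>(x, K)\<in>pN. measure lborel K *\<^sub>R h x - (f (Sup K) - f (Inf K))) + norm (\<Sum>(x, K)\<in>pG. measure lborel K *\<^sub>R h x - (f (Sup K) - f (Inf K)))"
        by (simp only: norm_triangle_ineq)
      have good: "norm (\<Sum>(x, K)\<in>pG. measure lborel K *\<^sub>R h x - (f (Sup K) - f (Inf K))) \<le> e1 * (b - a)"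
      proof -
        have "norm (\<Sum>(x, K)\<in>pG. measure lborel K *\<^sub>R h x - (f (Sup K) - f (Inf K))) \<le> (\<Sum>(x, K)\<in>pG. e1 * (Sup K - Inf K))"
        proof (rule sum_norm_le)
          fix t assume tG: "t \<in> pG"
          obtain x K where t: "t = (x, K)" by (cases t)
          have xp: "(x, K) \<in> p" and xN: "x \<notin> N" using tG by (auto simp: pG_def t)
          note k = pK[OF xp]
          have xab: "x \<in> {a..b} - N" using k(5,6) xN by blast
          have "x \<in> {Inf K..Sup K}" using k(6) by (subst (asm) k(1))
          then have le: "Inf K \<le> x" "x \<le> Sup K" by simp_all
          have m: "Sup K \<in> {a..b}" "Inf K \<in> {a..b}" "Sup K \<in> ball x (d x)" "Inf K \<in> ball x (d x)"
            using k(3,4,5,7) by blast+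
          have s: "norm (f (Sup K) - f x - (Sup K - x) *\<^sub>R g x) \<le> e1 * norm (Sup K - x)"
            by (rule d(3)[OF xab]) (use m in \<open>simp_all add: dist_norm norm_minus_commute\<close>)
          have i: "norm (f (Inf K) - f x - (Inf K - x) *\<^sub>R g x) \<le> e1 * norm (Inf K - x)"
            by (rule d(3)[OF xab]) (use m in \<open>simp_all add: dist_norm norm_minus_commute\<close>)
          have E: "measure lborel K *\<^sub>R h x - (f (Sup K) - f (Inf K)) =
              (f (Inf K) - f x - (Inf K - x) *\<^sub>R g x) - (f (Sup K) - f x - (Sup K - x) *\<^sub>R g x)"
            using xN by (simp add: content[OF xp] h_def algebra_simps)
          have "norm (measure lborel K *\<^sub>R h x - (f (Sup K) - f (Inf K))) \<le> e1 * norm (Inf K - x) + e1 * norm (Sup K - x)"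
            unfolding E by (rule order_trans[OF norm_triangle_ineq4 add_mono[OF i s]])
          also have "\<dots> = e1 * (Sup K - Inf K)" using le by (simp add: algebra_simps)
          finally show "norm (case t of (x, K) \<Rightarrow> measure lborel K *\<^sub>R h x - (f (Sup K) - f (Inf K))) \<le> (case t of (x, K) \<Rightarrow> e1 * (Sup K - Inf K))"
            by (simp add: t)
        qed
        also have "\<dots> \<le> (\<Sum>(x, K)\<in>p. e1 * (Sup K - Inf K))"
          using fin pK(2) e1 by (intro sum_mono2) (auto simp: pG_def)
        also have "\<dots> = e1 * (\<Sum>(x, K)\<in>p. Sup K - Inf K)" by (simp add: sum_distrib_left case_prod_unfold)
        also have "\<dots> = e1 * (b - a)" using additive_tagged_division_1[OF ab tag, of "\<lambda>x. x"] by simp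
        finally show ?thesis .
      qed
      have bad: "norm (\<Sum>(x, K)\<in>pN. measure lborel K *\<^sub>R h x - (f (Sup K) - f (Inf K))) < e / 2"
      proof -
        have pNt: "pN tagged_division_of \<Union>(snd ` pN)"
          by (rule tagged_partial_division_of_Union_self[OF tagged_partial_division_subset[OF conjunct1[OF tag[unfolded tagged_division_of_def]]]])
             (auto simp: pN_def)
        note div = division_of_tagged_division[OF pNt]
        have subT: "\<Union>(snd ` pN) \<subseteq> T" using pK(7) d(2) by (fastforce simp: pN_def)
        have subab: "\<Union>(snd ` pN) \<subseteq> {a..b}" using pK(5) by (fastforce simp: pN_def)
        have "norm (\<Sum>(x, K)\<in>pN. measure lborel K *\<^sub>R h x - (f (Sup K) - f (Inf K))) \<le> (\<Sum>(x, K)\<in>pN. norm (f (Sup K) - f (Inf K)))"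
          by (rule sum_norm_le) (auto simp: pN_def h_def norm_minus_commute)
        \<comment> \<open>Passing from tagged pairs to intervals requires a summand that is zero on
          every interval with empty interior. One-point intervals satisfy this; for the empty set,
          where \<open>Inf\<close> and \<open>Sup\<close> carry no information, the guard enforces
          it.\<close>
        also have "\<dots> = (\<Sum>(x, K)\<in>pN. if K = {} then 0 else norm (f (Sup K) - f (Inf K)))"
          by (intro sum.cong) (auto simp: pN_def dest: ne)
        also have "\<dots> = (\<Sum>K\<in>snd ` pN. if K = {} then 0 else norm (f (Sup K) - f (Inf K)))"
        proof (rule sum.over_tagged_division_lemma[OF pNt])
          fix u v :: real assume "box u v = {}"
          then show "(if cbox u v = {} then 0 else norm (f (Sup (cbox u v)) - f (Inf (cbox u v)))) = 0"
            by (cases "u = v") auto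
        qed
        also have "\<dots> = (\<Sum>K\<in>snd ` pN. norm (f (Sup K) - f (Inf K)))"
          by (intro sum.cong) (auto simp: pN_def dest: ne)
        also have "\<dots> < e / 2"
        proof (rule \<delta>(2)[OF div subab])
          show "(\<Sum>K\<in>snd ` pN. Sup K - Inf K) < \<delta>"
            using division_length_le_measure[OF div subT Tm] Td by simp
        qed
        finally show ?thesis .
      qed
      have "e1 * (b - a) \<le> e1 * (b - a + 1)" using e1 by simp
      also have "\<dots> = e / 4"
      proof -
        have "e / (4 * D) * D = e / 4" if "D \<noteq> 0" for D using that by simp
        moreover have "b - a + 1 \<noteq> 0" using ab by linarith
        ultimately show ?thesis unfolding e1_def by blast
      qed
      finally have "e1 * (b - a) < e / 2" using e by simp
      then show "norm ((\<Sum>(x, K)\<in>p. measure lborel K *\<^sub>R h x) - (f b - f a)) < e"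
        using split good bad by linarith
    qed
  qed
  then show ?thesis by (rule has_integral_spike[OF neg, rotated]) (simp add: h_def)
qed

lemma abs_continuous_has_integral:
  fixes f :: "real \<Rightarrow> 'a::banach"
  assumes "a \<le> b" "abs_continuous_on {a..b} f"
    and der: "AE t in lebesgue. a < t \<and> t < b \<longrightarrow> (f has_vector_derivative g t) (at t)"
  shows "(g has_integral (f b - f a)) {a..b}"
proof -
  from der obtain N where N: "N \<in> null_sets lebesgue" "{t \<in> space lebesgue. \<not> (a < t \<and> t < b \<longrightarrow> (f has_vector_derivative g t) (at t))} \<subseteq> N"
    by (auto elim!: AE_E2 eventually_ae_filter[THEN iffD1, elim_format])
  show ?thesis
  proof (rule fundamental_theorem_of_calculus_abs_continuous[OF assms(1,2)])
    show "negligible (N \<union> {a, b})" using N(1) by (simp add: negligible_iff_null_sets negligible_Un null_sets_completionI)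
    fix t assume t: "t \<in> {a..b} - (N \<union> {a, b})"
    then have "(f has_vector_derivative g t) (at t)" using N(2) by (auto simp: less_le)
    then show "(f has_vector_derivative g t) (at t within {a..b})" by (rule has_vector_derivative_at_within)
  qed
qed

text \<open>Differential inequalities are integrated through this lemma. Integrability of the
  derivative is not assumed but supplied by the fundamental theorem above, so an almost everywhere
  bound is enough.\<close>

lemma abs_continuous_deriv_le:
  fixes f :: "real \<Rightarrow> real"
  assumes ab: "a \<le> b" and ac: "abs_continuous_on {a..b} f"
    and der: "AE t in lebesgue. a < t \<and> t < b \<longrightarrow> (\<exists>d. (f has_vector_derivative d) (at t) \<and> d \<le> k t)"
    and k: "k integrable_on {a..b}"
  shows "f b - f a \<le> integral {a..b} k"
proof -
  \<comment> \<open>The default \<open>k t\<close> makes \<open>g \<le> k\<close> true at every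
    point, while \<open>g\<close> is the derivative at almost every point.\<close>
  define g where "g = (\<lambda>t. if (\<exists>d. (f has_vector_derivative d) (at t) \<and> d \<le> k t)
      then (SOME d. (f has_vector_derivative d) (at t) \<and> d \<le> k t) else k t)"
  have g: "g t \<le> k t" "(\<exists>d. (f has_vector_derivative d) (at t) \<and> d \<le> k t) \<Longrightarrow> (f has_vector_derivative g t) (at t)" for t
    using someI_ex[of "\<lambda>d. (f has_vector_derivative d) (at t) \<and> d \<le> k t"] by (auto simp: g_def)
  have "(g has_integral (f b - f a)) {a..b}"
    by (rule abs_continuous_has_integral[OF ab ac]) (use der in eventually_elim, use g(2) in blast)
  then show ?thesis using has_integral_le[OF _ integrable_integral[OF k]] g(1) by blast
qed

section \<open>Poisson integrals in the upper half plane\<close>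

text \<open>The Poisson kernel of the upper half disc of radius \<open>R\<close> at \<open>i y\<close>: the pole \<open>i y\<close> is reflected in
  the real axis and in the circle, which puts the other poles at \<open>- i y\<close> and \<open>\<plusminus> i R\<^sup>2 / y\<close>.\<close>

definition segment_kernel :: "real \<Rightarrow> real \<Rightarrow> real \<Rightarrow> real"
  where "segment_kernel R y x = 1 / (x\<^sup>2 + y\<^sup>2) - R\<^sup>2 / (y\<^sup>2 * x\<^sup>2 + R^4)"

definition arc_kernel :: "real \<Rightarrow> real \<Rightarrow> real \<Rightarrow> real"
  where "arc_kernel R y \<theta> =
    2 * R * (R\<^sup>2 - y\<^sup>2) * sin \<theta> / ((R\<^sup>2 - y\<^sup>2)\<^sup>2 + 4 * R\<^sup>2 * y\<^sup>2 * (cos \<theta>)\<^sup>2)"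

definition half_disc :: "real \<Rightarrow> complex set"
  where "half_disc R = cball 0 R \<inter> {z. 0 \<le> Im z}"

lemma has_integral_segment_kernel:
  assumes "0 < y" "y < R"
  shows "(segment_kernel R y has_integral 2 / y * (arctan (R / y) - arctan (y / R))) {-R..R}"
proof -
  have R: "0 < R" using assms by simp
  have d: "((\<lambda>x. (arctan (x / y) - arctan (y * x / R\<^sup>2)) / y) has_vector_derivative
      segment_kernel R y x) (at x within {-R..R})" for x
  proof -
    have "1 + (x / y)\<^sup>2 = (x\<^sup>2 + y\<^sup>2) / y\<^sup>2" "1 + (y * x / R\<^sup>2)\<^sup>2 = (y\<^sup>2 * x\<^sup>2 + R^4) / R^4"
      using assms R by (auto simp: field_simps power2_eq_square power4_eq_xxxx)
    moreover have "x\<^sup>2 + y\<^sup>2 > 0" "y\<^sup>2 * x\<^sup>2 + R^4 > 0"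
      using assms R by (auto simp: add_nonneg_pos)
    ultimately show ?thesis
      unfolding has_real_derivative_iff_has_vector_derivative[symmetric]
      using assms R
      apply (auto intro!: derivative_eq_intros simp: segment_kernel_def)
      apply (simp add: divide_simps)
      apply (simp add: power2_eq_square power4_eq_xxxx algebra_simps)
      done
  qed
  have "(segment_kernel R y has_integral
     (arctan (R / y) - arctan (y * R / R\<^sup>2)) / y - (arctan (-R / y) - arctan (y * -R / R\<^sup>2)) / y) {-R..R}"
    by (rule fundamental_theorem_of_calculus) (use R d in auto)
  moreover have "y * R / R\<^sup>2 = y / R" "y * -R / R\<^sup>2 = - (y / R)" "-R / y = - (R / y)"
    using R by (auto simp: power2_eq_square)
  ultimately show ?thesis
    by (simp add: arctan_minus diff_divide_distrib right_diff_distrib)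
qed

lemma has_integral_arc_kernel:
  assumes "0 < y" "y < R"
  shows "(arc_kernel R y has_integral 2 / y * arctan (2 * R * y / (R\<^sup>2 - y\<^sup>2))) {0..pi}"
proof -
  have R: "0 < R" using assms by simp
  have pos: "R\<^sup>2 - y\<^sup>2 > 0" using assms by (simp add: power_strict_mono)
  define D where "D = R\<^sup>2 - y\<^sup>2"
  have D: "D > 0" using pos by (simp add: D_def)
  have d: "((\<lambda>x. - arctan (2 * R * y * cos x / D) / y) has_vector_derivative
      arc_kernel R y x) (at x within {0..pi})" for x
  proof -
    have e: "1 + (2 * R * y * cos x / D)\<^sup>2 = (D\<^sup>2 + 4 * R\<^sup>2 * y\<^sup>2 * (cos x)\<^sup>2) / D\<^sup>2"
      using D by (auto simp: field_simps power2_eq_square)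
    have p: "D\<^sup>2 + 4 * R\<^sup>2 * y\<^sup>2 * (cos x)\<^sup>2 > 0"
      using D by (simp add: add_pos_nonneg)
    show ?thesis
      unfolding has_real_derivative_iff_has_vector_derivative[symmetric] arc_kernel_def D_def[symmetric]
      using assms R D p e
      by (auto intro!: derivative_eq_intros simp: divide_simps) (simp add: power2_eq_square algebra_simps)
  qed
  have "(arc_kernel R y has_integral
     - arctan (2 * R * y * cos pi / D) / y - (- arctan (2 * R * y * cos 0 / D) / y)) {0..pi}"
    by (rule fundamental_theorem_of_calculus) (use d in auto)
  then show ?thesis by (simp add: arctan_minus D_def)
qed

text \<open>With \<open>\<theta> = arctan (y / R)\<close> the first two terms give
  \<open>pi / 2 - 2 \<theta>\<close> and the third is \<open>2 \<theta>\<close> by the double-angle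
  formula. After multiplication by \<open>2 / y\<close> the two kernels have total mass
  \<open>pi / y\<close>, which is the half-disc formula for the constant 1.\<close>

lemma kernel_masses:
  assumes "0 < y" "y < R"
  shows "arctan (R / y) - arctan (y / R) + arctan (2 * R * y / (R\<^sup>2 - y\<^sup>2)) = pi / 2"
proof -
  have R: "0 < R" using assms by simp
  have "2 * arctan (y / R) = arctan ((2 * (y / R)) / (1 - (y / R)\<^sup>2))"
    by (rule arctan_double) (use assms in auto)
  also have "(2 * (y / R)) / (1 - (y / R)\<^sup>2) = 2 * R * y / (R\<^sup>2 - y\<^sup>2)"
  proof -
    have "R\<^sup>2 - y\<^sup>2 > 0" using assms by (simp add: power_strict_mono)
    moreover have "1 - (y / R)\<^sup>2 = (R\<^sup>2 - y\<^sup>2) / R\<^sup>2" using R by (simp add: field_simps)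
    ultimately show ?thesis using R by (simp add: power2_eq_square)
  qed
  finally have 1: "arctan (2 * R * y / (R\<^sup>2 - y\<^sup>2)) = 2 * arctan (y / R)" by simp
  have "arctan (1 / (y / R)) = pi / 2 - arctan (y / R)"
    using assms R arctan_inverse[of "y / R"] by simp
  then show ?thesis using 1 by simp
qed

text \<open>The left side is the segment kernel continued to the circle of radius \<open>R\<close>,
  times the derivative of the parametrisation. On the circle the two denominators are
  \<open>cis \<theta> * w\<close> and \<open>R^2 * cis \<theta> * cnj w\<close>, so the difference
  of the fractions becomes \<open>1 / w - 1 / cnj w\<close>, which is purely imaginary, and the
  factor \<open>\<i>\<close> makes it real.\<close>

lemma complex_kernel_arc:
  fixes R y \<theta> :: real
  assumes "0 < y" "y < R"
  shows "(1 / ((R * cis \<theta>)\<^sup>2 + (of_real y)\<^sup>2) - (of_real R)\<^sup>2 / ((of_real y)\<^sup>2 * (R * cis \<theta>)\<^sup>2 + of_real R^4)) * R * \<i> * cis \<theta>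
    = of_real (arc_kernel R y \<theta>)"
proof -
  have R: "0 < R" using assms by simp
  define w where "w = of_real (R\<^sup>2) * cis \<theta> + of_real (y\<^sup>2) * cis (-\<theta>)"
  have D: "R\<^sup>2 - y\<^sup>2 > 0" using assms by (simp add: power_strict_mono)
  have ww: "w * cnj w = of_real ((R\<^sup>2 - y\<^sup>2)\<^sup>2 + 4 * R\<^sup>2 * y\<^sup>2 * (cos \<theta>)\<^sup>2)"
  proof -
    have s: "(sin \<theta>)\<^sup>2 = 1 - (cos \<theta>)\<^sup>2" by (simp add: sin_squared_eq)
    have r: "Re w = (R\<^sup>2 + y\<^sup>2) * cos \<theta>" and i: "Im w = (R\<^sup>2 - y\<^sup>2) * sin \<theta>"
      by (simp_all add: w_def algebra_simps)
    have "(Re w)\<^sup>2 + (Im w)\<^sup>2 = (R\<^sup>2 - y\<^sup>2)\<^sup>2 + 4 * R\<^sup>2 * y\<^sup>2 * (cos \<theta>)\<^sup>2"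
      unfolding r i power_mult_distrib s by (simp add: power2_eq_square algebra_simps)
    then show ?thesis by (simp only: complex_mult_cnj)
  qed
  have wn: "w \<noteq> 0"
  proof
    assume "w = 0"
    with ww have "(of_real ((R\<^sup>2 - y\<^sup>2)\<^sup>2 + 4 * R\<^sup>2 * y\<^sup>2 * (cos \<theta>)\<^sup>2) :: complex) = 0" by simp
    then have "(R\<^sup>2 - y\<^sup>2)\<^sup>2 + 4 * R\<^sup>2 * y\<^sup>2 * (cos \<theta>)\<^sup>2 = 0" by (simp only: of_real_eq_0_iff)
    moreover have "(R\<^sup>2 - y\<^sup>2)\<^sup>2 > 0" "4 * R\<^sup>2 * y\<^sup>2 * (cos \<theta>)\<^sup>2 \<ge> 0" using D by auto
    ultimately show False by linarith
  qed
  have a: "(R * cis \<theta>)\<^sup>2 + (of_real y)\<^sup>2 = cis \<theta> * w"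
    unfolding w_def by (simp add: power2_eq_square algebra_simps cis_mult)
  have cw: "cnj w = of_real (R\<^sup>2) * cis (-\<theta>) + of_real (y\<^sup>2) * cis \<theta>"
    by (simp add: w_def cis_cnj)
  have b: "(of_real y)\<^sup>2 * (R * cis \<theta>)\<^sup>2 + of_real R^4 = of_real (R\<^sup>2) * cis \<theta> * cnj w"
    unfolding cw by (simp add: power2_eq_square power4_eq_xxxx algebra_simps cis_mult)
  have "(1 / ((R * cis \<theta>)\<^sup>2 + (of_real y)\<^sup>2) - (of_real R)\<^sup>2 / ((of_real y)\<^sup>2 * (R * cis \<theta>)\<^sup>2 + of_real R^4)) * R * \<i> * cis \<theta>
     = (1 / w - 1 / cnj w) * R * \<i>"
    unfolding a b using R by (simp add: field_simps wn)
  also have "\<dots> = (cnj w - w) / (w * cnj w) * R * \<i>"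
    using wn by (simp add: field_simps)
  also have "cnj w - w = - 2 * \<i> * of_real ((R\<^sup>2 - y\<^sup>2) * sin \<theta>)"
    unfolding w_def by (simp add: complex_eq_iff algebra_simps)
  finally show ?thesis
    unfolding ww arc_kernel_def by (simp add: field_simps)
qed

lemma interior_halfspace_Im_ge: "interior {z. c \<le> Im z} = {z. c < Im z}"
  using interior_halfspace_ge[of \<i> c] by (simp add: inner_complex_def)

text \<open>Cauchy's theorem for \<open>f - f (\<i> y)\<close> times the kernel. The subtraction
  cancels the pole at \<open>\<i> y\<close>, the reflected poles lie outside the half disc, so the
  boundary integral is zero; the masses of the two kernels then restore the value
  \<open>f (\<i> y)\<close>.\<close>

lemma half_disc_formula:
  fixes f :: "complex \<Rightarrow> complex"
  assumes y: "0 < y" "y < R"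
    and cont: "continuous_on (half_disc R) f"
    and hol: "f holomorphic_on interior (half_disc R)"
  shows "f (\<i> * y) = (y / pi) *
      (integral {-R..R} (\<lambda>x. f (of_real x) * segment_kernel R y x)
       + integral {0..pi} (\<lambda>\<theta>. f (R * cis \<theta>) * arc_kernel R y \<theta>))"
proof -
  have R: "0 < R" using y by simp
  define z0 where "z0 = \<i> * of_real y"
  define S where "S = half_disc R"
  have Seq: "S = cball 0 R \<inter> {z. 0 \<le> Im z}" by (simp add: S_def half_disc_def)
  have conv: "convex S" unfolding Seq by (intro convex_Int convex_cball convex_halfspace_Im_ge)
  have intS: "interior S = ball 0 R \<inter> {z. 0 < Im z}"
    unfolding Seq by (simp add: interior_Int interior_halfspace_Im_ge)
  have z0: "z0 \<in> interior S" using y unfolding intS z0_def by (auto simp: norm_mult)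
  \<comment> \<open>The difference quotient with its limit filled in at \<open>z0\<close>. The
    Cauchy theorem used below admits finitely many points of mere continuity, and \<open>z0\<close>
    is the only one.\<close>
  define \<phi> where "\<phi> = (\<lambda>w. if w = z0 then deriv f z0 else (f w - f z0) / (w - z0))"
  define F where "F = (\<lambda>w. \<phi> w / (w + z0) - (f w - f z0) * (of_real R)\<^sup>2 / ((of_real y)\<^sup>2 * w\<^sup>2 + of_real R^4))"
  have holS: "f holomorphic_on interior S" using hol by (simp add: S_def)
  have fd: "f field_differentiable at w" if "w \<in> interior S" for w
    using holS that by (simp add: holomorphic_on_imp_differentiable_at)
  have contS: "continuous_on S f" using cont by (simp add: S_def)
  have nz1: "w + z0 \<noteq> 0" if "w \<in> S" for w
    using that y by (auto simp: Seq z0_def complex_eq_iff)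
  \<comment> \<open>A zero would be one of the points \<open>\<plusminus> \<i> R^2 / y\<close>,
    whose modulus exceeds \<open>R\<close>.\<close>
  have nz2: "(of_real y)\<^sup>2 * w\<^sup>2 + of_real R^4 \<noteq> 0" if "w \<in> S" for w
  proof
    assume "(of_real y)\<^sup>2 * w\<^sup>2 + of_real R^4 = 0"
    then have "of_real R^4 = - (of_real y)\<^sup>2 * w\<^sup>2" by (simp add: eq_neg_iff_add_eq_0 add.commute)
    then have "norm ((of_real R :: complex)^4) = norm (- (of_real y)\<^sup>2 * w\<^sup>2)" by simp
    then have "R^4 = y\<^sup>2 * (norm w)\<^sup>2" using R y by (simp add: norm_mult norm_power)
    moreover have "(norm w)\<^sup>2 \<le> R\<^sup>2" using that by (simp add: Seq power_mono)
    moreover have "y\<^sup>2 * (norm w)\<^sup>2 \<le> y\<^sup>2 * R\<^sup>2" using calculation(2) by (simp add: mult_left_mono)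
    moreover have "y\<^sup>2 < R\<^sup>2" using y by (simp add: power_strict_mono)
    then have "y\<^sup>2 * R\<^sup>2 < R\<^sup>2 * R\<^sup>2" using R by (intro mult_strict_right_mono) auto
    ultimately show False by (simp add: power4_eq_xxxx power2_eq_square)
  qed
  have cont\<phi>: "continuous_on S \<phi>"
  proof -
    have "isCont \<phi> z0"
    proof -
      have "(f has_field_derivative deriv f z0) (at z0)"
        using fd[OF z0] by (simp add: field_differentiable_derivI)
      then have "((\<lambda>w. (f w - f z0) / (w - z0)) \<longlongrightarrow> deriv f z0) (at z0)"
        by (simp add: has_field_derivative_iff)
      moreover have "(\<phi> \<longlongrightarrow> deriv f z0) (at z0) \<longleftrightarrow> ((\<lambda>w. (f w - f z0) / (w - z0)) \<longlongrightarrow> deriv f z0) (at z0)"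
        by (rule Lim_cong_within) (auto simp: \<phi>_def)
      ultimately show ?thesis by (simp add: isCont_def \<phi>_def)
    qed
    moreover have "continuous (at w within S) \<phi>" if "w \<in> S" "w \<noteq> z0" for w
    proof -
      have "continuous (at w within S) (\<lambda>w. (f w - f z0) / (w - z0))"
        using contS that by (intro continuous_intros) (auto simp: continuous_on_eq_continuous_within)
      moreover have "\<forall>\<^sub>F u in at w within S. (f u - f z0) / (u - z0) = \<phi> u"
      proof -
        have "\<forall>\<^sub>F u in at w within S. u \<noteq> z0"
          by (rule eventually_neq_at_within)
        then show ?thesis by (rule eventually_mono) (auto simp: \<phi>_def)
      qed
      ultimately show ?thesis
        using that unfolding continuous_within
        by (simp add: \<phi>_def Lim_transform_eventually)
    qed
    ultimately show ?thesis
      by (metis continuous_at_imp_continuous_at_within continuous_on_eq_continuous_within)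
  qed
  have contF: "continuous_on S F"
    unfolding F_def using nz1 nz2 by (intro continuous_intros cont\<phi> contS) auto
  have fdF: "F field_differentiable at w" if w: "w \<in> interior S - {z0}" for w
  proof -
    have wS: "w \<in> S" using w interior_subset by auto
    have fd1: "(\<lambda>w. (f w - f z0) / (w - z0) / (w + z0) - (f w - f z0) * (of_real R)\<^sup>2 / ((of_real y)\<^sup>2 * w\<^sup>2 + of_real R^4))
       field_differentiable at w"
      using w nz1[OF wS] nz2[OF wS] fd[of w] by (intro derivative_intros) auto
    have "\<forall>\<^sub>F u in nhds w. u \<noteq> z0" using w
      by (intro t1_space_nhds) auto
    then have ev: "\<forall>\<^sub>F u in nhds w. F u = (f u - f z0) / (u - z0) / (u + z0) - (f u - f z0) * (of_real R)\<^sup>2 / ((of_real y)\<^sup>2 * u\<^sup>2 + of_real R^4)"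
      by (rule eventually_mono) (auto simp: F_def \<phi>_def)
    show ?thesis using fd1 unfolding field_differentiable_def
      by (subst DERIV_cong_ev[OF refl ev refl])
  qed
  define g where "g = linepath (of_real (-R)) (of_real R) +++ part_circlepath 0 R 0 pi"
  have vp: "valid_path g" unfolding g_def by (intro valid_path_join) (auto simp: rcis_def)
  have seg: "path_image (linepath (of_real (-R)) (of_real R)) \<subseteq> S"
  proof -
    have "of_real (-R) \<in> S" "of_real R \<in> S" using R by (auto simp: Seq)
    then show ?thesis unfolding path_image_linepath by (rule closed_segment_subset[OF _ _ conv])
  qed
  have arc: "path_image (part_circlepath 0 R 0 pi) \<subseteq> S"
    unfolding path_image_part_circlepath' using R
    by (auto simp: Seq closed_segment_eq_real_ivl norm_mult intro!: mult_nonneg_nonneg sin_ge_zero)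
  have pi: "path_image g \<subseteq> S" unfolding g_def using seg arc by (auto simp: path_image_join)
  have loop: "pathfinish g = pathstart g" unfolding g_def by (simp add: rcis_def cis_conv_exp[symmetric])
  have "(F has_contour_integral 0) g"
    by (rule Cauchy_theorem_convex[OF contF conv, of "{z0}"]) (use fdF vp pi loop in auto)
  moreover have c1: "F contour_integrable_on linepath (of_real (-R)) (of_real R)"
    by (rule contour_integrable_continuous_linepath) (use contF seg in \<open>auto intro: continuous_on_subset\<close>)
  have c2: "F contour_integrable_on part_circlepath 0 R 0 pi"
    by (rule contour_integrable_continuous_part_circlepath) (use contF arc in \<open>auto intro: continuous_on_subset\<close>)
  ultimately have sum0: "contour_integral (linepath (of_real (-R)) (of_real R)) F + contour_integral (part_circlepath 0 R 0 pi) F = 0"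
    unfolding g_def using c1 c2
    by (subst contour_integral_join[symmetric]) (auto simp: rcis_def dest: contour_integral_unique)
  have h1: "((\<lambda>x. F (of_real x)) has_integral contour_integral (linepath (of_real (-R)) (of_real R)) F) {-R..R}"
    using has_contour_integral_integral[OF c1] R
    by (subst (asm) has_contour_integral_linepath_Reals_iff) auto
  have h2: "((\<lambda>t. F (R * cis t) * R * \<i> * cis t) has_integral contour_integral (part_circlepath 0 R 0 pi) F) {0..pi}"
    using has_contour_integral_integral[OF c2]
    by (subst (asm) has_contour_integral_part_circlepath_iff) auto
  have F_eq: "F w = (f w - f z0) * (1 / (w\<^sup>2 + (of_real y)\<^sup>2) - (of_real R)\<^sup>2 / ((of_real y)\<^sup>2 * w\<^sup>2 + of_real R^4))"
    if "w \<noteq> z0" for w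
  proof -
    have "(w - z0) * (w + z0) = w\<^sup>2 + (of_real y)\<^sup>2"
      by (simp add: z0_def power2_eq_square algebra_simps)
    then have "F w = (f w - f z0) / (w\<^sup>2 + (of_real y)\<^sup>2) - (f w - f z0) * (of_real R)\<^sup>2 / ((of_real y)\<^sup>2 * w\<^sup>2 + of_real R^4)"
      using that by (simp add: F_def \<phi>_def)
    then show ?thesis by (simp add: algebra_simps)
  qed
  have s1: "F (of_real x) = (f (of_real x) - f z0) * segment_kernel R y x" for x
  proof -
    have "complex_of_real x \<noteq> z0" using y by (auto simp: z0_def complex_eq_iff)
    then show ?thesis by (simp add: F_eq segment_kernel_def)
  qed
  have s2: "F (R * cis t) * R * \<i> * cis t = (f (R * cis t) - f z0) * arc_kernel R y t" for t
  proof -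
    have "norm (R * cis t) \<noteq> norm z0" using y R by (simp add: z0_def norm_mult)
    then have "R * cis t \<noteq> z0" by metis
    then show ?thesis
      using complex_kernel_arc[OF y, of t] by (simp add: F_eq mult.assoc)
  qed
  let ?K1 = "2 / y * (arctan (R / y) - arctan (y / R))"
  let ?K2 = "2 / y * arctan (2 * R * y / (R\<^sup>2 - y\<^sup>2))"
  have k1: "((\<lambda>x. f z0 * of_real (segment_kernel R y x)) has_integral f z0 * of_real ?K1) {-R..R}"
    by (intro has_integral_mult_right has_integral_of_real has_integral_segment_kernel y)
  have k2: "((\<lambda>x. f z0 * of_real (arc_kernel R y x)) has_integral f z0 * of_real ?K2) {0..pi}"
    by (intro has_integral_mult_right has_integral_of_real has_integral_arc_kernel y)
  have i1: "integral {-R..R} (\<lambda>x. f (of_real x) * segment_kernel R y x)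
       = contour_integral (linepath (of_real (-R)) (of_real R)) F + f z0 * of_real ?K1"
    using has_integral_add[OF h1 k1] by (intro integral_unique) (simp add: s1 algebra_simps)
  have i2: "integral {0..pi} (\<lambda>x. f (R * cis x) * arc_kernel R y x)
       = contour_integral (part_circlepath 0 R 0 pi) F + f z0 * of_real ?K2"
    using has_integral_add[OF h2 k2] by (intro integral_unique) (simp only: s2, simp add: algebra_simps)
  have "?K1 + ?K2 = 2 / y * (pi / 2)"
    unfolding kernel_masses[OF y, symmetric] by (simp only: distrib_left)
  then have "?K1 + ?K2 = pi / y" by simp
  then have kk: "(of_real ?K1 + of_real ?K2 :: complex) = of_real (pi / y)" by (metis of_real_add)
  have "integral {-R..R} (\<lambda>x. f (of_real x) * segment_kernel R y x)
       + integral {0..pi} (\<lambda>\<theta>. f (R * cis \<theta>) * arc_kernel R y \<theta>) = f z0 * (of_real ?K1 + of_real ?K2)"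
    unfolding i1 i2 using sum0 by (simp add: algebra_simps)
  then show ?thesis
    unfolding kk using y by (simp add: z0_def)
qed

section \<open>Harmonic functions up to the boundary and their Herglotz representation\<close>

text \<open>The holomorphic function is chosen for each half disc separately, which is all that the
  half-disc formula needs. For \<open>ln |q|\<close> a branch of the logarithm is then required only
  near a compact set, on a neighbourhood whose width may depend on \<open>R\<close>.\<close>

definition harmonic_half_plane :: "(complex \<Rightarrow> real) \<Rightarrow> bool"
  where "harmonic_half_plane u \<longleftrightarrow> (\<forall>R>0. \<exists>f. continuous_on (half_disc R) f \<and>
     f holomorphic_on interior (half_disc R) \<and> (\<forall>z\<in>half_disc R. Re (f z) = u z))"

lemma half_disc_formula_real:
  assumes u: "harmonic_half_plane u" and y: "0 < y" "y < R"
  shows "(\<lambda>x. u (of_real x) * segment_kernel R y x) integrable_on {-R..R}"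
    and "(\<lambda>\<theta>. u (R * cis \<theta>) * arc_kernel R y \<theta>) integrable_on {0..pi}"
    and "u (\<i> * y) = (y / pi) *
      (integral {-R..R} (\<lambda>x. u (of_real x) * segment_kernel R y x)
       + integral {0..pi} (\<lambda>\<theta>. u (R * cis \<theta>) * arc_kernel R y \<theta>))"
proof -
  have R: "R > 0" using y by simp
  obtain f where f: "continuous_on (half_disc R) f" "f holomorphic_on interior (half_disc R)"
    "\<And>z. z \<in> half_disc R \<Longrightarrow> Re (f z) = u z"
    using u R unfolding harmonic_half_plane_def by blast
  have pos: "x\<^sup>2 + y\<^sup>2 > 0" "y\<^sup>2 * x\<^sup>2 + R^4 > 0" for x
    using y R by (auto simp: add_nonneg_pos)
  have k1: "continuous_on {-R..R} (\<lambda>x. of_real (segment_kernel R y x) :: complex)"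
    unfolding segment_kernel_def using pos by (intro continuous_intros) (auto simp: less_imp_neq[symmetric])
  have "0 < R\<^sup>2 - y\<^sup>2" using y by (simp add: power_strict_mono)
  then have pos2: "(R\<^sup>2 - y\<^sup>2)\<^sup>2 + 4 * R\<^sup>2 * y\<^sup>2 * (cos \<theta>)\<^sup>2 > 0" for \<theta>
    by (simp add: add_pos_nonneg)
  have k2: "continuous_on {0..pi} (\<lambda>x. of_real (arc_kernel R y x) :: complex)"
    unfolding arc_kernel_def using pos2 by (intro continuous_intros) (auto simp: less_imp_neq[symmetric])
  have m1: "of_real x \<in> half_disc R" if "x \<in> {-R..R}" for x
    using that by (auto simp: half_disc_def)
  have m2: "of_real R * cis t \<in> half_disc R" if "t \<in> {0..pi}" for t
    using that R by (auto simp: half_disc_def norm_mult intro!: mult_nonneg_nonneg sin_ge_zero)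
  have c1: "continuous_on {-R..R} (\<lambda>x. f (of_real x))"
    by (rule continuous_on_compose2[OF f(1)]) (use m1 in \<open>auto intro!: continuous_intros\<close>)
  have c2: "continuous_on {0..pi} (\<lambda>t. f (R * cis t))"
    by (rule continuous_on_compose2[OF f(1)]) (use m2 in \<open>auto intro!: continuous_intros\<close>)
  have h1: "((\<lambda>x. f (of_real x) * of_real (segment_kernel R y x)) has_integral integral {-R..R} (\<lambda>x. f (of_real x) * of_real (segment_kernel R y x))) {-R..R}"
    by (intro integrable_integral integrable_continuous_real continuous_on_mult c1 k1)
  have h2: "((\<lambda>x. f (R * cis x) * of_real (arc_kernel R y x)) has_integral integral {0..pi} (\<lambda>x. f (R * cis x) * of_real (arc_kernel R y x))) {0..pi}"
    by (intro integrable_integral integrable_continuous_real continuous_on_mult c2 k2)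
  have r1: "((\<lambda>x. u (of_real x) * segment_kernel R y x) has_integral Re (integral {-R..R} (\<lambda>x. f (of_real x) * of_real (segment_kernel R y x)))) {-R..R}"
    using has_integral_Re[OF h1] by (rule has_integral_eq[rotated]) (use f(3) m1 in auto)
  have r2: "((\<lambda>x. u (R * cis x) * arc_kernel R y x) has_integral Re (integral {0..pi} (\<lambda>x. f (R * cis x) * of_real (arc_kernel R y x)))) {0..pi}"
    using has_integral_Re[OF h2] by (rule has_integral_eq[rotated]) (use f(3) m2 in auto)
  show "(\<lambda>x. u (of_real x) * segment_kernel R y x) integrable_on {-R..R}"
    "(\<lambda>\<theta>. u (R * cis \<theta>) * arc_kernel R y \<theta>) integrable_on {0..pi}"
    using r1 r2 by (auto simp: integrable_on_def)
  have "\<i> * of_real y \<in> half_disc R" using y by (auto simp: half_disc_def norm_mult)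
  then have "u (\<i> * y) = Re (f (\<i> * y))" using f(3) by simp
  also have "\<dots> = (y / pi) * (Re (integral {-R..R} (\<lambda>x. f (of_real x) * of_real (segment_kernel R y x))) +
      Re (integral {0..pi} (\<lambda>x. f (R * cis x) * of_real (arc_kernel R y x))))"
    unfolding half_disc_formula[OF y f(1,2)] by (simp flip: of_real_divide)
  finally show "u (\<i> * y) = (y / pi) *
      (integral {-R..R} (\<lambda>x. u (of_real x) * segment_kernel R y x)
       + integral {0..pi} (\<lambda>\<theta>. u (R * cis \<theta>) * arc_kernel R y \<theta>))"
    using r1 r2 by (simp add: integral_unique)
qed

lemma harmonic_half_plane_continuous:
  assumes "harmonic_half_plane u"
  shows "continuous_on {z. 0 \<le> Im z} u"
proof -
  have "continuous (at z within {z. 0 \<le> Im z}) u" if z: "0 \<le> Im z" for z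
  proof -
    define R where "R = norm z + 1"
    have R: "R > 0" by (simp add: R_def add_nonneg_pos)
    obtain f where f: "continuous_on (half_disc R) f" "\<And>z. z \<in> half_disc R \<Longrightarrow> Re (f z) = u z"
      using assms R unfolding harmonic_half_plane_def by blast
    have "continuous_on (half_disc R) u"
      using continuous_on_Re[OF f(1)] by (rule continuous_on_cong[THEN iffD1, rotated -1]) (use f in auto)
    then have "continuous (at z within half_disc R) u"
      using z by (auto simp: continuous_on_eq_continuous_within half_disc_def R_def)
    moreover have "at z within half_disc R = at z within {z. 0 \<le> Im z}"
      by (rule at_within_nhd[of _ "ball 0 R"]) (auto simp: half_disc_def R_def)
    ultimately show ?thesis by simp
  qed
  then show ?thesis by (auto simp: continuous_on_eq_continuous_within)
qed

lemma harmonic_half_plane_continuous_real: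
  assumes "harmonic_half_plane u"
  shows "continuous_on UNIV (\<lambda>x. u (of_real x))"
  by (rule continuous_on_compose2[OF harmonic_half_plane_continuous[OF assms]])
     (auto intro!: continuous_intros)

lemma segment_kernel_bounds:
  assumes "0 < y" "y < R" "x \<in> {-R..R}"
  shows "0 \<le> segment_kernel R y x" "segment_kernel R y x \<le> 1 / (x\<^sup>2 + y\<^sup>2)"
proof -
  have "R\<^sup>2 - y\<^sup>2 \<ge> 0" "R\<^sup>2 - x\<^sup>2 \<ge> 0" using assms by (auto simp: abs_le_square_iff[symmetric])
  then have "(R\<^sup>2 - y\<^sup>2) * (R\<^sup>2 - x\<^sup>2) \<ge> 0" by simp
  then have "R\<^sup>2 * (x\<^sup>2 + y\<^sup>2) \<le> y\<^sup>2 * x\<^sup>2 + R^4"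
    by (simp add: algebra_simps power4_eq_xxxx power2_eq_square)
  moreover have "x\<^sup>2 + y\<^sup>2 > 0" "y\<^sup>2 * x\<^sup>2 + R^4 > 0" using assms by (auto simp: add_nonneg_pos)
  ultimately show "0 \<le> segment_kernel R y x"
    by (simp add: segment_kernel_def divide_le_eq pos_le_divide_eq)
  show "segment_kernel R y x \<le> 1 / (x\<^sup>2 + y\<^sup>2)"
    by (simp add: segment_kernel_def)
qed

lemma segment_kernel_tendsto:
  assumes "0 < y"
  shows "(\<lambda>n. segment_kernel (real n) y x) \<longlonglongrightarrow> 1 / (x\<^sup>2 + y\<^sup>2)"
proof -
  have "((\<lambda>n. (real n)\<^sup>2 / (y\<^sup>2 * x\<^sup>2 + real n^4)) \<longlonglongrightarrow> 0)" by real_asymp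
  from tendsto_diff[OF tendsto_const this] show ?thesis unfolding segment_kernel_def by simp
qed

text \<open>Both factors of \<open>sin \<theta>\<close> are asymptotic to \<open>2 / R\<close> as
  \<open>R\<close> grows, whatever \<open>y\<close> is. The contribution of the arc to the half-disc
  formula thus has a limit independent of \<open>y\<close>, and this limit produces the linear term
  of \<open>herglotz\<close>.\<close>

lemma arc_kernel_bounds:
  assumes "0 < y" "y < R" "\<theta> \<in> {0..pi}"
  shows "sin \<theta> * (2 * R * (R\<^sup>2 - y\<^sup>2) / (R\<^sup>2 + y\<^sup>2)\<^sup>2) \<le> arc_kernel R y \<theta>"
    "arc_kernel R y \<theta> \<le> sin \<theta> * (2 * R / (R\<^sup>2 - y\<^sup>2))"
proof -
  have R: "R > 0" and D: "R\<^sup>2 - y\<^sup>2 > 0" using assms by (auto simp: power_strict_mono)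
  have s: "sin \<theta> \<ge> 0" using assms sin_ge_zero by auto
  have c: "(cos \<theta>)\<^sup>2 \<le> 1" by (simp add: abs_square_le_1)
  have l: "(R\<^sup>2 - y\<^sup>2)\<^sup>2 \<le> (R\<^sup>2 - y\<^sup>2)\<^sup>2 + 4 * R\<^sup>2 * y\<^sup>2 * (cos \<theta>)\<^sup>2" by simp
  have "4 * R\<^sup>2 * y\<^sup>2 * (cos \<theta>)\<^sup>2 \<le> 4 * R\<^sup>2 * y\<^sup>2 * 1" using c by (intro mult_left_mono) auto
  then have r: "(R\<^sup>2 - y\<^sup>2)\<^sup>2 + 4 * R\<^sup>2 * y\<^sup>2 * (cos \<theta>)\<^sup>2 \<le> (R\<^sup>2 + y\<^sup>2)\<^sup>2"
    by (simp add: power2_eq_square algebra_simps)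
  have D2: "0 < (R\<^sup>2 - y\<^sup>2)\<^sup>2" using D by simp
  have n: "0 \<le> 2 * R * (R\<^sup>2 - y\<^sup>2) * sin \<theta>" using R D s by simp
  have "2 * R * (R\<^sup>2 - y\<^sup>2) * sin \<theta> / (R\<^sup>2 + y\<^sup>2)\<^sup>2 \<le> arc_kernel R y \<theta>"
    unfolding arc_kernel_def using less_le_trans[OF D2 l] less_le_trans[OF less_le_trans[OF D2 l] r] r n
    by (intro divide_left_mono mult_pos_pos)
  then show "sin \<theta> * (2 * R * (R\<^sup>2 - y\<^sup>2) / (R\<^sup>2 + y\<^sup>2)\<^sup>2) \<le> arc_kernel R y \<theta>"
    by (simp add: mult_ac)
  have "arc_kernel R y \<theta> \<le> 2 * R * (R\<^sup>2 - y\<^sup>2) * sin \<theta> / (R\<^sup>2 - y\<^sup>2)\<^sup>2"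
    unfolding arc_kernel_def using less_le_trans[OF D2 l] D2 l n by (intro divide_left_mono mult_pos_pos)
  also have "\<dots> = sin \<theta> * (2 * R / (R\<^sup>2 - y\<^sup>2))" using D by (simp add: power2_eq_square)
  finally show "arc_kernel R y \<theta> \<le> sin \<theta> * (2 * R / (R\<^sup>2 - y\<^sup>2))" .
qed

text \<open>The radius \<open>R = n\<close> tends to infinity in the half-disc formula. The arc part
  is nonnegative, so the segment part stays below a constant and Fatou's lemma gives integrability;
  dominated convergence then yields the integral over the line. What remains is the limit of the arc
  part, squeezed between multiples of \<open>\<alpha> n * (2 / n)\<close>.\<close>

lemma herglotz:
  assumes u: "harmonic_half_plane u" and nonneg: "\<And>z. 0 \<le> Im z \<Longrightarrow> 0 \<le> u z"
  obtains c where "0 \<le> c"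
    "\<And>y. 0 < y \<Longrightarrow> integrable lborel (\<lambda>x. u (of_real x) / (x\<^sup>2 + y\<^sup>2))"
    "\<And>y. 0 < y \<Longrightarrow> u (\<i> * y) = c * y + (y / pi) * (\<integral>x. u (of_real x) / (x\<^sup>2 + y\<^sup>2) \<partial>lborel)"
proof -
  define U where "U = (\<lambda>x::real. u (of_real x))"
  have contU: "continuous_on A U" for A
    using harmonic_half_plane_continuous_real[OF u] unfolding U_def by (rule continuous_on_subset) auto
  have Upos: "0 \<le> U x" for x by (simp add: U_def nonneg)
  have [measurable]: "U \<in> borel_measurable borel" using contU by (simp add: borel_measurable_continuous_onI)
  define s where "s = (\<lambda>y n x. indicator {- real n..real n} x *\<^sub>R (U x * segment_kernel (real n) y x))"
  define \<alpha> where "\<alpha> = (\<lambda>n. integral {0..pi} (\<lambda>\<theta>. u (real n * cis \<theta>) * sin \<theta>))"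
  define J where "J = (\<lambda>y. \<integral>x. U x / (x\<^sup>2 + y\<^sup>2) \<partial>lborel)"
  have main: "integrable lborel (\<lambda>x. U x / (x\<^sup>2 + y\<^sup>2)) \<and> (\<lambda>n. \<alpha> n * (2 / real n)) \<longlonglongrightarrow> pi * u (\<i> * y) / y - J y"
    if y: "0 < y" for y
  proof -
    define N where "N = Suc (nat \<lceil>y\<rceil>)"
    have N: "y < real n" if "n \<ge> N" for n using that unfolding N_def by linarith
    define SegI where "SegI = (\<lambda>n. integral {- real n..real n} (\<lambda>x. U x * segment_kernel (real n) y x))"
    define ArcI where "ArcI = (\<lambda>n. integral {0..pi} (\<lambda>\<theta>. u (real n * cis \<theta>) * arc_kernel (real n) y \<theta>))"
    have form: "SegI n + ArcI n = pi * u (\<i> * y) / y" if "n \<ge> N" for n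
      using half_disc_formula_real(3)[OF u y N[OF that]] y unfolding SegI_def ArcI_def U_def
      by (simp add: field_simps)
    have u_arc: "0 \<le> u (real n * cis \<theta>)" if "\<theta> \<in> {0..pi}" for n \<theta>
      using that by (intro nonneg) (auto intro!: mult_nonneg_nonneg sin_ge_zero)
    have Arc_nonneg: "0 \<le> ArcI n" if "n \<ge> N" for n
      unfolding ArcI_def
    proof (rule integral_nonneg[OF half_disc_formula_real(2)[OF u y N[OF that]]])
      fix \<theta> assume t: "\<theta> \<in> {0..pi}"
      have "0 \<le> sin \<theta> * (2 * real n * ((real n)\<^sup>2 - y\<^sup>2) / ((real n)\<^sup>2 + y\<^sup>2)\<^sup>2)"
        using t sin_ge_zero N[OF that] y by (auto intro!: mult_nonneg_nonneg divide_nonneg_nonneg power_mono)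
      then show "0 \<le> u (real n * cis \<theta>) * arc_kernel (real n) y \<theta>"
        using u_arc[OF t, of n] arc_kernel_bounds(1)[OF y N[OF that] t] by (intro mult_nonneg_nonneg) auto
    qed
    have s_int: "integrable lborel (s y n)" and s_val: "integral\<^sup>L lborel (s y n) = SegI n" if "n \<ge> N" for n
    proof -
      have "0 < x\<^sup>2 + y\<^sup>2" "0 < y\<^sup>2 * x\<^sup>2 + real n^4" for x using y N[OF that] by (auto simp: add_nonneg_pos)
      then have c: "continuous_on {- real n..real n} (\<lambda>x. U x * segment_kernel (real n) y x)"
        unfolding segment_kernel_def
        by (intro continuous_intros contU) (auto simp: less_imp_neq[symmetric])
      then show 1: "integrable lborel (s y n)"
        unfolding s_def using borel_integrable_compact[OF compact_Icc c] by simp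
      then show "integral\<^sup>L lborel (s y n) = SegI n"
        using set_borel_integral_eq_integral(2)[of "{- real n..real n}" "\<lambda>x. U x * segment_kernel (real n) y x"]
        unfolding s_def SegI_def set_lebesgue_integral_def set_integrable_def by simp
    qed
    have s_lim: "(\<lambda>n. s y n x) \<longlonglongrightarrow> U x / (x\<^sup>2 + y\<^sup>2)" for x
    proof -
      have "(\<lambda>n. U x * segment_kernel (real n) y x) \<longlonglongrightarrow> U x * (1 / (x\<^sup>2 + y\<^sup>2))"
        by (intro tendsto_intros segment_kernel_tendsto y)
      moreover have "\<forall>\<^sub>F n in sequentially. U x * segment_kernel (real n) y x = s y n x"
        using eventually_ge_at_top[of "nat \<lceil>\<bar>x\<bar>\<rceil>"]
        by eventually_elim (auto simp: s_def indicator_def; linarith)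
      ultimately show ?thesis by (simp add: tendsto_cong)
    qed
    have s_nonneg: "0 \<le> s y n x" and s_le: "s y n x \<le> U x / (x\<^sup>2 + y\<^sup>2)" if "n \<ge> N" for n x
    proof -
      show "0 \<le> s y n x"
        using segment_kernel_bounds(1)[OF y N[OF that], of x] Upos[of x] by (auto simp: s_def indicator_def)
      have "U x * segment_kernel (real n) y x \<le> U x * (1 / (x\<^sup>2 + y\<^sup>2))" if "x \<in> {- real n..real n}"
        using segment_kernel_bounds(2)[OF y N[OF \<open>n \<ge> N\<close>] that] Upos[of x] by (intro mult_left_mono)
      moreover have "0 \<le> U x / (x\<^sup>2 + y\<^sup>2)" using Upos[of x] by simp
      ultimately show "s y n x \<le> U x / (x\<^sup>2 + y\<^sup>2)" by (auto simp: s_def indicator_def)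
    qed
    have int: "integrable lborel (\<lambda>x. U x / (x\<^sup>2 + y\<^sup>2))"
    proof (rule integrableI_bounded)
      have "(\<integral>\<^sup>+ x. ennreal (norm (U x / (x\<^sup>2 + y\<^sup>2))) \<partial>lborel) =
          (\<integral>\<^sup>+ x. liminf (\<lambda>n. ennreal (s y (n + N) x)) \<partial>lborel)"
      proof (rule nn_integral_cong)
        fix x
        have "(\<lambda>n. ennreal (s y (n + N) x)) \<longlonglongrightarrow> ennreal (U x / (x\<^sup>2 + y\<^sup>2))"
          by (intro tendsto_ennrealI LIMSEQ_ignore_initial_segment s_lim)
        then show "ennreal (norm (U x / (x\<^sup>2 + y\<^sup>2))) = liminf (\<lambda>n. ennreal (s y (n + N) x))"
          using Upos[of x] by (simp add: lim_imp_Liminf)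
      qed
      also have "\<dots> \<le> liminf (\<lambda>n. \<integral>\<^sup>+ x. ennreal (s y (n + N) x) \<partial>lborel)"
        by (rule nn_integral_liminf) (use s_int in auto)
      also have "\<dots> = liminf (\<lambda>n. ennreal (SegI (n + N)))"
        by (intro arg_cong[where f = liminf] ext)
           (use s_nonneg s_int s_val in \<open>auto simp: nn_integral_eq_integral\<close>)
      also have "\<dots> \<le> liminf (\<lambda>n. ennreal (pi * u (\<i> * y) / y))"
        by (intro Liminf_mono always_eventually allI ennreal_leI) (use form Arc_nonneg in \<open>smt (verit) le_add2\<close>)
      also have "\<dots> < \<infinity>" by (simp add: Liminf_const)
      finally show "(\<integral>\<^sup>+ x. ennreal (norm (U x / (x\<^sup>2 + y\<^sup>2))) \<partial>lborel) < \<infinity>" .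
    qed measurable
    have "(\<lambda>n. integral\<^sup>L lborel (s y (n + N))) \<longlonglongrightarrow> J y"
      unfolding J_def
      by (rule integral_dominated_convergence[OF _ _ int])
         (use s_int s_lim s_nonneg s_le in \<open>auto intro!: LIMSEQ_ignore_initial_segment\<close>)
    then have "(\<lambda>n. SegI (n + N)) \<longlonglongrightarrow> J y" using s_val by simp
    then have "(\<lambda>n. pi * u (\<i> * y) / y - SegI (n + N)) \<longlonglongrightarrow> pi * u (\<i> * y) / y - J y"
      by (intro tendsto_intros)
    moreover have "pi * u (\<i> * y) / y - SegI (n + N) = ArcI (n + N)" for n
      using form[of "n + N"] by simp
    ultimately have "(\<lambda>n. ArcI (n + N)) \<longlonglongrightarrow> pi * u (\<i> * y) / y - J y" by simp
    then have ArcLim: "ArcI \<longlonglongrightarrow> pi * u (\<i> * y) / y - J y" by (rule LIMSEQ_offset)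
    have "(\<lambda>n. \<alpha> n * (2 / real n)) \<longlonglongrightarrow> pi * u (\<i> * y) / y - J y"
    proof (rule tendsto_sandwich)
      have 1: "(\<lambda>n. ((real n)\<^sup>2 - y\<^sup>2) / (real n)\<^sup>2) \<longlonglongrightarrow> 1" by real_asymp
      show "(\<lambda>n. ArcI n * (((real n)\<^sup>2 - y\<^sup>2) / (real n)\<^sup>2)) \<longlonglongrightarrow> pi * u (\<i> * y) / y - J y"
        using tendsto_mult[OF ArcLim 1] by simp
      have 2: "(\<lambda>n. ((real n)\<^sup>2 + y\<^sup>2)\<^sup>2 / ((real n)\<^sup>2 * ((real n)\<^sup>2 - y\<^sup>2))) \<longlonglongrightarrow> 1" by real_asymp
      show "(\<lambda>n. ArcI n * (((real n)\<^sup>2 + y\<^sup>2)\<^sup>2 / ((real n)\<^sup>2 * ((real n)\<^sup>2 - y\<^sup>2)))) \<longlonglongrightarrow> pi * u (\<i> * y) / y - J y"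
        using tendsto_mult[OF ArcLim 2] by simp
      have cont_arc: "continuous_on {0..pi} (\<lambda>\<theta>. u (real n * cis \<theta>))" for n
        by (rule continuous_on_compose2[OF harmonic_half_plane_continuous[OF u]])
           (auto intro!: continuous_intros mult_nonneg_nonneg sin_ge_zero)
      have sint: "(\<lambda>\<theta>. u (real n * cis \<theta>) * sin \<theta> * K) integrable_on {0..pi}" for n K
        by (intro integrable_continuous_real continuous_intros cont_arc)
      have sval: "integral {0..pi} (\<lambda>\<theta>. u (real n * cis \<theta>) * sin \<theta> * K) = \<alpha> n * K" for n K
        unfolding \<alpha>_def by (rule integral_mult_left)
      have lo: "\<alpha> n * (2 * real n * ((real n)\<^sup>2 - y\<^sup>2) / ((real n)\<^sup>2 + y\<^sup>2)\<^sup>2) \<le> ArcI n" if "n \<ge> N" for n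
        unfolding ArcI_def sval[symmetric]
      proof (rule integral_le[OF sint half_disc_formula_real(2)[OF u y N[OF that]]])
        fix \<theta> assume t: "\<theta> \<in> {0..pi}"
        show "u (real n * cis \<theta>) * sin \<theta> * (2 * real n * ((real n)\<^sup>2 - y\<^sup>2) / ((real n)\<^sup>2 + y\<^sup>2)\<^sup>2) \<le> u (real n * cis \<theta>) * arc_kernel (real n) y \<theta>"
          using mult_left_mono[OF arc_kernel_bounds(1)[OF y N[OF that] t] u_arc[OF t, of n]] by (simp only: mult.assoc)
      qed
      have hi: "ArcI n \<le> \<alpha> n * (2 * real n / ((real n)\<^sup>2 - y\<^sup>2))" if "n \<ge> N" for n
        unfolding ArcI_def sval[symmetric]
      proof (rule integral_le[OF half_disc_formula_real(2)[OF u y N[OF that]] sint])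
        fix \<theta> assume t: "\<theta> \<in> {0..pi}"
        show "u (real n * cis \<theta>) * arc_kernel (real n) y \<theta> \<le> u (real n * cis \<theta>) * sin \<theta> * (2 * real n / ((real n)\<^sup>2 - y\<^sup>2))"
          using mult_left_mono[OF arc_kernel_bounds(2)[OF y N[OF that] t] u_arc[OF t, of n]] by (simp only: mult.assoc)
      qed
      have pos: "0 < real n" "0 < (real n)\<^sup>2 - y\<^sup>2" "0 < (real n)\<^sup>2 + y\<^sup>2" if "n \<ge> N" for n
        using N[OF that] y by (auto simp: power_strict_mono add_pos_nonneg)
      show "\<forall>\<^sub>F n in sequentially. ArcI n * (((real n)\<^sup>2 - y\<^sup>2) / (real n)\<^sup>2) \<le> \<alpha> n * (2 / real n)"
        using eventually_ge_at_top[of N]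
      proof eventually_elim
        case (elim n)
        have "ArcI n * (((real n)\<^sup>2 - y\<^sup>2) / (real n)\<^sup>2) \<le> \<alpha> n * (2 * real n / ((real n)\<^sup>2 - y\<^sup>2)) * (((real n)\<^sup>2 - y\<^sup>2) / (real n)\<^sup>2)"
          using hi[OF elim] pos[OF elim] by (intro mult_right_mono) auto
        also have "\<dots> = \<alpha> n * (2 / real n)" using pos[OF elim] by (simp add: power2_eq_square)
        finally show ?case .
      qed
      show "\<forall>\<^sub>F n in sequentially. \<alpha> n * (2 / real n) \<le> ArcI n * (((real n)\<^sup>2 + y\<^sup>2)\<^sup>2 / ((real n)\<^sup>2 * ((real n)\<^sup>2 - y\<^sup>2)))"
        using eventually_ge_at_top[of N]
      proof eventually_elim
        case (elim n)
        have "\<alpha> n * (2 / real n) = \<alpha> n * (2 * real n * ((real n)\<^sup>2 - y\<^sup>2) / ((real n)\<^sup>2 + y\<^sup>2)\<^sup>2) * (((real n)\<^sup>2 + y\<^sup>2)\<^sup>2 / ((real n)\<^sup>2 * ((real n)\<^sup>2 - y\<^sup>2)))"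
          using pos[OF elim] by (simp add: divide_simps) (simp add: power2_eq_square)
        also have "\<dots> \<le> ArcI n * (((real n)\<^sup>2 + y\<^sup>2)\<^sup>2 / ((real n)\<^sup>2 * ((real n)\<^sup>2 - y\<^sup>2)))"
          using lo[OF elim] pos[OF elim] by (intro mult_right_mono) auto
        finally show ?case .
      qed
    qed
    with int show ?thesis by blast
  qed
  \<comment> \<open>No \<open>y\<close> occurs in this limit, although \<open>main\<close> evaluates
    it through any chosen \<open>y\<close>.\<close>
  define C where "C = lim (\<lambda>n. \<alpha> n * (2 / real n))"
  have C: "C = pi * u (\<i> * y) / y - J y" if "0 < y" for y
    using main[OF that] by (auto simp: C_def limI)
  have "\<alpha> n * (2 / real n) \<ge> 0" for n
    unfolding \<alpha>_def
    by (intro mult_nonneg_nonneg integral_nonneg integrable_continuous_real continuous_intros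
          continuous_on_compose2[OF harmonic_half_plane_continuous[OF u]] nonneg)
       (auto intro!: mult_nonneg_nonneg sin_ge_zero)
  then have "C \<ge> 0"
    using main[of 1] C[of 1] LIMSEQ_le_const[of "\<lambda>n. \<alpha> n * (2 / real n)" C 0] by auto
  show ?thesis
  proof (rule that[of "C / pi"])
    show "0 \<le> C / pi" using \<open>C \<ge> 0\<close> by simp
    show "integrable lborel (\<lambda>x. u (of_real x) / (x\<^sup>2 + y\<^sup>2))" if "0 < y" for y
      using main[OF that] by (simp add: U_def)
    show "u (\<i> * y) = C / pi * y + (y / pi) * (\<integral>x. u (of_real x) / (x\<^sup>2 + y\<^sup>2) \<partial>lborel)" if "0 < y" for y
      using C[OF that] that unfolding J_def U_def by (simp add: field_simps)
  qed
qed

lemma harmonic_half_plane_Re: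
  assumes "continuous_on {z. 0 \<le> Im z} f" "f holomorphic_on {z. 0 < Im z}"
  shows "harmonic_half_plane (\<lambda>z. Re (f z))"
proof -
  have "interior (half_disc R) \<subseteq> {z. 0 < Im z}" for R
    unfolding half_disc_def by (simp add: interior_Int interior_halfspace_Im_ge)
  then show ?thesis unfolding harmonic_half_plane_def using assms
    by (auto intro!: exI[of _ f] intro: continuous_on_subset holomorphic_on_subset simp: half_disc_def)
qed

lemma harmonic_half_plane_add_const:
  assumes "harmonic_half_plane u"
  shows "harmonic_half_plane (\<lambda>z. c + u z)"
  unfolding harmonic_half_plane_def
proof (intro allI impI)
  fix R :: real assume "R > 0"
  then obtain f where f: "continuous_on (half_disc R) f" "f holomorphic_on interior (half_disc R)"
    "\<forall>z\<in>half_disc R. Re (f z) = u z"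
    using assms unfolding harmonic_half_plane_def by blast
  show "\<exists>f. continuous_on (half_disc R) f \<and> f holomorphic_on interior (half_disc R) \<and>
        (\<forall>z\<in>half_disc R. Re (f z) = c + u z)"
    using f by (intro exI[of _ "\<lambda>z. of_real c + f z"]) (auto intro!: continuous_intros holomorphic_intros)
qed

text \<open>The zero set of \<open>q\<close> has positive distance from the compact half disc.
  Adding a small ball to the convex half disc gives a convex open set without zeros, on which a
  holomorphic logarithm exists.\<close>

lemma harmonic_half_plane_ln_cmod:
  assumes hol: "q holomorphic_on UNIV" and nz: "\<And>z. 0 \<le> Im z \<Longrightarrow> q z \<noteq> 0"
  shows "harmonic_half_plane (\<lambda>z. ln (cmod (q z)))"
  unfolding harmonic_half_plane_def
proof (intro allI impI)
  fix R :: real assume R: "R > 0"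
  have conv: "convex (half_disc R)" unfolding half_disc_def
    by (intro convex_Int convex_cball convex_halfspace_Im_ge)
  have comp: "compact (half_disc R)" unfolding half_disc_def
    by (intro compact_Int_closed compact_cball closed_halfspace_Im_ge)
  have "open (- (q -` {0}))"
    using holomorphic_on_imp_continuous_on[OF hol]
    by (intro open_Compl closed_vimage) auto
  moreover have "half_disc R \<subseteq> - (q -` {0})" using nz by (auto simp: half_disc_def)
  ultimately obtain e where e: "e > 0" "(\<Union>x\<in>half_disc R. ball x e) \<subseteq> - (q -` {0})"
    using compact_subset_open_imp_ball_epsilon_subset[OF comp] by metis
  define V where "V = (\<Union>x\<in>half_disc R. \<Union>y\<in>ball 0 e. {x + y})"
  have V: "V \<subseteq> - (q -` {0})"
    using e(2) by (force simp: V_def dist_norm)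
  have "convex V" unfolding V_def by (intro convex_sums conv convex_ball)
  moreover have "open V" unfolding V_def by (intro open_sums) auto
  ultimately obtain g where g: "g holomorphic_on V" "\<And>z. z \<in> V \<Longrightarrow> q z = exp (g z)"
    using simply_connected_eq_holomorphic_log[of V] V holomorphic_on_subset[OF hol, of V]
      convex_imp_simply_connected[of V] by blast
  have sub: "half_disc R \<subseteq> V" unfolding V_def using e(1) by force
  have "continuous_on (half_disc R) g" "g holomorphic_on interior (half_disc R)"
    using g(1) sub interior_subset holomorphic_on_imp_continuous_on
    by (blast intro: continuous_on_subset holomorphic_on_subset)+
  moreover have "Re (g z) = ln (cmod (q z))" if "z \<in> half_disc R" for z
    using g(2)[of z] that sub by auto
  ultimately show "\<exists>f. continuous_on (half_disc R) f \<and> f holomorphic_on interior (half_disc R) \<and>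
        (\<forall>z\<in>half_disc R. Re (f z) = ln (cmod (q z)))" by blast
qed

section \<open>Poisson means of bounded and of nonnegative harmonic functions\<close>

text \<open>The Herglotz representation of the constant 1: a linear coefficient \<open>c > 0\<close>
  would, at \<open>y = 2 / c\<close>, force the value 1 to be at least 2.\<close>

lemma half_plane_mean_unit:
  assumes "0 < (y::real)"
  shows "integrable lborel (\<lambda>x. 1 / (x\<^sup>2 + y\<^sup>2))" "(\<integral>x. 1 / (x\<^sup>2 + y\<^sup>2) \<partial>lborel) = pi / y"
proof -
  have h: "harmonic_half_plane (\<lambda>z. 1)"
    using harmonic_half_plane_Re[of "\<lambda>_. 1"] by (simp add: continuous_on_const)
  obtain c where c: "0 \<le> c" "\<And>y::real. 0 < y \<Longrightarrow> integrable lborel (\<lambda>x. 1 / (x\<^sup>2 + y\<^sup>2))"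
    "\<And>y. 0 < y \<Longrightarrow> 1 = c * y + (y / pi) * (\<integral>x. 1 / (x\<^sup>2 + y\<^sup>2) \<partial>lborel)"
    using herglotz[OF h] by auto
  have nn: "(\<integral>x. 1 / (x\<^sup>2 + y\<^sup>2) \<partial>lborel) \<ge> 0" for y :: real by (intro Bochner_Integration.integral_nonneg) auto
  have "c = 0"
  proof (rule ccontr)
    assume "c \<noteq> 0"
    then have "c > 0" using c(1) by simp
    then have "(2 / c / pi) * (\<integral>x. 1 / (x\<^sup>2 + (2 / c)\<^sup>2) \<partial>lborel) \<ge> 0"
      using nn by (intro mult_nonneg_nonneg) auto
    moreover have "c * (2 / c) = 2" "2 / c > 0" using \<open>c > 0\<close> by auto
    ultimately show False using c(3)[of "2 / c"] by linarith
  qed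
  show "integrable lborel (\<lambda>x. 1 / (x\<^sup>2 + y\<^sup>2))" using c(2) assms by blast
  show "(\<integral>x. 1 / (x\<^sup>2 + y\<^sup>2) \<partial>lborel) = pi / y"
    using c(3)[OF assms] assms \<open>c = 0\<close> by (simp add: field_simps)
qed

lemma half_plane_mean_bounded:
  assumes u: "harmonic_half_plane u" and bdd: "\<And>z. 0 \<le> Im z \<Longrightarrow> \<bar>u z\<bar> \<le> M" and y: "0 < y"
  shows "integrable lborel (\<lambda>x. u (of_real x) / (x\<^sup>2 + y\<^sup>2))"
    "u (\<i> * y) = (y / pi) * (\<integral>x. u (of_real x) / (x\<^sup>2 + y\<^sup>2) \<partial>lborel)"
proof -
  have M: "M \<ge> 0" using bdd[of 0] by simp
  have pos: "0 \<le> M + u z" if "0 \<le> Im z" for z using bdd[OF that] by (auto simp: abs_le_iff)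
  obtain c where c: "0 \<le> c" "\<And>y. 0 < y \<Longrightarrow> integrable lborel (\<lambda>x. (M + u (of_real x)) / (x\<^sup>2 + y\<^sup>2))"
    "\<And>y. 0 < y \<Longrightarrow> M + u (\<i> * y) = c * y + (y / pi) * (\<integral>x. (M + u (of_real x)) / (x\<^sup>2 + y\<^sup>2) \<partial>lborel)"
    using herglotz[OF harmonic_half_plane_add_const[OF u] pos] by blast
  have nn: "(\<integral>x. (M + u (of_real x)) / (x\<^sup>2 + y\<^sup>2) \<partial>lborel) \<ge> 0" for y :: real
    using pos by (intro Bochner_Integration.integral_nonneg) auto
  have "c = 0"
  proof (rule ccontr)
    assume "c \<noteq> 0"
    then have "c > 0" using c(1) by simp
    \<comment> \<open>At this height the linear term alone is \<open>2 * M + 1\<close>, beyond the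
      bound \<open>2 * M\<close> of the shifted function.\<close>
    define Y where "Y = (2 * M + 1) / c"
    have Y: "Y > 0" using \<open>c > 0\<close> M by (simp add: Y_def)
    have "c * Y + (Y / pi) * (\<integral>x. (M + u (of_real x)) / (x\<^sup>2 + Y\<^sup>2) \<partial>lborel) \<ge> c * Y + 0"
      using nn Y by (intro add_mono mult_nonneg_nonneg) auto
    moreover have "M + u (\<i> * Y) \<le> 2 * M" using bdd[of "\<i> * Y"] Y by (simp add: abs_le_iff)
    ultimately have "c * Y \<le> 2 * M" using c(3)[OF Y] by simp
    then show False using \<open>c > 0\<close> by (simp add: Y_def)
  qed
  have int: "integrable lborel (\<lambda>x. (M + u (of_real x)) / (x\<^sup>2 + y\<^sup>2) - M * (1 / (x\<^sup>2 + y\<^sup>2)))"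
    by (intro Bochner_Integration.integrable_diff c(2) y integrable_mult_right half_plane_mean_unit)
  have eq: "(M + u (of_real x)) / (x\<^sup>2 + y\<^sup>2) - M * (1 / (x\<^sup>2 + y\<^sup>2)) = u (of_real x) / (x\<^sup>2 + y\<^sup>2)" for x :: real
    by (simp add: add_divide_distrib)
  show 1: "integrable lborel (\<lambda>x. u (of_real x) / (x\<^sup>2 + y\<^sup>2))" using int unfolding eq .
  have "(\<integral>x. (M + u (of_real x)) / (x\<^sup>2 + y\<^sup>2) \<partial>lborel) = M * (pi / y) + (\<integral>x. u (of_real x) / (x\<^sup>2 + y\<^sup>2) \<partial>lborel)"
    using Bochner_Integration.integral_add[OF integrable_mult_right[OF half_plane_mean_unit(1)[OF y]] 1, of M]
    unfolding integral_mult_right_zero half_plane_mean_unit(2)[OF y] by (simp add: add_divide_distrib)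
  then show "u (\<i> * y) = (y / pi) * (\<integral>x. u (of_real x) / (x\<^sup>2 + y\<^sup>2) \<partial>lborel)"
    using c(3)[OF y] y \<open>c = 0\<close> by (simp add: field_simps)
qed

definition poisson_kernel :: "real \<Rightarrow> real \<Rightarrow> real"
  where "poisson_kernel y x = y / (pi * (x\<^sup>2 + y\<^sup>2))"

lemma poisson_kernel_nonneg: "0 \<le> y \<Longrightarrow> 0 \<le> poisson_kernel y x"
  by (simp add: poisson_kernel_def)

lemma borel_measurable_poisson_kernel [measurable (raw)]:
  assumes "f \<in> borel_measurable M"
  shows "(\<lambda>x. poisson_kernel y (f x)) \<in> borel_measurable M"
  using assms unfolding poisson_kernel_def by measurable

lemma poisson_kernel_mass:
  assumes "0 < y"
  shows "integrable lborel (\<lambda>x. poisson_kernel y (x - x0))" "(\<integral>x. poisson_kernel y (x - x0) \<partial>lborel) = 1"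
    "(\<integral>\<^sup>+x. ennreal (poisson_kernel y (x - x0)) \<partial>lborel) = 1"
proof -
  have e: "poisson_kernel y x = (y / pi) * (1 / (x\<^sup>2 + y\<^sup>2))" for x by (simp add: poisson_kernel_def)
  have i: "integrable lborel (poisson_kernel y)" "integral\<^sup>L lborel (poisson_kernel y) = 1"
    unfolding e integral_mult_right_zero half_plane_mean_unit(2)[OF assms]
    using assms by (rule_tac integrable_mult_right[OF half_plane_mean_unit(1)], simp_all)
  show 1: "integrable lborel (\<lambda>x. poisson_kernel y (x - x0))"
    using lborel_integrable_real_affine[OF i(1), of 1 "-x0"] by (simp add: add.commute)
  show 2: "(\<integral>x. poisson_kernel y (x - x0) \<partial>lborel) = 1"
    using lborel_integral_real_affine[of 1 "poisson_kernel y" "-x0"] i(2) by (simp add: add.commute)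
  show "(\<integral>\<^sup>+x. ennreal (poisson_kernel y (x - x0)) \<partial>lborel) = 1"
    using 1 2 poisson_kernel_nonneg[of y] assms by (subst nn_integral_eq_integral) auto
qed

lemma poisson_bounded:
  assumes cont: "continuous_on {z. 0 \<le> Im z} f" and hol: "f holomorphic_on {z. 0 < Im z}"
    and bdd: "\<And>z. 0 \<le> Im z \<Longrightarrow> \<bar>Re (f z)\<bar> \<le> M" and y: "0 < y"
  shows "integrable lborel (\<lambda>x. Re (f (of_real x)) * poisson_kernel y (x - x0))"
    "Re (f (Complex x0 y)) = (\<integral>x. Re (f (of_real x)) * poisson_kernel y (x - x0) \<partial>lborel)"
proof -
  define g where "g = (\<lambda>z. f (z + of_real x0))"
  have "continuous_on {z. 0 \<le> Im z} g" unfolding g_def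
    by (rule continuous_on_compose2[OF cont]) (auto intro!: continuous_intros)
  moreover have "g holomorphic_on {z. 0 < Im z}" unfolding g_def
    by (rule holomorphic_on_compose_gen[OF _ hol, unfolded o_def]) (auto intro!: holomorphic_intros)
  ultimately have h: "harmonic_half_plane (\<lambda>z. Re (g z))" by (rule harmonic_half_plane_Re)
  have b: "\<bar>Re (g z)\<bar> \<le> M" if "0 \<le> Im z" for z using bdd that by (simp add: g_def)
  have e: "Re (g (of_real x)) / (x\<^sup>2 + y\<^sup>2) * (y / pi) = Re (f (of_real (x0 + x))) * poisson_kernel y ((x0 + x) - x0)" for x
    by (simp add: g_def poisson_kernel_def add.commute)
  have i1: "integrable lborel (\<lambda>x. Re (f (of_real (x0 + x))) * poisson_kernel y ((x0 + x) - x0))"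
    unfolding e[symmetric] by (intro integrable_mult_left half_plane_mean_bounded(1)[OF h b y])
  show "integrable lborel (\<lambda>x. Re (f (of_real x)) * poisson_kernel y (x - x0))"
    using lborel_integrable_real_affine[OF i1, of 1 "-x0"] by simp
  have "\<i> * of_real y + of_real x0 = Complex x0 y" by (simp add: complex_eq_iff)
  then have "Re (f (Complex x0 y)) = Re (g (\<i> * y))" by (simp add: g_def)
  also have "\<dots> = (\<integral>x. Re (g (of_real x)) / (x\<^sup>2 + y\<^sup>2) * (y / pi) \<partial>lborel)"
    using half_plane_mean_bounded(2)[OF h b y] unfolding integral_mult_left_zero by (simp only: mult.commute)
  also have "\<dots> = (\<integral>x. Re (f (of_real x)) * poisson_kernel y (x - x0) \<partial>lborel)"
    unfolding e using lborel_integral_real_affine[of 1 "\<lambda>x. Re (f (of_real x)) * poisson_kernel y (x - x0)" x0] by simp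
  finally show "Re (f (Complex x0 y)) = (\<integral>x. Re (f (of_real x)) * poisson_kernel y (x - x0) \<partial>lborel)" .
qed

text \<open>The two sides differ by the linear coefficient of the Herglotz representation, which is
  nonnegative but otherwise unknown here.\<close>

lemma half_plane_mean_nonneg_le:
  assumes u: "harmonic_half_plane u" and nonneg: "\<And>z. 0 \<le> Im z \<Longrightarrow> 0 \<le> u z"
  shows "(\<integral>\<^sup>+x. ennreal (u (of_real x) * poisson_kernel 1 x) \<partial>lborel) \<le> ennreal (u \<i>)"
proof -
  obtain c where c: "0 \<le> c" "\<And>y. 0 < y \<Longrightarrow> integrable lborel (\<lambda>x. u (of_real x) / (x\<^sup>2 + y\<^sup>2))"
    "\<And>y. 0 < y \<Longrightarrow> u (\<i> * y) = c * y + (y / pi) * (\<integral>x. u (of_real x) / (x\<^sup>2 + y\<^sup>2) \<partial>lborel)"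
    using herglotz[OF u nonneg] by blast
  have e: "u (of_real x) * poisson_kernel 1 x = (1 / pi) * (u (of_real x) / (x\<^sup>2 + 1\<^sup>2))" for x
    by (simp add: poisson_kernel_def)
  have "(\<integral>\<^sup>+x. ennreal (u (of_real x) * poisson_kernel 1 x) \<partial>lborel) = ennreal ((1 / pi) * (\<integral>x. u (of_real x) / (x\<^sup>2 + 1\<^sup>2) \<partial>lborel))"
    unfolding e integral_mult_right_zero[symmetric] using c(2)[of 1] nonneg
    by (intro nn_integral_eq_integral integrable_mult_right AE_I2) auto
  also have "\<dots> \<le> ennreal (u \<i>)" using c(1) c(3)[of 1] by (intro ennreal_leI) simp
  finally show ?thesis .
qed

text \<open>Divided by \<open>y\<close>, the Poisson term tends to zero by dominated convergence.
  Hence the growth rate along the imaginary axis is the linear coefficient, and it is the amount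
  missing in the mean at \<open>y = 1\<close>.\<close>

lemma half_plane_mean_growth:
  assumes u: "harmonic_half_plane u" and nonneg: "\<And>z. 0 \<le> Im z \<Longrightarrow> 0 \<le> u z"
    and lim: "((\<lambda>y. u (\<i> * of_real y) / y) \<longlongrightarrow> \<tau>) at_top"
  shows "(\<integral>\<^sup>+x. ennreal (u (of_real x) * poisson_kernel 1 x) \<partial>lborel) = ennreal (u \<i> - \<tau>)"
proof -
  obtain c where c: "0 \<le> c" "\<And>y. 0 < y \<Longrightarrow> integrable lborel (\<lambda>x. u (of_real x) / (x\<^sup>2 + y\<^sup>2))"
    "\<And>y. 0 < y \<Longrightarrow> u (\<i> * y) = c * y + (y / pi) * (\<integral>x. u (of_real x) / (x\<^sup>2 + y\<^sup>2) \<partial>lborel)"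
    using herglotz[OF u nonneg] by blast
  have [measurable]: "(\<lambda>x. u (of_real x)) \<in> borel_measurable borel"
    using harmonic_half_plane_continuous_real[OF u] by (simp add: borel_measurable_continuous_onI)
  have "((\<lambda>y. \<integral>x. u (of_real x) / (x\<^sup>2 + y\<^sup>2) \<partial>lborel) \<longlongrightarrow> integral\<^sup>L lborel (\<lambda>x::real. 0)) at_top"
  proof (rule integral_dominated_convergence_at_top[where w = "\<lambda>x. u (of_real x) / (x\<^sup>2 + 1\<^sup>2)"])
    show "integrable lborel (\<lambda>x. u (of_real x) / (x\<^sup>2 + 1\<^sup>2))" using c(2)[of 1] by simp
    show "\<forall>\<^sub>F y in at_top. AE x in lborel. norm (u (of_real x) / (x\<^sup>2 + y\<^sup>2)) \<le> u (of_real x) / (x\<^sup>2 + 1\<^sup>2)"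
      using eventually_ge_at_top[of 1]
    proof eventually_elim
      case (elim y)
      then have "1\<^sup>2 \<le> y\<^sup>2" by (intro power_mono) auto
      then show ?case using nonneg
        by (intro AE_I2) (auto intro!: divide_left_mono mult_pos_pos add_nonneg_pos simp: add_nonneg_pos)
    qed
    show "AE x in lborel. ((\<lambda>y. u (of_real x) / (x\<^sup>2 + y\<^sup>2)) \<longlongrightarrow> 0) at_top"
      by (intro AE_I2) real_asymp
  qed auto
  then have J: "((\<lambda>y. \<integral>x. u (of_real x) / (x\<^sup>2 + y\<^sup>2) \<partial>lborel) \<longlongrightarrow> 0) at_top" by simp
  have "((\<lambda>y. c + (1 / pi) * (\<integral>x. u (of_real x) / (x\<^sup>2 + y\<^sup>2) \<partial>lborel)) \<longlongrightarrow> c + (1 / pi) * 0) at_top"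
    by (intro tendsto_intros J)
  moreover have "\<forall>\<^sub>F y in at_top. c + (1 / pi) * (\<integral>x. u (of_real x) / (x\<^sup>2 + y\<^sup>2) \<partial>lborel) = u (\<i> * of_real y) / y"
    using eventually_gt_at_top[of 0] by eventually_elim (simp add: c(3) field_simps)
  ultimately have "((\<lambda>y. u (\<i> * of_real y) / y) \<longlongrightarrow> c + (1 / pi) * 0) at_top"
    by (rule Lim_transform_eventually)
  then have "c = \<tau>" using tendsto_unique[OF _ lim] by simp
  have e: "u (of_real x) * poisson_kernel 1 x = (1 / pi) * (u (of_real x) / (x\<^sup>2 + 1\<^sup>2))" for x
    by (simp add: poisson_kernel_def)
  have "(\<integral>\<^sup>+x. ennreal (u (of_real x) * poisson_kernel 1 x) \<partial>lborel) = ennreal ((1 / pi) * (\<integral>x. u (of_real x) / (x\<^sup>2 + 1\<^sup>2) \<partial>lborel))"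
    unfolding e integral_mult_right_zero[symmetric] using c(2)[of 1] nonneg
    by (intro nn_integral_eq_integral integrable_mult_right AE_I2) auto
  also have "(1 / pi) * (\<integral>x. u (of_real x) / (x\<^sup>2 + 1\<^sup>2) \<partial>lborel) = u \<i> - \<tau>"
    using c(3)[of 1] \<open>c = \<tau>\<close> by simp
  finally show ?thesis .
qed

section \<open>Nontangential limits\<close>

text \<open>Averages over intervals to the right of \<open>x\<close> converge off \<open>N1\<close>.
  The same fact for the reflected function \<open>f (- x)\<close> covers the averages to the left,
  off the reflection of \<open>N2\<close>.\<close>

lemma AE_has_vector_derivative_integral:
  fixes f :: "real \<Rightarrow> 'b::euclidean_space"
  assumes int: "\<And>a b. f integrable_on {a..b}"
  shows "AE x in lebesgue. \<forall>c<x. ((\<lambda>t. integral {c..t} f) has_vector_derivative f x) (at x)"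
proof -
  have i1: "f integrable_on cbox a b" for a b using int by simp
  have i2: "(\<lambda>x. f (- x)) integrable_on cbox a b" for a b
    using int[of "-b" "-a"] Henstock_Kurzweil_Integration.integrable_reflect_real[where f = f and a = "-b" and b = "-a"] by simp
  obtain N1 where N1: "negligible N1" "\<And>x e. \<lbrakk>x \<notin> N1; 0 < e\<rbrakk> \<Longrightarrow>
       \<exists>d>0. \<forall>h. 0 < h \<and> h < d \<longrightarrow> norm (integral (cbox x (x + h *\<^sub>R One)) f /\<^sub>R h ^ DIM(real) - f x) < e"
    by (rule integrable_ccontinuous_explicit[OF i1]) (rule that, assumption+)
  obtain N2 where N2: "negligible N2" "\<And>x e. \<lbrakk>x \<notin> N2; 0 < e\<rbrakk> \<Longrightarrow>
       \<exists>d>0. \<forall>h. 0 < h \<and> h < d \<longrightarrow> norm (integral (cbox x (x + h *\<^sub>R One)) (\<lambda>x. f (- x)) /\<^sub>R h ^ DIM(real) - f (- x)) < e"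
    by (rule integrable_ccontinuous_explicit[OF i2]) (rule that, assumption+)
  have neg: "negligible (N1 \<union> uminus ` N2)"
  proof (intro negligible_Un N1(1) negligible_locally_Lipschitz_image N2(1))
    show "\<exists>T B. open T \<and> x \<in> T \<and> (\<forall>y\<in>N2 \<inter> T. norm (- y - - x) \<le> B * norm (y - x))" for x
      by (intro exI[of _ UNIV] exI[of _ 1]) auto
  qed auto
  have main: "((\<lambda>t. integral {c..t} f) has_vector_derivative f x) (at x)"
    if x: "x \<notin> N1 \<union> uminus ` N2" and c: "c < x" for x c
    unfolding has_vector_derivative_def has_derivative_at_alt
  proof (intro conjI allI impI)
    show "bounded_linear (\<lambda>h. h *\<^sub>R f x)" by (rule bounded_linear_scaleR_left)
    fix e :: real assume e: "e > 0"
    have "- x \<notin> N2" using x by (metis UnCI image_eqI minus_minus)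
    then obtain d2 where d2: "d2 > 0" "\<And>h. 0 < h \<Longrightarrow> h < d2 \<Longrightarrow>
        norm (integral {- x..- x + h} (\<lambda>x. f (- x)) /\<^sub>R h - f x) < e"
      using N2(2)[of "-x" e] e by auto
    obtain d1 where d1: "d1 > 0" "\<And>h. 0 < h \<Longrightarrow> h < d1 \<Longrightarrow>
        norm (integral {x..x + h} f /\<^sub>R h - f x) < e"
      using N1(2)[of x e] x e by auto
    have scale: "norm (I - h *\<^sub>R v) \<le> e * h" if "h > 0" "norm (I /\<^sub>R h - v) < e" for I v :: 'b and h
    proof -
      have "norm (I - h *\<^sub>R v) = h * norm (I /\<^sub>R h - v)"
        using that(1) norm_scaleR[of h "I /\<^sub>R h - v"] by (simp add: scaleR_diff_right)
      then show ?thesis using that by (simp add: mult.commute)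
    qed
    show "\<exists>d>0. \<forall>y. norm (y - x) < d \<longrightarrow>
        norm (integral {c..y} f - integral {c..x} f - (y - x) *\<^sub>R f x) \<le> e * norm (y - x)"
    proof (intro exI[of _ "min (min d1 d2) (x - c)"] conjI allI impI)
      show "0 < min (min d1 d2) (x - c)" using d1 d2 c by simp
      fix y assume y: "norm (y - x) < min (min d1 d2) (x - c)"
      consider "y = x" | "y > x" | "y < x" by linarith
      then show "norm (integral {c..y} f - integral {c..x} f - (y - x) *\<^sub>R f x) \<le> e * norm (y - x)"
      proof cases
        case 2
        have "integral {c..x} f + integral {x..y} f = integral {c..y} f"
          by (rule Henstock_Kurzweil_Integration.integral_combine) (use 2 c int in auto)
        then have "integral {c..y} f - integral {c..x} f = integral {x..x + (y - x)} f"
          by (simp add: algebra_simps)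
        then show ?thesis using scale[OF _ d1(2)[of "y - x"]] 2 y by auto
      next
        case 3
        have cy: "c < y" using y 3 by (auto simp: abs_if split: if_splits)
        have "integral {c..y} f + integral {y..x} f = integral {c..x} f"
          by (rule Henstock_Kurzweil_Integration.integral_combine) (use 3 cy int in auto)
        moreover have "integral {- x..- x + (x - y)} (\<lambda>x. f (- x)) = integral {y..x} f"
          using Henstock_Kurzweil_Integration.integral_reflect_real[of x y f] by simp
        ultimately have "integral {c..y} f - integral {c..x} f - (y - x) *\<^sub>R f x =
            - (integral {- x..- x + (x - y)} (\<lambda>x. f (- x)) - (x - y) *\<^sub>R f x)"
          by (simp add: algebra_simps)
        then show ?thesis using scale[OF _ d2(2)[of "x - y"]] 3 y by (simp only: norm_minus_cancel) auto
      qed simp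
    qed
  qed
  then show ?thesis using neg by (auto intro!: AE_I'[of "N1 \<union> uminus ` N2"] simp: negligible_iff_null_sets)
qed

text \<open>A linear term turns \<open>G\<close> into an increasing homeomorphism
  \<open>\<Phi>\<close>. The measure \<open>A \<mapsto> |\<Phi> A|\<close> is absolutely continuous
  because Lipschitz maps send null sets to null sets, so Radon-Nikodym exhibits
  \<open>\<Phi>\<close> as a primitive, to which Lebesgue differentiation applies.\<close>

lemma lipschitz_AE_differentiable_real:
  fixes G :: "real \<Rightarrow> real"
  assumes lip: "\<And>x y. \<bar>G x - G y\<bar> \<le> L * \<bar>x - y\<bar>"
  shows "AE x in lebesgue. \<exists>c. (G has_vector_derivative c) (at x)"
proof -
  \<comment> \<open>The slope \<open>L + 1\<close> outweighs the Lipschitz constant by 1, so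
    increments of \<open>\<Phi>\<close> are at least those of the argument.\<close>
  define \<Phi> where "\<Phi> = (\<lambda>x. G x + (L + 1) * x)"
  have grow: "b - a \<le> \<Phi> b - \<Phi> a" "\<Phi> b - \<Phi> a \<le> (2 * L + 1) * (b - a)" if "a \<le> b" for a b
  proof -
    have "\<bar>G b - G a\<bar> \<le> L * (b - a)" using lip[of b a] that by simp
    then have "G b - G a \<le> L * (b - a)" "G a - G b \<le> L * (b - a)" by linarith+
    then show "b - a \<le> \<Phi> b - \<Phi> a" "\<Phi> b - \<Phi> a \<le> (2 * L + 1) * (b - a)"
      by (simp_all add: \<Phi>_def distrib_right right_diff_distrib)
  qed
  have "L \<ge> 0" using order_trans[OF abs_ge_zero lip[of 1 0]] by simp
  then have L: "2 * L + 1 \<ge> 0" by simp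
  have lip\<Phi>: "\<bar>\<Phi> x - \<Phi> y\<bar> \<le> (2 * L + 1) * \<bar>x - y\<bar>" for x y
  proof -
    have "\<bar>\<Phi> b - \<Phi> a\<bar> \<le> (2 * L + 1) * \<bar>b - a\<bar>" if "a \<le> b" for a b
    proof -
      have "\<bar>\<Phi> b - \<Phi> a\<bar> = \<Phi> b - \<Phi> a" "\<bar>b - a\<bar> = b - a" using grow(1)[OF that] that by linarith+
      then show ?thesis using grow(2)[OF that] by presburger
    qed
    from this[of x y] this[of y x] show ?thesis by (metis abs_minus_commute linear)
  qed
  have strict: "strict_mono \<Phi>" 
  proof (rule strict_monoI)
    fix x y :: real assume "x < y"
    then show "\<Phi> x < \<Phi> y" using grow(1)[of x y] by linarith
  qed
  have cont: "continuous_on UNIV \<Phi>"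
    by (intro lipschitz_on_continuous_on[of "2 * L + 1"] lipschitz_onI)
       (use lip\<Phi> L in \<open>simp_all add: dist_real_def\<close>)
  have surj: "\<exists>x. \<Phi> x = y" for y
  proof -
    define r where "r = \<bar>y - \<Phi> 0\<bar>"
    have "\<Phi> (-r) \<le> y" "y \<le> \<Phi> r" using grow(1)[of "-r" 0] grow(1)[of 0 r] by (simp_all add: r_def)
    moreover have "-r \<le> r" by (simp add: r_def)
    ultimately show ?thesis using IVT'[of \<Phi> "-r" y r] continuous_on_subset[OF cont] by auto
  qed
  define \<Psi> where "\<Psi> = the_inv \<Phi>"
  have inj: "inj \<Phi>" using strict by (rule strict_mono_imp_inj_on)
  have \<Psi>\<Phi>: "\<Psi> (\<Phi> x) = x" for x unfolding \<Psi>_def using inj by (rule the_inv_f_f)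
  have \<Phi>\<Psi>: "\<Phi> (\<Psi> y) = y" for y using surj[of y] \<Psi>\<Phi> by auto
  have vim: "\<Psi> -` A = \<Phi> ` A" for A
  proof (intro set_eqI iffI)
    fix y assume "y \<in> \<Psi> -` A"
    then show "y \<in> \<Phi> ` A" by (intro image_eqI[of _ _ "\<Psi> y"]) (simp_all add: \<Phi>\<Psi>)
  qed (auto simp: \<Psi>\<Phi>)
  have "mono \<Psi>" using strict \<Phi>\<Psi> by (metis monoI strict_mono_less_eq)
  then have [measurable]: "\<Psi> \<in> borel_measurable borel" by (rule borel_measurable_mono)
  \<comment> \<open>Since \<open>\<Psi>\<close> inverts \<open>\<Phi>\<close>, the measure
    \<open>\<nu>\<close> of a set is the Lebesgue measure of its image under
    \<open>\<Phi>\<close>.\<close>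
  define \<nu> where "\<nu> = distr lborel borel \<Psi>"
  have "absolutely_continuous lborel \<nu>"
    unfolding absolutely_continuous_def
  proof
    fix N :: "real set" assume N: "N \<in> null_sets lborel"
    have "negligible N" using N by (simp add: negligible_iff_null_sets null_sets_completionI)
    then have "negligible (\<Phi> ` N)"
      by (rule negligible_locally_Lipschitz_image[rotated])
         (use lip\<Phi> in \<open>auto intro!: exI[of _ UNIV] exI[of _ "2 * L + 1"]\<close>)
    then have "\<Psi> -` N \<in> null_sets lebesgue" by (simp add: vim negligible_iff_null_sets)
    moreover have "\<Psi> -` N \<in> sets borel" using N by (auto intro!: measurable_sets_borel[of \<Psi> borel])
    ultimately show "N \<in> null_sets \<nu>" using N
      by (auto simp: \<nu>_def null_sets_def emeasure_distr emeasure_completion)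
  qed
  moreover have "sets \<nu> = sets lborel" by (simp add: \<nu>_def)
  ultimately obtain D where [measurable]: "D \<in> borel_measurable lborel" and D: "density lborel D = \<nu>"
    using sigma_finite_measure.Radon_Nikodym[OF sigma_finite_lborel] by blast
  define d where "d = (\<lambda>x. enn2real (D x))"
  have [measurable]: "d \<in> borel_measurable borel" unfolding d_def by measurable
  have D_int: "(\<integral>\<^sup>+x. D x * indicator {a..b} x \<partial>lborel) = ennreal (\<Phi> b - \<Phi> a)" if "a \<le> b" for a b
  proof -
    have "(\<integral>\<^sup>+x. D x * indicator {a..b} x \<partial>lborel) = emeasure \<nu> {a..b}"
      by (simp add: D[symmetric] emeasure_density)
    also have "\<dots> = emeasure lborel (\<Phi> ` {a..b})" by (simp add: \<nu>_def emeasure_distr vim)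
    also have "\<Phi> ` {a..b} = {\<Phi> a..\<Phi> b}"
      using \<Phi>\<Psi> \<open>mono \<Psi>\<close> \<Psi>\<Phi> strict
      by (auto simp: strict_mono_less_eq image_iff) (metis \<Phi>\<Psi> strict_mono_less_eq atLeastAtMost_iff)
    finally show ?thesis using that grow(1)[OF that] by simp
  qed
  have d_int: "(d has_integral (\<Phi> b - \<Phi> a)) {a..b}" if ab: "a \<le> b" for a b
  proof -
    have "AE x in lborel. D x * indicator {a..b} x \<noteq> \<infinity>"
      by (rule nn_integral_PInf_AE) (use D_int[OF ab] in auto)
    then have "(\<integral>\<^sup>+x. ennreal (indicator {a..b} x * d x) \<partial>lborel) = (\<integral>\<^sup>+x. D x * indicator {a..b} x \<partial>lborel)"
      by (intro nn_integral_cong_AE) (auto simp: d_def indicator_def less_top)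
    then have e: "(\<integral>\<^sup>+x. ennreal (indicator {a..b} x * d x) \<partial>lborel) = ennreal (\<Phi> b - \<Phi> a)"
      using D_int[OF ab] by simp
    have nn: "0 \<le> indicator {a..b} x * d x" for x by (simp add: d_def)
    have i: "integrable lborel (\<lambda>x. indicator {a..b} x * d x)"
      by (rule integrableI_nn_integral_finite[OF _ _ e]) (use nn in auto)
    then have "integral\<^sup>L lborel (\<lambda>x. indicator {a..b} x * d x) = \<Phi> b - \<Phi> a"
      using e nn_integral_eq_integral[OF i] nn grow(1)[OF ab] ab by (simp add: Bochner_Integration.integral_nonneg)
    then show ?thesis
      using set_borel_integral_eq_integral[of "{a..b}" d] i
      by (simp add: set_integrable_def set_lebesgue_integral_def has_integral_iff)
  qed
  have "AE x in lebesgue. \<forall>c<x. ((\<lambda>t. integral {c..t} d) has_vector_derivative d x) (at x)"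
  proof (rule AE_has_vector_derivative_integral)
    show "d integrable_on {a..b}" for a b
      using d_int[of a b] by (cases "a \<le> b") (auto simp: integrable_on_def)
  qed
  then show ?thesis
  proof (eventually_elim)
    case (elim x)
    have "((\<lambda>t. integral {x - 1..t} d) has_vector_derivative d x) (at x)" using elim by simp
    then have "((\<lambda>t. \<Phi> t - \<Phi> (x - 1)) has_vector_derivative d x) (at x)"
      by (rule has_vector_derivative_transform_within_open[of _ _ _ "{x - 1<..}"])
         (auto intro!: integral_unique d_int)
    then have "((\<lambda>t. (\<Phi> t - \<Phi> (x - 1)) + \<Phi> (x - 1) - (L + 1) * t) has_vector_derivative (d x + 0 - (L + 1) * 1)) (at x)"
      by (intro derivative_intros) auto
    then show ?case by (auto simp: \<Phi>_def)
  qed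
qed


section \<open>Fatou's theorem on nontangential limits\<close>

text \<open>Away from the centre the kernel is linear in the height, with the fixed integrable
  kernel of height 1 as profile; the part of a Poisson integral far from the centre is therefore of
  order \<open>y\<close>.\<close>

lemma poisson_kernel_tail:
  assumes "0 < y" "0 < r" "r \<le> \<bar>s\<bar>"
  shows "poisson_kernel y s \<le> y * (1 + 1 / r\<^sup>2) * poisson_kernel 1 s"
proof -
  have s: "r\<^sup>2 \<le> s\<^sup>2" using assms power_mono[of r "\<bar>s\<bar>" 2] by simp
  have s0: "s\<^sup>2 > 0" using assms s by (smt (verit) zero_less_power)
  have "s\<^sup>2 + 1 \<le> s\<^sup>2 * (1 + 1 / r\<^sup>2)" using s assms by (simp add: field_simps)
  also have "\<dots> \<le> (s\<^sup>2 + y\<^sup>2) * (1 + 1 / r\<^sup>2)" using assms by (intro mult_right_mono) auto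
  finally have "1 / (s\<^sup>2 + y\<^sup>2) \<le> (1 + 1 / r\<^sup>2) / (s\<^sup>2 + 1)"
    using s0 by (simp add: divide_simps add_pos_nonneg add_pos_pos mult.commute)
  then have "y / pi * (1 / (s\<^sup>2 + y\<^sup>2)) \<le> y / pi * ((1 + 1 / r\<^sup>2) / (s\<^sup>2 + 1))"
    using assms by (intro mult_left_mono) auto
  then show ?thesis by (simp add: poisson_kernel_def)
qed

text \<open>The Poisson integral is split at distance \<open>\<delta>\<close> from
  \<open>x0\<close>. The near part is at most \<open>\<epsilon>\<close> since the kernel has mass 1;
  in the far part the points are at least \<open>\<delta> / 2\<close> away from \<open>Re z\<close>,
  so the tail bound applies.\<close>

lemma poisson_majorant:
  assumes cont: "continuous_on {z. 0 \<le> Im z} f" and hol: "f holomorphic_on {z. 0 < Im z}"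
    and bdd: "\<And>z. 0 \<le> Im z \<Longrightarrow> cmod (f z) \<le> M"
    and small: "\<And>x. \<bar>x - x0\<bar> < \<delta> \<Longrightarrow> cmod (f (of_real x)) \<le> \<epsilon>" and \<delta>: "0 < \<delta>"
    and z: "0 < Im z" "\<bar>Re z - x0\<bar> \<le> \<delta> / 2"
  shows "cmod (f z) \<le> \<epsilon> + M * (Im z * (1 + 1 / (\<delta> / 2)\<^sup>2))"
proof -
  have M: "M \<ge> 0" using bdd[of 0] order_trans[OF norm_ge_zero] by simp
  have \<epsilon>: "\<epsilon> \<ge> 0" using small[of x0] \<delta> order_trans[OF norm_ge_zero] by simp
  \<comment> \<open>A unimodular factor rotates \<open>f z\<close> to its modulus, so the real
    Poisson formula yields a bound for the modulus.\<close>
  define u where "u = (if f z = 0 then 1 else cnj (f z) / of_real (cmod (f z)))"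
  have u1: "cmod u = 1" by (simp add: u_def norm_divide)
  have uf: "u * f z = of_real (cmod (f z))"
  proof (cases "f z = 0")
    case False
    then have "u * f z = (f z * cnj (f z)) / of_real (cmod (f z))" by (simp add: u_def mult.commute)
    also have "\<dots> = of_real ((cmod (f z))\<^sup>2) / of_real (cmod (f z))" by (simp only: complex_norm_square)
    also have "\<dots> = of_real (cmod (f z))" using False by (simp add: power2_eq_square)
    finally show ?thesis .
  qed simp
  define g where "g = (\<lambda>z. u * f z)"
  have g: "continuous_on {z. 0 \<le> Im z} g" "g holomorphic_on {z. 0 < Im z}"
    unfolding g_def by (intro continuous_intros cont holomorphic_intros hol)+
  have gle: "\<bar>Re (g w)\<bar> \<le> cmod (f w)" for w
    using abs_Re_le_cmod[of "g w"] by (simp add: g_def norm_mult u1)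
  have gb: "\<bar>Re (g w)\<bar> \<le> M" if "0 \<le> Im w" for w using order_trans[OF gle bdd[OF that]] .
  define x1 where "x1 = Re z"
  define y where "y = Im z"
  have zc: "z = Complex x1 y" by (simp add: x1_def y_def)
  have y: "y > 0" using z by (simp add: y_def)
  define K where "K = y * (1 + 1 / (\<delta> / 2)\<^sup>2)"
  have K: "K \<ge> 0" using y by (simp add: K_def)
  have "cmod (f z) = Re (g z)" by (simp add: g_def uf)
  also have "\<dots> = (\<integral>x. Re (g (of_real x)) * poisson_kernel y (x - x1) \<partial>lborel)"
    unfolding zc by (rule poisson_bounded(2)[OF g gb y])
  also have "\<dots> \<le> (\<integral>x. \<epsilon> * poisson_kernel y (x - x1) + M * K * poisson_kernel 1 (x - x1) \<partial>lborel)"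
  proof (rule integral_mono)
    show "integrable lborel (\<lambda>x. Re (g (of_real x)) * poisson_kernel y (x - x1))"
      by (rule poisson_bounded(1)[OF g gb y])
    show "integrable lborel (\<lambda>x. \<epsilon> * poisson_kernel y (x - x1) + M * K * poisson_kernel 1 (x - x1))"
      using y by (intro Bochner_Integration.integrable_add integrable_mult_right poisson_kernel_mass(1)) auto
    fix x
    have P: "poisson_kernel y (x - x1) \<ge> 0" "poisson_kernel 1 (x - x1) \<ge> 0"
      using y by (auto intro: poisson_kernel_nonneg)
    show "Re (g (of_real x)) * poisson_kernel y (x - x1)
        \<le> \<epsilon> * poisson_kernel y (x - x1) + M * K * poisson_kernel 1 (x - x1)"
    proof (cases "\<bar>x - x0\<bar> < \<delta>")
      case True
      have "Re (g (of_real x)) \<le> \<epsilon>" using gle[of "of_real x"] small[OF True] by linarith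
      then have "Re (g (of_real x)) * poisson_kernel y (x - x1) \<le> \<epsilon> * poisson_kernel y (x - x1)"
        using P by (intro mult_right_mono)
      then show ?thesis using P M K by (smt (verit) mult_nonneg_nonneg)
    next
      case False
      then have "\<delta> / 2 \<le> \<bar>x - x1\<bar>" using z unfolding x1_def by linarith
      then have "poisson_kernel y (x - x1) \<le> K * poisson_kernel 1 (x - x1)"
        unfolding K_def using \<delta> y by (intro poisson_kernel_tail) auto
      then have "M * poisson_kernel y (x - x1) \<le> M * (K * poisson_kernel 1 (x - x1))"
        using M by (rule mult_left_mono)
      moreover have "Re (g (of_real x)) * poisson_kernel y (x - x1) \<le> M * poisson_kernel y (x - x1)"
        using gb[of "of_real x"] P by (intro mult_right_mono) auto
      moreover have "\<epsilon> * poisson_kernel y (x - x1) \<ge> 0" using P \<epsilon> by simp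
      ultimately show ?thesis by (simp add: mult.assoc)
    qed
  qed
  also have "\<dots> = \<epsilon> + M * K"
    using poisson_kernel_mass[OF y, of x1] poisson_kernel_mass[of 1 x1]
    by (subst Bochner_Integration.integral_add) (auto simp del: integral_mult_right simp: integral_mult_right_zero)
  finally show ?thesis by (simp add: K_def y_def)
qed

text \<open>After subtracting its linearisation at \<open>x0\<close>, the primitive \<open>F\<close> is small near \<open>x0\<close> on the real line, hence by
  the Poisson majorant also in cones; Cauchy's estimate turns this into a bound for \<open>F' - c\<close>.\<close>

lemma nontangential_limit_at_differentiable_point:
  assumes der: "\<And>z. 0 < Im z \<Longrightarrow> (F has_field_derivative w z) (at z)"
    and lip: "L-lipschitz_on {z. 0 \<le> Im z} F"
    and diff: "((\<lambda>x. F (of_real x)) has_vector_derivative c) (at x0)"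
    and \<alpha>: "0 < \<alpha>"
  shows "(w \<longlongrightarrow> c) (at (of_real x0) within stolz_cone \<alpha> x0)"
proof -
  define G where "G = (\<lambda>z. F z - F (of_real x0) - c * (z - of_real x0))"
  define M where "M = L + cmod c"
  have contF: "continuous_on {z. 0 \<le> Im z} F" using lip by (rule lipschitz_on_continuous_on)
  have holF: "F holomorphic_on {z. 0 < Im z}"
    using der by (auto simp: holomorphic_on_open open_halfspace_Im_gt)
  have contG: "continuous_on {z. 0 \<le> Im z} G" unfolding G_def by (intro continuous_intros contF)
  have holG: "G holomorphic_on {z. 0 < Im z}" unfolding G_def by (intro holomorphic_intros holF)
  have G_le: "cmod (G z) \<le> M * cmod (z - of_real x0)" if "0 \<le> Im z" for z
  proof -
    have "cmod (F z - F (of_real x0)) \<le> L * cmod (z - of_real x0)"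
      using lipschitz_on_normD[OF lip, of z "of_real x0"] that by simp
    then show ?thesis unfolding G_def M_def
      using norm_triangle_ineq4[of "F z - F (of_real x0)" "c * (z - of_real x0)"]
      by (simp add: norm_mult distrib_right)
  qed
  have M: "M \<ge> 0" using lipschitz_on_nonneg[OF lip] by (simp add: M_def)
  have little_o: "\<exists>\<rho>>0. \<forall>z. 0 < Im z \<and> cmod (z - of_real x0) < \<rho> \<longrightarrow> cmod (G z) \<le> e * cmod (z - of_real x0)"
    if e: "e > 0" for e
  proof -
    obtain \<delta> where \<delta>: "\<delta> > 0" "\<And>x. \<bar>x - x0\<bar> < \<delta> \<Longrightarrow> cmod (G (of_real x)) \<le> e / 2 * \<bar>x - x0\<bar>"
    proof -
      have "\<exists>d>0. \<forall>y. norm (y - x0) < d \<longrightarrow>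
          norm (F (of_real y) - F (of_real x0) - (y - x0) *\<^sub>R c) \<le> e / 2 * norm (y - x0)"
        using diff e unfolding has_vector_derivative_def has_derivative_at_alt by (meson half_gt_zero)
      then obtain d where d: "d > 0" "\<And>y. norm (y - x0) < d \<Longrightarrow>
          norm (F (of_real y) - F (of_real x0) - (y - x0) *\<^sub>R c) \<le> e / 2 * norm (y - x0)" by blast
      have eq: "F (of_real y) - F (of_real x0) - (y - x0) *\<^sub>R c = G (of_real y)" for y
        by (simp add: G_def scaleR_conv_of_real mult.commute)
      show thesis by (rule that[of d]) (use d in \<open>simp_all only: eq real_norm_def\<close>)
    qed
    define C where "C = M * (1 + 1 / (\<delta> / 2)\<^sup>2)"
    have C: "C \<ge> 0" using M by (simp add: C_def)
    \<comment> \<open>The first entry keeps \<open>Re z\<close> within \<open>\<delta> / 2\<close>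
      of \<open>x0\<close>, as the majorant requires; the second makes the far part
      \<open>C * Im z\<close> at most \<open>e / 2\<close>.\<close>
    define \<rho> where "\<rho> = min (\<delta> / 2) (e / (2 * (C + 1)))"
    have \<rho>: "\<rho> > 0" using \<delta> e C by (simp add: \<rho>_def)
    show ?thesis
    proof (intro exI[of _ \<rho>] conjI allI impI \<rho>)
      fix z assume z: "0 < Im z \<and> cmod (z - of_real x0) < \<rho>"
      \<comment> \<open>The quotient by \<open>z - x0\<close> would be undefined at
        \<open>x0\<close>. Lowering the pole to \<open>x0 - \<i> k\<close> gives a function
        continuous on the closed half plane and only decreases the quotient; \<open>k\<close> tends
        to 0 afterwards.\<close>
      have *: "cmod (G z) \<le> e * cmod (z - of_real x0 + \<i> * of_real k)" if k: "k > 0" for k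
      proof -
        define H where "H = (\<lambda>z. G z / (z - of_real x0 + \<i> * of_real k))"
        have den: "cmod (z - of_real x0) \<le> cmod (z - of_real x0 + \<i> * of_real k)"
          "z - of_real x0 + \<i> * of_real k \<noteq> 0" if "0 \<le> Im z" for z
        proof -
          have "(Im z)\<^sup>2 \<le> (Im z + k)\<^sup>2" using that k by (intro power_mono) auto
          then show "cmod (z - of_real x0) \<le> cmod (z - of_real x0 + \<i> * of_real k)"
            by (simp add: cmod_def)
          show "z - of_real x0 + \<i> * of_real k \<noteq> 0" using that k by (auto simp: complex_eq_iff)
        qed
        have Hb: "cmod (H z) \<le> B" if "0 \<le> Im z" "cmod (G z) \<le> B * cmod (z - of_real x0)" "B \<ge> 0" for z B
        proof -
          have "cmod (G z) \<le> B * cmod (z - of_real x0 + \<i> * of_real k)"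
            using that(2) mult_left_mono[OF den(1)[OF that(1)] that(3)] by linarith
          then show ?thesis using den(2)[OF that(1)] by (simp add: H_def norm_divide divide_le_eq)
        qed
        have "cmod (H z) \<le> e / 2 + M * (Im z * (1 + 1 / (\<delta> / 2)\<^sup>2))"
        proof (rule poisson_majorant[of H M x0 \<delta> "e / 2" z])
          show "continuous_on {z. 0 \<le> Im z} H" unfolding H_def
            using den by (intro continuous_intros contG) auto
          show "H holomorphic_on {z. 0 < Im z}" unfolding H_def
            using den by (intro holomorphic_intros holG) auto
          show "cmod (H z) \<le> M" if "0 \<le> Im z" for z using Hb[OF that G_le[OF that] M] .
          show "cmod (H (of_real x)) \<le> e / 2" if "\<bar>x - x0\<bar> < \<delta>" for x
            using Hb[of "of_real x" "e / 2"] \<delta>(2)[OF that] e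
            by (simp flip: of_real_diff)
          show "0 < \<delta>" "0 < Im z" using \<delta> z by auto
          show "\<bar>Re z - x0\<bar> \<le> \<delta> / 2"
            using z abs_Re_le_cmod[of "z - of_real x0"] by (auto simp: \<rho>_def)
        qed
        also have "\<dots> = e / 2 + C * Im z" by (simp add: C_def)
        also have "C * Im z \<le> (C + 1) * (e / (2 * (C + 1)))"
          using z abs_Im_le_cmod[of "z - of_real x0"] C by (intro mult_mono) (auto simp: \<rho>_def)
        also have "\<dots> = e / 2"
        proof -
          have "D * (e / (2 * D)) = e / 2" if "D \<noteq> 0" for D using that by simp
          then show ?thesis using C by (metis add_nonneg_eq_0_iff zero_le_one zero_neq_one)
        qed
        finally have "cmod (H z) \<le> e" by simp
        then show ?thesis using den(2)[of z] z by (simp add: H_def norm_divide divide_le_eq)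
      qed
      have "((\<lambda>k. e * cmod (z - of_real x0 + \<i> * of_real k)) \<longlongrightarrow> e * cmod (z - of_real x0 + \<i> * of_real 0)) (at_right 0)"
        by (intro tendsto_intros)
      then have "cmod (G z) \<le> e * cmod (z - of_real x0 + \<i> * of_real 0)"
      proof (rule tendsto_lowerbound)
        show "\<forall>\<^sub>F k in at_right 0. cmod (G z) \<le> e * cmod (z - of_real x0 + \<i> * of_real k)"
          using eventually_at_right_less[of 0] by eventually_elim (rule *)
      qed simp
      then show "cmod (G z) \<le> e * cmod (z - of_real x0)" by simp
    qed
  qed
  show ?thesis
    unfolding Lim_within
  proof (intro allI impI)
    fix e :: real assume e: "e > 0"
    \<comment> \<open>Cauchy's estimate on a disc of radius \<open>y / 2\<close> costs a factor 4
      together with the doubling of \<open>|z - x0|\<close>, and in the cone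
      \<open>|z - x0| / y < \<alpha> + 1\<close>.\<close>
    define e' where "e' = e / (4 * (\<alpha> + 1))"
    have e': "e' > 0" using e \<alpha> by (simp add: e'_def)
    obtain \<rho> where \<rho>: "\<rho> > 0" "\<And>z. 0 < Im z \<Longrightarrow> cmod (z - of_real x0) < \<rho> \<Longrightarrow> cmod (G z) \<le> e' * cmod (z - of_real x0)"
      using little_o[OF e'] by blast
    show "\<exists>d>0. \<forall>z\<in>stolz_cone \<alpha> x0. 0 < dist z (of_real x0) \<and> dist z (of_real x0) < d \<longrightarrow> dist (w z) c < e"
    proof (intro exI[of _ "\<rho> / 2"] conjI ballI impI)
      show "0 < \<rho> / 2" using \<rho> by simp
      fix z assume z: "z \<in> stolz_cone \<alpha> x0" and d: "0 < dist z (of_real x0) \<and> dist z (of_real x0) < \<rho> / 2"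
      define y where "y = Im z"
      have y: "y > 0" and re: "\<bar>Re z - x0\<bar> < \<alpha> * y" using z by (auto simp: stolz_cone_def y_def)
      have dz: "cmod (z - of_real x0) < (\<alpha> + 1) * y"
      proof -
        have "cmod (z - of_real x0) \<le> \<bar>Re z - x0\<bar> + \<bar>Im z\<bar>" using cmod_le[of "z - of_real x0"] by simp
        then show ?thesis using re y by (simp add: y_def distrib_right)
      qed
      have yd: "y \<le> cmod (z - of_real x0)" using abs_Im_le_cmod[of "z - of_real x0"] y by (simp add: y_def)
      have up: "0 < Im x" if "x \<in> cball z (y / 2)" for x
      proof -
        have "\<bar>Im z - Im x\<bar> \<le> Im z / 2" using that abs_Im_le_cmod[of "z - x"] by (simp add: dist_norm y_def)
        then show ?thesis using y unfolding y_def by linarith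
      qed
      have derG: "(G has_field_derivative (w z - c)) (at z)"
        unfolding G_def using y by (auto intro!: derivative_eq_intros der simp: y_def)
      have "norm ((deriv ^^ 1) G z) \<le> fact 1 * (e' * (2 * cmod (z - of_real x0))) / (y / 2) ^ 1"
      proof (rule Cauchy_inequality)
        show "G holomorphic_on ball z (y / 2)" using up ball_subset_cball by (intro holomorphic_on_subset[OF holG]) blast
        show "continuous_on (cball z (y / 2)) G" using less_imp_le[OF up] by (intro continuous_on_subset[OF contG]) blast
        show "0 < y / 2" using y by simp
        fix x assume x: "norm (z - x) = y / 2"
        have "cmod (x - of_real x0) \<le> cmod (z - of_real x0) + y / 2"
          using norm_triangle_ineq4[of "z - of_real x0" "z - x"] x by simp
        then have 1: "cmod (x - of_real x0) \<le> 2 * cmod (z - of_real x0)" using yd y by linarith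
        have "cmod (G x) \<le> e' * cmod (x - of_real x0)"
        proof (rule \<rho>(2))
          show "0 < Im x" by (rule up) (simp add: dist_norm x)
          show "cmod (x - of_real x0) < \<rho>" using 1 d by (simp add: dist_norm)
        qed
        also have "\<dots> \<le> e' * (2 * cmod (z - of_real x0))" using 1 e' by (intro mult_left_mono) auto
        finally show "cmod (G x) \<le> e' * (2 * cmod (z - of_real x0))" .
      qed
      then have "cmod (w z - c) \<le> e' * (2 * cmod (z - of_real x0)) / (y / 2)"
        using DERIV_imp_deriv[OF derG] by simp
      also have "\<dots> = 4 * e' * (cmod (z - of_real x0) / y)" by simp
      also have "\<dots> < 4 * e' * (\<alpha> + 1)"
        using dz y e' by (intro mult_strict_left_mono) (auto simp: divide_less_eq)
      also have "\<dots> = e"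
      proof -
        have "4 * (e / (4 * D)) * D = e" if "D \<noteq> 0" for D using that by simp
        then show ?thesis unfolding e'_def using \<alpha> by (metis add_pos_pos less_irrefl zero_less_one)
      qed
      finally show "dist (w z) c < e" by (simp add: dist_norm)
    qed
  qed
qed

text \<open>Since \<open>|w| \<le> 1\<close>, a primitive of \<open>w\<close> is 1-Lipschitz and
  extends to the closed half plane. Its real and imaginary parts on the real line are Lipschitz,
  hence differentiable almost everywhere, and at each such point the derivative is the nontangential
  limit of \<open>w\<close>.\<close>

theorem fatou_nontangential:
  assumes hol: "w holomorphic_on {z. 0 < Im z}" and bdd: "\<And>z. 0 < Im z \<Longrightarrow> cmod (w z) \<le> 1"
  shows "AE x in lebesgue. \<exists>c. \<forall>\<alpha>>0. (w \<longlongrightarrow> c) (at (of_real x) within stolz_cone \<alpha> x)"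
proof -
  have op: "open {z. 0 < Im z}" and conv: "convex {z. 0 < Im z}"
    by (auto simp: open_halfspace_Im_gt convex_halfspace_Im_gt)
  obtain F0 where F0: "\<And>z. z \<in> {z. 0 < Im z} \<Longrightarrow> (F0 has_field_derivative w z) (at z within {z. 0 < Im z})"
    using holomorphic_convex_primitive'[OF conv op hol] by blast
  have "1-lipschitz_on {z. 0 < Im z} F0"
  proof (rule lipschitz_onI)
    fix x y assume "x \<in> {z. 0 < Im z}" "y \<in> {z. 0 < Im z}"
    then show "dist (F0 x) (F0 y) \<le> 1 * dist x y"
      unfolding dist_norm by (intro field_differentiable_bound[OF conv F0]) (auto simp: bdd)
  qed simp
  moreover have "closure {z. 0 < Im z} = {z. 0 \<le> Im z}"
    using closure_halfspace_gt[of \<i> 0] by (simp add: inner_complex_def)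
  ultimately obtain F where F: "1-lipschitz_on {z. 0 \<le> Im z} F" "\<And>z. 0 < Im z \<Longrightarrow> F z = F0 z"
    using lipschitz_extend_closure[of 1 "{z. 0 < Im z}" F0] by auto
  have der: "(F has_field_derivative w z) (at z)" if "0 < Im z" for z
  proof -
    have z: "z \<in> {z. 0 < Im z}" using that by simp
    have "(F0 has_field_derivative w z) (at z)" using F0[OF z] by (simp only: at_within_open[OF z op])
    moreover have "\<forall>\<^sub>F u in nhds z. F u = F0 u"
      using eventually_nhds_in_open[OF op z] by eventually_elim (simp add: F(2))
    ultimately show ?thesis by (simp add: DERIV_cong_ev)
  qed
  have l: "cmod (F (of_real x) - F (of_real y)) \<le> 1 * \<bar>x - y\<bar>" for x y
    using lipschitz_on_normD[OF F(1), of "of_real x" "of_real y"] by (simp flip: of_real_diff)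
  have "AE x in lebesgue. \<exists>c. ((\<lambda>x. Re (F (of_real x))) has_vector_derivative c) (at x)"
    by (rule lipschitz_AE_differentiable_real[of _ 1]) (use l abs_Re_le_cmod order_trans in \<open>fastforce simp flip: minus_complex.sel\<close>)
  moreover have "AE x in lebesgue. \<exists>c. ((\<lambda>x. Im (F (of_real x))) has_vector_derivative c) (at x)"
    by (rule lipschitz_AE_differentiable_real[of _ 1]) (use l abs_Im_le_cmod order_trans in \<open>fastforce simp flip: minus_complex.sel\<close>)
  ultimately show ?thesis
  proof eventually_elim
    case (elim x)
    then obtain c d where "((\<lambda>x. Re (F (of_real x))) has_vector_derivative c) (at x)"
      "((\<lambda>x. Im (F (of_real x))) has_vector_derivative d) (at x)" by blast
    then have "((\<lambda>x. F (of_real x)) has_vector_derivative Complex c d) (at x)"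
      by (simp add: has_vector_derivative_complex_iff has_real_derivative_iff_has_vector_derivative)
    then show ?case
      using nontangential_limit_at_differentiable_point[OF der F(1)] by blast
  qed
qed

section \<open>Row solutions of the canonical system\<close>

lemma has_vector_derivative_cmod_square:
  assumes "(q has_vector_derivative q') (at t)"
  shows "((\<lambda>t. (cmod (q t))\<^sup>2) has_vector_derivative 2 * Re (cnj (q t) * q')) (at t)"
proof -
  have "((\<lambda>t. cnj (q t) * q t) has_vector_derivative (cnj (q t) * q' + cnj q' * q t)) (at t)"
    by (intro has_vector_derivative_mult bounded_linear.has_vector_derivative[OF bounded_linear_cnj] assms)
  then have "((\<lambda>t. Re (cnj (q t) * q t)) has_vector_derivative Re (cnj (q t) * q' + cnj q' * q t)) (at t)"
    by (rule bounded_linear.has_vector_derivative[OF bounded_linear_Re])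
  moreover have "Re (cnj (q t) * q t) = (cmod (q t))\<^sup>2" for t by (simp add: cmod_def power2_eq_square)
  ultimately show ?thesis by (simp add: mult.commute)
qed

lemma abs_continuous_on_cmod_square:
  assumes "abs_continuous_on {a..b} q"
  shows "abs_continuous_on {a..b} (\<lambda>t. (cmod (q t))\<^sup>2)"
proof -
  have "abs_continuous_on {a..b} (\<lambda>t. Re (cnj (q t) * q t))"
    by (intro abs_continuous_on_bounded_linear[OF bounded_linear_Re] abs_continuous_on_mult
          abs_continuous_on_bounded_linear[OF bounded_linear_cnj] assms)
  moreover have "Re (cnj (q t) * q t) = (cmod (q t))\<^sup>2" for t by (simp add: cmod_def power2_eq_square)
  ultimately show ?thesis by simp
qed

lemma has_vector_derivative_ln:
  fixes f :: "real \<Rightarrow> real"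
  assumes "(f has_vector_derivative d) (at t)" "0 < f t"
  shows "((\<lambda>t. ln (f t)) has_vector_derivative d / f t) (at t)"
  using assms unfolding has_real_derivative_iff_has_vector_derivative[symmetric]
  by (auto intro!: derivative_eq_intros)

text \<open>The quantity \<open>ln (|P|^2 + |Q|^2 + e^2)\<close> grows at rate at most
  \<open>6 k\<close>, where 6 is 2 from differentiating squares times 3 from
  \<open>(x + y + e)^2 \<le> 3 (x^2 + y^2 + e^2)\<close>. The term \<open>e\<close> makes the
  logarithm finite when \<open>P = Q = 0\<close> and at the same time absorbs a forcing term; the
  applications to differences in the spectral parameter choose it proportional to the
  forcing.\<close>

lemma gronwall_pair:
  fixes P Q :: "real \<Rightarrow> complex"
  assumes T: "0 \<le> T" and ac: "abs_continuous_on {0..T} P" "abs_continuous_on {0..T} Q"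
    and e: "0 < e" and k: "k integrable_on {0..T}" and k0: "\<And>t. 0 \<le> k t"
    and der: "AE t in lebesgue. 0 < t \<and> t < T \<longrightarrow> (\<exists>P' Q'. (P has_vector_derivative P') (at t) \<and>
      (Q has_vector_derivative Q') (at t) \<and>
      cmod P' \<le> k t * (cmod (P t) + cmod (Q t) + e) \<and> cmod Q' \<le> k t * (cmod (P t) + cmod (Q t) + e))"
  shows "(cmod (P T))\<^sup>2 + (cmod (Q T))\<^sup>2 \<le> ((cmod (P 0))\<^sup>2 + (cmod (Q 0))\<^sup>2 + e\<^sup>2) * exp (6 * integral {0..T} k)"
proof -
  define m where "m = (\<lambda>t. (cmod (P t))\<^sup>2 + (cmod (Q t))\<^sup>2 + e\<^sup>2)"
  have m_ge: "e\<^sup>2 \<le> m t" for t by (simp add: m_def)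
  have m_pos: "0 < m t" for t using m_ge[of t] e by (smt (verit) zero_less_power)
  have acm: "abs_continuous_on {0..T} m" unfolding m_def
    by (intro abs_continuous_on_add abs_continuous_on_cmod_square ac abs_continuous_on_const)
  have "ln (m T) - ln (m 0) \<le> integral {0..T} (\<lambda>t. 6 * k t)"
  proof (rule abs_continuous_deriv_le[OF T])
    show "abs_continuous_on {0..T} (\<lambda>t. ln (m t))"
      by (rule abs_continuous_on_ln[OF acm, of "e\<^sup>2"]) (use e m_ge in auto)
    show "(\<lambda>t. 6 * k t) integrable_on {0..T}" using k by (rule integrable_on_mult_right)
    show "AE t in lebesgue. 0 < t \<and> t < T \<longrightarrow> (\<exists>d. ((\<lambda>t. ln (m t)) has_vector_derivative d) (at t) \<and> d \<le> 6 * k t)"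
      using der
    proof eventually_elim
      case (elim t)
      show ?case
      proof (intro impI)
        assume "0 < t \<and> t < T"
        then obtain P' Q' where P': "(P has_vector_derivative P') (at t)" "(Q has_vector_derivative Q') (at t)"
          "cmod P' \<le> k t * (cmod (P t) + cmod (Q t) + e)" "cmod Q' \<le> k t * (cmod (P t) + cmod (Q t) + e)"
          using elim by blast
        define d where "d = 2 * Re (cnj (P t) * P') + 2 * Re (cnj (Q t) * Q') + 0"
        have dm: "(m has_vector_derivative d) (at t)" unfolding m_def d_def
          by (intro has_vector_derivative_add has_vector_derivative_cmod_square P' has_vector_derivative_const)
        define S where "S = cmod (P t) + cmod (Q t) + e"
        have S: "S \<ge> 0" using e by (simp add: S_def)
        have "Re (cnj (P t) * P') \<le> cmod (P t) * (k t * S)"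
          using complex_Re_le_cmod[of "cnj (P t) * P'"] mult_left_mono[OF P'(3), of "cmod (P t)"]
          by (simp add: norm_mult S_def)
        moreover have "Re (cnj (Q t) * Q') \<le> cmod (Q t) * (k t * S)"
          using complex_Re_le_cmod[of "cnj (Q t) * Q'"] mult_left_mono[OF P'(4), of "cmod (Q t)"]
          by (simp add: norm_mult S_def)
        ultimately have "d \<le> 2 * (k t * ((cmod (P t) + cmod (Q t)) * S))" by (simp add: d_def algebra_simps)
        also have "\<dots> \<le> 2 * (k t * (3 * m t))"
        proof (intro mult_left_mono)
          have "(cmod (P t) + cmod (Q t)) * S \<le> S * S" using S e by (intro mult_right_mono) (auto simp: S_def)
          also have "\<dots> \<le> 3 * m t"
          proof -
            have "0 \<le> (cmod (P t) - cmod (Q t))\<^sup>2 + (cmod (P t) - e)\<^sup>2 + (cmod (Q t) - e)\<^sup>2" by simp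
            then show ?thesis by (simp add: S_def m_def power2_eq_square algebra_simps)
          qed
          finally show "(cmod (P t) + cmod (Q t)) * S \<le> 3 * m t" .
        qed (use k0 in auto)
        finally have "d / m t \<le> 6 * k t" using m_pos[of t] by (simp add: divide_le_eq mult_ac)
        then show "\<exists>d. ((\<lambda>t. ln (m t)) has_vector_derivative d) (at t) \<and> d \<le> 6 * k t"
          using has_vector_derivative_ln[OF dm m_pos] by blast
      qed
    qed
  qed
  then have "ln (m T) \<le> ln (m 0) + 6 * integral {0..T} k" by simp
  then have "exp (ln (m T)) \<le> exp (ln (m 0) + 6 * integral {0..T} k)" by simp
  then have "m T \<le> m 0 * exp (6 * integral {0..T} k)" using m_pos by (simp add: exp_add)
  moreover have "(cmod (P T))\<^sup>2 + (cmod (Q T))\<^sup>2 \<le> m T" by (simp add: m_def)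
  ultimately show ?thesis unfolding m_def by linarith
qed

text \<open>Half the derivative of \<open>|q|^2 - |p|^2\<close> along the system. The contribution
  of the skew-adjoint \<open>B\<close> cancels and that of \<open>A\<close> is multiplied by
  \<open>Im z\<close>; the bracket on the right is the quadratic form of \<open>A\<close> at the row
  \<open>(p, q)\<close>.\<close>

lemma energy_derivative_identity:
  fixes p q z b :: complex and a :: real
  shows "Re (cnj q * ((1 - \<i> * z) * b * p - \<i> * z * a * q)) - Re (cnj p * (\<i> * z * a * p + (1 + \<i> * z) * cnj b * q))
    = Im z * (a * (cmod p)\<^sup>2 + a * (cmod q)\<^sup>2 + 2 * Re (b * p * cnj q))"
  unfolding cmod_power2 by (simp add: algebra_simps power2_eq_square)

lemma energy_form_nonneg:
  assumes "cmod \<beta> \<le> \<alpha>"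
  shows "0 \<le> \<alpha> * (cmod p)\<^sup>2 + \<alpha> * (cmod q)\<^sup>2 + 2 * Re (\<beta> * p * cnj q)"
proof -
  have "\<bar>Re (\<beta> * p * cnj q)\<bar> \<le> cmod \<beta> * (cmod p * cmod q)"
    using abs_Re_le_cmod[of "\<beta> * p * cnj q"] by (simp add: norm_mult mult.assoc)
  also have "\<dots> \<le> \<alpha> * (cmod p * cmod q)" using assms by (intro mult_right_mono) auto
  finally have "- (2 * (\<alpha> * (cmod p * cmod q))) \<le> 2 * Re (\<beta> * p * cnj q)" by (simp add: abs_le_iff)
  moreover have "\<alpha> \<ge> 0" using assms norm_ge_zero[of \<beta>] by linarith
  then have "0 \<le> \<alpha> * (cmod p - cmod q)\<^sup>2" by simp
  ultimately show ?thesis by (simp add: power2_eq_square algebra_simps)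
qed

text \<open>The coefficients live on the whole line so that primitives may start to the left of 0.
  The bound on \<open>b\<close> holds at every point, which makes the square root \<open>lam\<close>
  meaningful everywhere.\<close>

locale canonical_coefficients =
  fixes a :: "real \<Rightarrow> real" and b :: "real \<Rightarrow> complex"
  assumes norm_b_le: "\<And>t. cmod (b t) \<le> a t"
    and measurable_a [measurable]: "a \<in> borel_measurable lebesgue"
    and measurable_b [measurable]: "b \<in> borel_measurable lebesgue"
    and integrable_a: "\<And>u v. a integrable_on {u..v}"
begin

lemma a_nonneg: "0 \<le> a t"
  using norm_b_le[of t] order_trans[OF norm_ge_zero] by blast

text \<open>In the Arov gauge \<open>A\<close> has diagonal entries \<open>a\<close>, \<open>B\<close> has zero diagonal, and both have the upper right
  entry \<open>b\<close>; a row \<open>(p, q)\<close> of a matrix solution then satisfies the following scalar system.\<close>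

definition row_solution :: "complex \<Rightarrow> (real \<Rightarrow> complex) \<Rightarrow> (real \<Rightarrow> complex) \<Rightarrow> bool"
  where "row_solution z p q \<longleftrightarrow>
    (\<forall>T. abs_continuous_on {0..T} p \<and> abs_continuous_on {0..T} q) \<and>
    (AE t in lebesgue. 0 < t \<longrightarrow>
      (p has_vector_derivative (\<i> * z * a t * p t + (1 + \<i> * z) * cnj (b t) * q t)) (at t) \<and>
      (q has_vector_derivative ((1 - \<i> * z) * b t * p t - \<i> * z * a t * q t)) (at t))"

lemma row_solutionD:
  assumes "row_solution z p q"
  shows "0 \<le> s \<Longrightarrow> abs_continuous_on {s..T} p" "0 \<le> s \<Longrightarrow> abs_continuous_on {s..T} q"
    "AE t in lebesgue. 0 < t \<longrightarrow>
      (p has_vector_derivative (\<i> * z * a t * p t + (1 + \<i> * z) * cnj (b t) * q t)) (at t) \<and>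
      (q has_vector_derivative ((1 - \<i> * z) * b t * p t - \<i> * z * a t * q t)) (at t)"
  using assms abs_continuous_on_subset[of "{0..T}" _ "{s..T}"] unfolding row_solution_def by auto

lemma row_solution_lincomb:
  assumes "row_solution z p q" "row_solution z p' q'"
  shows "row_solution z (\<lambda>t. c * p t + d * p' t) (\<lambda>t. c * q t + d * q' t)"
  unfolding row_solution_def
proof (intro conjI allI)
  have m: "bounded_linear (\<lambda>x. c * x)" for c :: complex by (rule bounded_linear_mult_right)
  show "abs_continuous_on {0..T} (\<lambda>t. c * p t + d * p' t)" "abs_continuous_on {0..T} (\<lambda>t. c * q t + d * q' t)" for T
    using assms by (auto intro!: abs_continuous_on_add abs_continuous_on_bounded_linear[OF m] simp: row_solution_def)
  show "AE t in lebesgue. 0 < t \<longrightarrow>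
      ((\<lambda>t. c * p t + d * p' t) has_vector_derivative (\<i> * z * a t * (c * p t + d * p' t) + (1 + \<i> * z) * cnj (b t) * (c * q t + d * q' t))) (at t) \<and>
      ((\<lambda>t. c * q t + d * q' t) has_vector_derivative ((1 - \<i> * z) * b t * (c * p t + d * p' t) - \<i> * z * a t * (c * q t + d * q' t))) (at t)"
    using row_solutionD(3)[OF assms(1)] row_solutionD(3)[OF assms(2)]
  proof eventually_elim
    case (elim t)
    show ?case
    proof (intro impI conjI)
      assume t: "0 < t"
      show "((\<lambda>t. c * p t + d * p' t) has_vector_derivative (\<i> * z * a t * (c * p t + d * p' t) + (1 + \<i> * z) * cnj (b t) * (c * q t + d * q' t))) (at t)"
        by (rule has_vector_derivative_eq_rhs[OF has_vector_derivative_add[OF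
              bounded_linear.has_vector_derivative[OF m] bounded_linear.has_vector_derivative[OF m]]])
           (use elim t in \<open>auto simp: algebra_simps\<close>)
      show "((\<lambda>t. c * q t + d * q' t) has_vector_derivative ((1 - \<i> * z) * b t * (c * p t + d * p' t) - \<i> * z * a t * (c * q t + d * q' t))) (at t)"
        by (rule has_vector_derivative_eq_rhs[OF has_vector_derivative_add[OF
              bounded_linear.has_vector_derivative[OF m] bounded_linear.has_vector_derivative[OF m]]])
           (use elim t in \<open>auto simp: algebra_simps\<close>)
    qed
  qed
qed

text \<open>Liouville's formula: the system for \<open>(p, q)\<close> has diagonal coefficients
  \<open>\<i> z a\<close> and \<open>- \<i> z a\<close>, hence trace zero.\<close>

lemma row_solution_det:
  assumes 1: "row_solution z p q" and 2: "row_solution z p' q'" and T: "0 \<le> T"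
  shows "p T * q' T - p' T * q T = p 0 * q' 0 - p' 0 * q 0"
proof -
  have "((\<lambda>t. 0) has_integral ((p T * q' T - p' T * q T) - (p 0 * q' 0 - p' 0 * q 0))) {0..T}"
  proof (rule abs_continuous_has_integral[OF T])
    show "abs_continuous_on {0..T} (\<lambda>T. p T * q' T - p' T * q T)"
      using 1 2 by (intro abs_continuous_on_diff abs_continuous_on_mult row_solutionD) auto
    show "AE t in lebesgue. 0 < t \<and> t < T \<longrightarrow> ((\<lambda>T. p T * q' T - p' T * q T) has_vector_derivative 0) (at t)"
      using row_solutionD(3)[OF 1] row_solutionD(3)[OF 2]
    proof eventually_elim
      case (elim t)
      show ?case
        by (intro impI, rule has_vector_derivative_eq_rhs[OF has_vector_derivative_diff[OF
              has_vector_derivative_mult has_vector_derivative_mult]])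
           (use elim in \<open>auto simp: algebra_simps\<close>)
    qed
  qed
  then show ?thesis using has_integral_unique[OF _ has_integral_0] by fastforce
qed

text \<open>Integration of the energy identity: the quadratic form of \<open>A\<close> is
  nonnegative, and its factor \<open>Im z\<close> decides between growth and conservation.\<close>

lemma
  assumes sol: "row_solution z p q"
  shows energy_mono: "\<lbrakk>0 \<le> Im z; 0 \<le> s; s \<le> t\<rbrakk> \<Longrightarrow> (cmod (q s))\<^sup>2 - (cmod (p s))\<^sup>2 \<le> (cmod (q t))\<^sup>2 - (cmod (p t))\<^sup>2"
    and energy_const: "\<lbrakk>Im z = 0; 0 \<le> t\<rbrakk> \<Longrightarrow> (cmod (q t))\<^sup>2 - (cmod (p t))\<^sup>2 = (cmod (q 0))\<^sup>2 - (cmod (p 0))\<^sup>2"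
proof -
  define F where "F = (\<lambda>t. Im z * (a t * (cmod (p t))\<^sup>2 + a t * (cmod (q t))\<^sup>2 + 2 * Re (b t * p t * cnj (q t))))"
  have der: "AE t in lebesgue. 0 < t \<longrightarrow> ((\<lambda>t. (cmod (q t))\<^sup>2 - (cmod (p t))\<^sup>2) has_vector_derivative 2 * F t) (at t)"
    using row_solutionD(3)[OF sol]
  proof eventually_elim
    case (elim t)
    show ?case
      by (intro impI, rule has_vector_derivative_eq_rhs[OF has_vector_derivative_diff[OF
            has_vector_derivative_cmod_square has_vector_derivative_cmod_square]])
         (use elim energy_derivative_identity[of "q t" z "b t" "p t" "a t"] in \<open>auto simp: F_def\<close>)
  qed
  have ac: "abs_continuous_on {s..t} (\<lambda>t. (cmod (q t))\<^sup>2 - (cmod (p t))\<^sup>2)" if "0 \<le> s" for s t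
    using sol that by (intro abs_continuous_on_diff abs_continuous_on_cmod_square row_solutionD)
  have int: "((\<lambda>t. 2 * F t) has_integral ((cmod (q t))\<^sup>2 - (cmod (p t))\<^sup>2 - ((cmod (q s))\<^sup>2 - (cmod (p s))\<^sup>2))) {s..t}"
    if "0 \<le> s" "s \<le> t" for s t
    by (rule abs_continuous_has_integral[OF that(2) ac[OF that(1)]])
       (use der in eventually_elim, use that in auto)
  show "(cmod (q s))\<^sup>2 - (cmod (p s))\<^sup>2 \<le> (cmod (q t))\<^sup>2 - (cmod (p t))\<^sup>2" if "0 \<le> Im z" "0 \<le> s" "s \<le> t"
  proof -
    have "0 \<le> 2 * F t" for t unfolding F_def
      using that(1) energy_form_nonneg[OF norm_b_le, of t "p t" "q t"] by simp
    then show ?thesis using has_integral_nonneg[OF int[OF that(2,3)]] by simp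
  qed
  show "(cmod (q t))\<^sup>2 - (cmod (p t))\<^sup>2 = (cmod (q 0))\<^sup>2 - (cmod (p 0))\<^sup>2" if "Im z = 0" "0 \<le> t"
  proof -
    have "(\<lambda>t. 2 * F t) = (\<lambda>t. 0)" using that(1) by (simp add: F_def fun_eq_iff)
    then have "((\<lambda>t. 2 * F t) has_integral 0) {0..t}" by simp
    then show ?thesis using has_integral_unique[OF int[OF order_refl that(2)]] by fastforce
  qed
qed

end

lemma Re_cnj_mult_scale: "Re (cnj z * (of_real c * z)) = c * (cmod z)\<^sup>2"
  unfolding cmod_power2 by (simp add: power2_eq_square algebra_simps)

context canonical_coefficients
begin

lemma integral_a_nonneg: "0 \<le> integral {s..t} a"
  by (rule integral_nonneg) (use integrable_a a_nonneg in auto)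

text \<open>At \<open>z = \<i>\<close> the factor \<open>1 + \<i> z\<close> vanishes, so the
  equation for \<open>p\<close> decouples to \<open>p' = - a p\<close> and zero initial data
  persist; then \<open>q' = a q\<close>. This is the effect of the Arov gauge, by which
  \<open>- \<i> z A + B\<close> is triangular at that point.\<close>

lemma row_solution_zero_at_i:
  assumes sol: "row_solution \<i> p q" and init: "p 0 = 0" "q 0 = 1" and T: "0 \<le> T"
  shows "p T = 0" "cmod (q T) = exp (integral {0..T} a)"
proof -
  have p0: "p t = 0" if t: "0 \<le> t" for t
  proof -
    have "(cmod (p t))\<^sup>2 - (cmod (p 0))\<^sup>2 \<le> integral {0..t} (\<lambda>t. 0)"
    proof (rule abs_continuous_deriv_le[OF t])
      show "abs_continuous_on {0..t} (\<lambda>t. (cmod (p t))\<^sup>2)"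
        using sol by (intro abs_continuous_on_cmod_square row_solutionD) auto
      show "AE s in lebesgue. 0 < s \<and> s < t \<longrightarrow> (\<exists>d. ((\<lambda>t. (cmod (p t))\<^sup>2) has_vector_derivative d) (at s) \<and> d \<le> 0)"
        using row_solutionD(3)[OF sol]
      proof eventually_elim
        case (elim s)
        have "2 * Re (cnj (p s) * (- (a s * p s))) = - 2 * (a s * (cmod (p s))\<^sup>2)"
          using Re_cnj_mult_scale[of "p s" "a s"] by simp
        also have "\<dots> \<le> 0" using a_nonneg[of s] by simp
        finally show ?case using elim has_vector_derivative_cmod_square[of p "- (a s * p s)" s] by auto
      qed
    qed auto
    then show ?thesis using init by simp
  qed
  then show "p T = 0" using T by simp
  have q1: "1 \<le> (cmod (q t))\<^sup>2" if "0 \<le> t" for t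
    using energy_mono[OF sol _ order_refl that] init p0[OF that] by simp
  have "((\<lambda>t. 2 * a t) has_integral (ln ((cmod (q T))\<^sup>2) - ln ((cmod (q 0))\<^sup>2))) {0..T}"
  proof (rule abs_continuous_has_integral[OF T])
    show "abs_continuous_on {0..T} (\<lambda>t. ln ((cmod (q t))\<^sup>2))"
      using sol q1 by (intro abs_continuous_on_ln[of _ _ _ 1] abs_continuous_on_cmod_square row_solutionD) auto
    show "AE t in lebesgue. 0 < t \<and> t < T \<longrightarrow> ((\<lambda>t. ln ((cmod (q t))\<^sup>2)) has_vector_derivative 2 * a t) (at t)"
      using row_solutionD(3)[OF sol]
    proof eventually_elim
      case (elim t)
      show ?case
      proof (intro impI)
        assume t: "0 < t \<and> t < T"
        have q: "0 < (cmod (q t))\<^sup>2" using q1[of t] t by linarith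
        have "(q has_vector_derivative a t * q t) (at t)" using elim t p0[of t] by simp
        then have d: "((\<lambda>t. ln ((cmod (q t))\<^sup>2)) has_vector_derivative 2 * Re (cnj (q t) * (a t * q t)) / (cmod (q t))\<^sup>2) (at t)"
          using q by (intro has_vector_derivative_ln has_vector_derivative_cmod_square)
        have eq: "2 * Re (cnj (q t) * (a t * q t)) / (cmod (q t))\<^sup>2 = 2 * a t"
          unfolding Re_cnj_mult_scale using q by simp
        show "((\<lambda>t. ln ((cmod (q t))\<^sup>2)) has_vector_derivative 2 * a t) (at t)"
          using d unfolding eq .
      qed
    qed
  qed
  moreover have "((\<lambda>t. 2 * a t) has_integral 2 * integral {0..T} a) {0..T}"
    by (intro has_integral_mult_right integrable_integral integrable_a)
  ultimately have "ln ((cmod (q T))\<^sup>2) = 2 * integral {0..T} a"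
    using init by (auto dest: has_integral_unique)
  moreover have "0 < cmod (q T)" using q1[OF T] by (smt (verit) power2_eq_square mult_eq_0_iff norm_ge_zero)
  ultimately have "ln (cmod (q T)) = integral {0..T} a" by (simp add: ln_realpow)
  then show "cmod (q T) = exp (integral {0..T} a)" using \<open>0 < cmod (q T)\<close> by (metis exp_ln)
qed

section \<open>The attracting root of the Riccati equation and its moving averages\<close>

definition lam :: "real \<Rightarrow> real"
  where "lam t = sqrt ((a t)\<^sup>2 - (cmod (b t))\<^sup>2)"

text \<open>The root of smaller modulus of \<open>cnj b + 2 a s + b s\<^sup>2 = 0\<close>. For \<open>z = i y\<close> the quotient \<open>s = p / q\<close> solves a
  Riccati equation whose part of order \<open>y\<close> is this quadratic, so \<open>s\<close> is attracted to the root
  as \<open>y\<close> tends to infinity.\<close>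

definition sroot :: "real \<Rightarrow> complex"
  where "sroot t = - cnj (b t) / of_real (a t + lam t)"

lemma lam_square: "(lam t)\<^sup>2 = (a t)\<^sup>2 - (cmod (b t))\<^sup>2"
  using norm_b_le[of t] by (simp add: lam_def power_mono)

lemma lam_bounds: "0 \<le> lam t" "lam t \<le> a t"
  using norm_b_le[of t] a_nonneg[of t] by (auto simp: lam_def power_mono intro: real_le_lsqrt)

lemma measurable_lam [measurable]: "lam \<in> borel_measurable lebesgue"
  unfolding lam_def by measurable

lemma measurable_sroot [measurable]: "sroot \<in> borel_measurable lebesgue"
proof -
  have 1: "(\<lambda>t. - cnj (b t)) \<in> borel_measurable lebesgue"
    by (rule measurable_compose[OF measurable_b, of "\<lambda>z. - cnj z"]) (intro borel_measurable_continuous_onI continuous_intros)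
  have "(\<lambda>t. a t + lam t) \<in> borel_measurable lebesgue" by measurable
  then have 2: "(\<lambda>t. complex_of_real (a t + lam t)) \<in> borel_measurable lebesgue"
    by (rule measurable_compose[of _ _ borel complex_of_real]) (intro borel_measurable_continuous_onI continuous_intros)
  show ?thesis unfolding sroot_def by (rule borel_measurable_divide[OF 1 2])
qed

lemma cmod_sroot_le: "cmod (sroot t) \<le> 1"
proof -
  have "cmod (sroot t) = cmod (b t) / (a t + lam t)"
    using lam_bounds(1)[of t] a_nonneg[of t] by (simp add: sroot_def norm_divide del: of_real_add)
  also have "\<dots> \<le> 1" using norm_b_le[of t] lam_bounds(1)[of t] a_nonneg[of t]
    by (cases "a t + lam t = 0") (auto simp: divide_le_eq)
  finally show ?thesis .
qed

text \<open>Follows from \<open>|b|^2 = (a - lam) (a + lam)\<close>; when \<open>a + lam\<close> is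
  zero, so is \<open>b\<close>. This product is why \<open>lam\<close> is the growth rate: the
  leading part \<open>y (a + Re (b s))\<close> of the rate becomes \<open>y lam\<close> at the
  root.\<close>

lemma b_sroot: "b t * sroot t = of_real (lam t - a t)"
proof (cases "a t + lam t = 0")
  case True
  then have "a t = 0" "lam t = 0" using lam_bounds(1)[of t] a_nonneg[of t] by linarith+
  then show ?thesis using norm_b_le[of t] by simp
next
  case False
  have "b t * sroot t = - of_real ((cmod (b t))\<^sup>2) / of_real (a t + lam t)"
    unfolding complex_norm_square by (simp add: sroot_def)
  also have "(cmod (b t))\<^sup>2 = (a t - lam t) * (a t + lam t)"
    using lam_square[of t] by (simp add: algebra_simps power2_eq_square)
  finally show ?thesis using False by (simp del: of_real_add)
qed

lemma sroot_equation: "cnj (b t) + 2 * a t * sroot t + b t * (sroot t)\<^sup>2 = 0"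
proof -
  have "cnj (b t) + sroot t * of_real (a t + lam t) = 0"
  proof (cases "a t + lam t = 0")
    case True
    then have "a t = 0" using lam_bounds(1)[of t] a_nonneg[of t] by linarith
    then show ?thesis using norm_b_le[of t] True by simp
  qed (simp add: sroot_def del: of_real_add)
  moreover have "cnj (b t) + 2 * a t * sroot t + b t * (sroot t)\<^sup>2 = cnj (b t) + sroot t * (2 * a t + b t * sroot t)"
    by (simp add: algebra_simps power2_eq_square)
  ultimately show ?thesis by (simp add: b_sroot)
qed

lemma measurable_bounded_integrable:
  fixes f :: "real \<Rightarrow> 'b::euclidean_space"
  assumes f: "f \<in> borel_measurable (lebesgue_on {u..v})" and g: "g integrable_on {u..v}"
    and le: "\<And>t. t \<in> {u..v} \<Longrightarrow> norm (f t) \<le> g t"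
  shows "f integrable_on {u..v}"
  by (rule measurable_bounded_by_integrable_imp_integrable[OF f g le]) auto

lemma integrable_sroot: "sroot integrable_on {u..v}"
  by (rule measurable_bounded_integrable[of _ _ _ "\<lambda>_. 1"])
     (auto intro: measurable_restrict_space1 measurable_sroot cmod_sroot_le)

lemma integrable_lam: "lam integrable_on {u..v}"
  by (rule measurable_bounded_integrable[OF _ integrable_a])
     (use lam_bounds in \<open>auto intro: measurable_restrict_space1 measurable_lam\<close>)

text \<open>The moving average replaces the root, which is only measurable, by a Lipschitz function.\<close>

definition avg :: "real \<Rightarrow> real \<Rightarrow> complex"
  where "avg h t = integral {t..t + h} sroot / of_real h"

lemma avg_bound:
  assumes "0 < h" shows "cmod (avg h t) \<le> 1"
proof -
  have "cmod (integral {t..t + h} sroot) \<le> integral {t..t + h} (\<lambda>_. 1)"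
    by (rule integral_norm_bound_integral) (auto simp: integrable_sroot cmod_sroot_le)
  then show ?thesis using assms by (simp add: avg_def norm_divide divide_le_eq)
qed

text \<open>A single primitive serves all averages. Its base point \<open>-1\<close> lies strictly
  to the left of every \<open>t \<ge> 0\<close>, as the almost everywhere differentiation of
  primitives demands.\<close>

lemma avg_eq:
  assumes "0 < h" "0 \<le> t"
  shows "avg h t = (integral {-1..t + h} sroot - integral {-1..t} sroot) / of_real h"
proof -
  have "integral {-1..t} sroot + integral {t..t + h} sroot = integral {-1..t + h} sroot"
    by (rule Henstock_Kurzweil_Integration.integral_combine) (use assms integrable_sroot in auto)
  then show ?thesis by (simp add: avg_def algebra_simps)
qed

lemma avg_abs_continuous:
  assumes h: "0 < h" shows "abs_continuous_on {0..T} (avg h)"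
proof -
  define S where "S = (\<lambda>t. integral {-1..t} sroot)"
  have S: "cmod (S v - S u) \<le> \<bar>v - u\<bar>" if "0 \<le> u" "0 \<le> v" for u v
  proof -
    have *: "cmod (S v - S u) \<le> v - u" if "0 \<le> u" "u \<le> v" for u v
    proof -
      have "integral {-1..u} sroot + integral {u..v} sroot = integral {-1..v} sroot"
        by (rule Henstock_Kurzweil_Integration.integral_combine) (use that integrable_sroot in auto)
      then have "S v - S u = integral {u..v} sroot" by (simp add: S_def algebra_simps)
      moreover have "cmod (integral {u..v} sroot) \<le> integral {u..v} (\<lambda>_. 1)"
        by (rule integral_norm_bound_integral) (auto simp: integrable_sroot cmod_sroot_le)
      ultimately show ?thesis using that by simp
    qed
    show ?thesis using *[of u v] *[of v u] that by (cases "u \<le> v") (auto simp: norm_minus_commute)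
  qed
  show ?thesis
  proof (rule abs_continuous_on_lipschitz[of _ _ "2 / h"])
    fix x y assume xy: "x \<in> {0..T}" "y \<in> {0..T}"
    have "avg h x - avg h y = ((S (x + h) - S (y + h)) - (S x - S y)) / of_real h"
      using xy h by (simp add: avg_eq S_def diff_divide_distrib)
    then have "cmod (avg h x - avg h y) = cmod ((S (x + h) - S (y + h)) - (S x - S y)) / h"
      using h by (simp add: norm_divide)
    also have "cmod ((S (x + h) - S (y + h)) - (S x - S y)) \<le> 2 * \<bar>x - y\<bar>"
      using norm_triangle_ineq4[of "S (x + h) - S (y + h)" "S x - S y"] S[of "y + h" "x + h"] S[of y x] xy h by simp
    finally show "norm (avg h x - avg h y) \<le> 2 / h * \<bar>x - y\<bar>" using h by (simp add: divide_right_mono)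
  qed
qed

lemma AE_root_derivative:
  "AE t in lebesgue. ((\<lambda>t. integral {-1..t} sroot) has_vector_derivative sroot t) (at t) \<or> t \<le> -1"
  using AE_has_vector_derivative_integral[of sroot, OF integrable_sroot]
  by eventually_elim (auto simp: not_le)

lemma AE_lebesgue_shift:
  fixes h :: real
  assumes "AE t in lebesgue. P t"
  shows "AE t in lebesgue. P (t + h)"
proof -
  from assms obtain N where N: "N \<in> null_sets lebesgue" "{t. \<not> P t} \<subseteq> N"
    by (auto simp: eventually_ae_filter)
  have "negligible ((+) (- h) ` N)" using N(1) by (intro negligible_translation) (simp add: negligible_iff_null_sets)
  moreover have "{t. \<not> P (t + h)} \<subseteq> (+) (- h) ` N"
  proof
    fix t assume "t \<in> {t. \<not> P (t + h)}"
    then have "t + h \<in> N" using N(2) by auto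
    then show "t \<in> (+) (- h) ` N" by (intro image_eqI[of _ _ "t + h"]) auto
  qed
  ultimately show ?thesis by (auto simp: eventually_ae_filter negligible_iff_null_sets)
qed

text \<open>The bound deteriorates as \<open>h\<close> shrinks. This is harmless because it enters
  the growth estimate divided by \<open>y\<close>, and \<open>h\<close> is fixed before
  \<open>y\<close> tends to infinity.\<close>

lemma avg_derivative:
  assumes h: "0 < h"
  shows "AE t in lebesgue. 0 < t \<longrightarrow> (\<exists>d. (avg h has_vector_derivative d) (at t) \<and> cmod d \<le> 2 / h)"
  using AE_root_derivative AE_lebesgue_shift[OF AE_root_derivative, of h]
proof eventually_elim
  case (elim t)
  show ?case
  proof (intro impI)
    assume t: "0 < t"
    define S where "S = (\<lambda>t. integral {-1..t} sroot)"
    have d0: "(S has_vector_derivative sroot t) (at t)" and d1: "(S has_vector_derivative sroot (t + h)) (at (t + h))"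
      using elim t h unfolding S_def by auto
    have "((\<lambda>x. x + h) has_vector_derivative 1) (at t)"
      by (auto intro!: derivative_eq_intros)
    then have "((S \<circ> (\<lambda>x. x + h)) has_vector_derivative 1 *\<^sub>R sroot (t + h)) (at t)"
      using d1 by (rule vector_diff_chain_at)
    then have "((\<lambda>x. (1 / h) *\<^sub>R (S (x + h) - S x)) has_vector_derivative (1 / h) *\<^sub>R (sroot (t + h) - sroot t)) (at t)"
      by (intro bounded_linear.has_vector_derivative[OF bounded_linear_scaleR_right] has_vector_derivative_diff d0) (simp add: o_def)
    then have "(avg h has_vector_derivative (1 / h) *\<^sub>R (sroot (t + h) - sroot t)) (at t)"
      by (rule has_vector_derivative_transform_within_open[of _ _ _ "{0<..}"])
         (use t h in \<open>auto simp: avg_eq S_def scaleR_conv_of_real divide_inverse mult.commute\<close>)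
    moreover have "cmod ((1 / h) *\<^sub>R (sroot (t + h) - sroot t)) \<le> 2 / h"
      using norm_triangle_ineq4[of "sroot (t + h)" "sroot t"] cmod_sroot_le[of t] cmod_sroot_le[of "t + h"] h
      by (simp add: divide_right_mono)
    ultimately show "\<exists>d. (avg h has_vector_derivative d) (at t) \<and> cmod d \<le> 2 / h" by blast
  qed
qed

lemma avg_tendsto:
  "AE t in lebesgue. 0 \<le> t \<longrightarrow> (\<lambda>n. avg (1 / real (Suc n)) t) \<longlonglongrightarrow> sroot t"
  using AE_root_derivative
proof eventually_elim
  case (elim t)
  show ?case
  proof
    assume t: "0 \<le> t"
    define S where "S = (\<lambda>t. integral {-1..t} sroot)"
    have "(S has_vector_derivative sroot t) (at t)" using elim t by (simp add: S_def)
    then have lim: "((\<lambda>h. norm (S (t + h) - S t - h *\<^sub>R sroot t) / norm h) \<longlongrightarrow> 0) (at 0)"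
      by (simp add: has_vector_derivative_def has_derivative_at)
    have "((\<lambda>h. (S (t + h) - S t) /\<^sub>R h - sroot t) \<longlongrightarrow> 0) (at 0)"
    proof (rule tendsto_norm_zero_cancel, rule Lim_transform_eventually[OF lim])
      have "norm (v - h *\<^sub>R w) / norm h = norm (v /\<^sub>R h - w)" if "h \<noteq> 0" for h and v w :: complex
      proof -
        have "v /\<^sub>R h - w = (v - h *\<^sub>R w) /\<^sub>R h" using that by (simp add: scaleR_diff_right)
        then show ?thesis by (simp add: divide_inverse mult.commute)
      qed
      then show "\<forall>\<^sub>F h in at 0. norm (S (t + h) - S t - h *\<^sub>R sroot t) / norm h = norm ((S (t + h) - S t) /\<^sub>R h - sroot t)"
        by (auto simp: eventually_at_filter)
    qed
    then have "((\<lambda>h. (S (t + h) - S t) /\<^sub>R h) \<longlongrightarrow> sroot t) (at 0)"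
      by (simp add: LIM_zero_iff)
    moreover have "filterlim (\<lambda>n. 1 / real (Suc n)) (at 0) sequentially"
      using LIMSEQ_inverse_real_of_nat by (auto simp: filterlim_at divide_inverse)
    ultimately have "(\<lambda>n. (S (t + 1 / real (Suc n)) - S t) /\<^sub>R (1 / real (Suc n))) \<longlonglongrightarrow> sroot t"
      by (rule filterlim_compose)
    then show "(\<lambda>n. avg (1 / real (Suc n)) t) \<longlonglongrightarrow> sroot t"
      using t by (simp add: avg_eq S_def scaleR_conv_of_real divide_inverse mult.commute)
  qed
qed

lemma avg_measurable: "0 < h \<Longrightarrow> avg h \<in> borel_measurable (lebesgue_on {0..T})"
  by (intro continuous_imp_measurable_on_sets_lebesgue abs_continuous_on_imp_continuous_on avg_abs_continuous) auto

lemma integrable_avg_error: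
  assumes "0 < h" shows "(\<lambda>t. a t * cmod (avg h t - sroot t)) integrable_on {0..T}"
proof (rule measurable_bounded_integrable[of _ _ _ "\<lambda>t. a t * 2"])
  have [measurable]: "a \<in> borel_measurable (lebesgue_on {0..T})" "sroot \<in> borel_measurable (lebesgue_on {0..T})"
    by (auto intro: measurable_restrict_space1 measurable_sroot measurable_a)
  note [measurable] = avg_measurable[OF assms]
  show "(\<lambda>t. a t * cmod (avg h t - sroot t)) \<in> borel_measurable (lebesgue_on {0..T})" by measurable
  show "(\<lambda>t. a t * 2) integrable_on {0..T}" by (intro integrable_on_mult_left integrable_a)
  show "norm (a t * cmod (avg h t - sroot t)) \<le> a t * 2" for t
    using norm_triangle_ineq4[of "avg h t" "sroot t"] avg_bound[OF assms, of t] cmod_sroot_le[of t] a_nonneg[of t]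
    by (simp add: mult_left_mono)
qed

text \<open>Lebesgue differentiation gives pointwise convergence of the averages, and since averages
  and root have modulus at most 1, \<open>2 a\<close> dominates.\<close>

lemma avg_error_tendsto:
  "(\<lambda>n. integral {0..T} (\<lambda>t. a t * cmod (avg (1 / real (Suc n)) t - sroot t))) \<longlonglongrightarrow> 0"
proof -
  define f where "f = (\<lambda>n t. a t * cmod (avg (1 / real (Suc n)) t - sroot t))"
  obtain N where N: "N \<in> null_sets lebesgue" "{t. \<not> (0 \<le> t \<longrightarrow> (\<lambda>n. avg (1 / real (Suc n)) t) \<longlonglongrightarrow> sroot t)} \<subseteq> N"
    using avg_tendsto by (auto simp: eventually_ae_filter)
  have neg: "negligible N" using N(1) by (simp add: negligible_iff_null_sets)
  define g where "g = (\<lambda>n t. if t \<in> N then 0 else f n t)"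
  have "(\<lambda>n. integral {0..T} (g n)) \<longlonglongrightarrow> integral {0..T} (\<lambda>t. 0)"
  proof (rule dominated_convergence(2)[where h = "\<lambda>t. a t * 2"])
    show "g n integrable_on {0..T}" for n
      by (rule integrable_spike[OF integrable_avg_error[of "1 / real (Suc n)"] neg]) (auto simp: g_def f_def)
    show "(\<lambda>t. a t * 2) integrable_on {0..T}" by (intro integrable_on_mult_left integrable_a)
    show "norm (g n t) \<le> a t * 2" for n t
      using norm_triangle_ineq4[of "avg (1 / real (Suc n)) t" "sroot t"] avg_bound[of "1 / real (Suc n)" t] cmod_sroot_le[of t] a_nonneg[of t]
      by (simp add: mult_left_mono g_def f_def)
    show "(\<lambda>n. g n t) \<longlonglongrightarrow> 0" if t: "t \<in> {0..T}" for t
    proof (cases "t \<in> N")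
      case False
      then have "(\<lambda>n. avg (1 / real (Suc n)) t) \<longlonglongrightarrow> sroot t" using N(2) t by auto
      then have "(\<lambda>n. a t * cmod (avg (1 / real (Suc n)) t - sroot t)) \<longlonglongrightarrow> a t * cmod (sroot t - sroot t)"
        by (intro tendsto_intros)
      then show ?thesis using False by (simp add: g_def f_def)
    qed (simp add: g_def)
  qed
  moreover have "integral {0..T} (g n) = integral {0..T} (f n)" for n
    by (rule integral_spike[OF neg]) (auto simp: g_def)
  ultimately show ?thesis by (simp add: f_def)
qed

end

section \<open>Holomorphic dependence on the spectral parameter\<close>

text \<open>A Lipschitz function on the punctured disc extends continuously to its centre, so the
  difference quotients converge. The derivative is obtained without being identified, so no
  variational equation has to be solved.\<close>

lemma field_differentiable_lipschitz_quotient: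
  fixes f :: "complex \<Rightarrow> complex"
  assumes L: "0 \<le> L" and lip: "\<And>h k. \<lbrakk>h \<noteq> 0; cmod h < 1; k \<noteq> 0; cmod k < 1\<rbrakk> \<Longrightarrow>
     cmod ((f (z + h) - f z) / h - (f (z + k) - f z) / k) \<le> L * cmod (h - k)"
  shows "f field_differentiable at z"
proof -
  define U where "U = {h::complex. h \<noteq> 0 \<and> cmod h < 1}"
  define d where "d = (\<lambda>h. (f (z + h) - f z) / h)"
  have "L-lipschitz_on U d"
    by (rule lipschitz_onI) (use lip L in \<open>auto simp: d_def U_def dist_norm\<close>)
  then obtain g where g: "L-lipschitz_on (closure U) g" "\<forall>x\<in>U. g x = d x"
    using lipschitz_extend_closure by blast
  have U: "U = ball 0 1 - {0}" by (auto simp: U_def)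
  have "0 islimpt U"
    unfolding islimpt_approachable
  proof (intro allI impI)
    fix e :: real assume "e > 0"
    then show "\<exists>x'\<in>U. x' \<noteq> 0 \<and> dist x' 0 < e"
      by (intro bexI[of _ "of_real (min (1 / 2) (e / 2))"]) (auto simp: U min_def)
  qed
  then have "0 \<in> closure U" by (simp add: closure_def)
  then have "(g \<longlongrightarrow> g 0) (at 0 within closure U)"
    using lipschitz_on_continuous_on[OF g(1)] by (simp add: continuous_on_def)
  then have "(g \<longlongrightarrow> g 0) (at 0 within U)" by (rule tendsto_within_subset) (rule closure_subset)
  moreover have at: "at 0 within U = at (0::complex)"
    by (rule at_within_nhd[of _ "ball 0 1"]) (auto simp: U)
  moreover have "\<forall>\<^sub>F h in at 0. g h = d h"
    unfolding at[symmetric] using g(2) by (auto simp: eventually_at_filter)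
  ultimately have "(d \<longlongrightarrow> g 0) (at 0)" by (auto intro: Lim_transform_eventually)
  then have "(f has_field_derivative g 0) (at z)" unfolding d_def by (simp add: DERIV_def)
  then show ?thesis by (auto simp: field_differentiable_def)
qed

context canonical_coefficients
begin

lemma integral_a_mono:
  assumes "t \<le> T" shows "integral {0..t} a \<le> integral {0..T} a"
  by (rule integral_subset_le) (use assms integrable_a a_nonneg in auto)

lemma coefficient_bound:
  assumes "cmod z \<le> R"
  shows "cmod (\<i> * z * a t * p + (1 + \<i> * z) * cnj (b t) * q) \<le> (1 + R) * a t * (cmod p + cmod q)"
    "cmod ((1 - \<i> * z) * b t * p - \<i> * z * a t * q) \<le> (1 + R) * a t * (cmod p + cmod q)"
proof -
  have R: "0 \<le> R" using assms norm_ge_zero order_trans by blast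
  have z: "cmod (1 + \<i> * z) \<le> 1 + R" "cmod (1 - \<i> * z) \<le> 1 + R"
    using norm_triangle_ineq[of 1 "\<i> * z"] norm_triangle_ineq4[of 1 "\<i> * z"] assms by (auto simp: norm_mult)
  have A: "cmod (\<i> * z * a t * w) \<le> (1 + R) * a t * cmod w" for w
  proof -
    have "cmod (\<i> * z * a t * w) = cmod z * (a t * cmod w)" using a_nonneg[of t] by (simp add: norm_mult)
    also have "\<dots> \<le> (1 + R) * (a t * cmod w)" using assms a_nonneg[of t] by (intro mult_right_mono) auto
    finally show ?thesis by (simp add: mult.assoc)
  qed
  have B: "cmod c * cmod (b t) * cmod w \<le> (1 + R) * a t * cmod w" if "cmod c \<le> 1 + R" for c w :: complex
    using that norm_b_le[of t] a_nonneg[of t] R by (intro mult_right_mono mult_mono) auto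
  show "cmod (\<i> * z * a t * p + (1 + \<i> * z) * cnj (b t) * q) \<le> (1 + R) * a t * (cmod p + cmod q)"
    using norm_triangle_ineq[of "\<i> * z * a t * p" "(1 + \<i> * z) * cnj (b t) * q"] A[of p] B[OF z(1), of q]
    by (simp add: norm_mult distrib_left)
  show "cmod ((1 - \<i> * z) * b t * p - \<i> * z * a t * q) \<le> (1 + R) * a t * (cmod p + cmod q)"
    using norm_triangle_ineq4[of "(1 - \<i> * z) * b t * p" "\<i> * z * a t * q"] A[of q] B[OF z(2), of p]
    by (simp add: norm_mult distrib_left)
qed

lemma row_solution_bound:
  assumes sol: "row_solution z p q" and T: "0 \<le> T" and z: "cmod z \<le> R"
  shows "(cmod (p T))\<^sup>2 + (cmod (q T))\<^sup>2 \<le> ((cmod (p 0))\<^sup>2 + (cmod (q 0))\<^sup>2 + 1) * exp (6 * ((1 + R) * integral {0..T} a))"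
proof -
  have R: "0 \<le> R" using z norm_ge_zero order_trans by blast
  have "(cmod (p T))\<^sup>2 + (cmod (q T))\<^sup>2 \<le> ((cmod (p 0))\<^sup>2 + (cmod (q 0))\<^sup>2 + 1\<^sup>2) * exp (6 * integral {0..T} (\<lambda>t. (1 + R) * a t))"
  proof (rule gronwall_pair[OF T])
    show "abs_continuous_on {0..T} p" "abs_continuous_on {0..T} q" using sol by (auto intro: row_solutionD)
    show "(\<lambda>t. (1 + R) * a t) integrable_on {0..T}" by (intro integrable_on_mult_right integrable_a)
    show "0 \<le> (1 + R) * a t" for t using R a_nonneg[of t] by simp
    show "AE t in lebesgue. 0 < t \<and> t < T \<longrightarrow> (\<exists>P' Q'. (p has_vector_derivative P') (at t) \<and>
      (q has_vector_derivative Q') (at t) \<and> cmod P' \<le> (1 + R) * a t * (cmod (p t) + cmod (q t) + 1) \<and>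
      cmod Q' \<le> (1 + R) * a t * (cmod (p t) + cmod (q t) + 1))"
      using row_solutionD(3)[OF sol]
    proof eventually_elim
      case (elim t)
      have "(1 + R) * a t * (cmod (p t) + cmod (q t)) \<le> (1 + R) * a t * (cmod (p t) + cmod (q t) + 1)"
        using R a_nonneg[of t] by (intro mult_left_mono) auto
      then show ?case using elim coefficient_bound[OF z, of t "p t" "q t"]
        by (blast intro: order_trans)
    qed
  qed simp
  then show ?thesis by simp
qed

end

text \<open>Initial values independent of \<open>z\<close> make all differences in the spectral
  parameter start from zero, so the Gronwall bound for them contains only the forcing. Both rows of
  the matrix solution are instances.\<close>

locale parametrized_solution = canonical_coefficients +
  fixes p q :: "complex \<Rightarrow> real \<Rightarrow> complex" and p0 q0 :: complex
  assumes solution: "\<And>z. row_solution z (p z) (q z)"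
    and initial: "\<And>z. p z 0 = p0" "\<And>z. q z 0 = q0"
begin

lemma parameter_bounded:
  obtains C where "0 < C" "\<And>z t. \<lbrakk>cmod z \<le> R; t \<in> {0..T}\<rbrakk> \<Longrightarrow> cmod (p z t) + cmod (q z t) \<le> C"
proof -
  define M where "M = ((cmod p0)\<^sup>2 + (cmod q0)\<^sup>2 + 1) * exp (6 * ((1 + \<bar>R\<bar>) * integral {0..T} a))"
  show thesis
  proof (rule that[of "2 * sqrt M + 1"])
    have M: "0 \<le> M" by (simp add: M_def)
    then show "0 < 2 * sqrt M + 1" by (simp add: add_nonneg_pos)
    fix z t assume z: "cmod z \<le> R" and t: "t \<in> {0..T}"
    have "(cmod (p z t))\<^sup>2 + (cmod (q z t))\<^sup>2 \<le> ((cmod p0)\<^sup>2 + (cmod q0)\<^sup>2 + 1) * exp (6 * ((1 + \<bar>R\<bar>) * integral {0..t} a))"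
      using row_solution_bound[OF solution, of t z "\<bar>R\<bar>"] z t by (simp add: initial)
    also have "\<dots> \<le> M" unfolding M_def
      using integral_a_mono[of t T] t by (intro mult_left_mono) (auto intro!: mult_left_mono)
    finally have le: "(cmod (p z t))\<^sup>2 + (cmod (q z t))\<^sup>2 \<le> M" .
    have "(cmod (p z t))\<^sup>2 \<le> M" "(cmod (q z t))\<^sup>2 \<le> M"
      using le zero_le_power2[of "cmod (p z t)"] zero_le_power2[of "cmod (q z t)"] by linarith+
    then have "cmod (p z t) \<le> sqrt M" "cmod (q z t) \<le> sqrt M" by (auto intro: real_le_rsqrt)
    then show "cmod (p z t) + cmod (q z t) \<le> 2 * sqrt M + 1" by simp
  qed
qed

text \<open>The difference of the solutions for \<open>z\<close> and \<open>w\<close> solves the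
  system for \<open>z\<close> with a forcing term of size at most \<open>|z - w| * a * C1\<close>,
  where \<open>C1\<close> bounds the solution for \<open>w\<close>. This dictates the choice of
  \<open>e\<close>.\<close>

lemma parameter_lipschitz:
  obtains C where "0 < C" "\<And>z w t. \<lbrakk>cmod z \<le> R; cmod w \<le> R; t \<in> {0..T}\<rbrakk> \<Longrightarrow>
    cmod (p z t - p w t) \<le> C * cmod (z - w) \<and> cmod (q z t - q w t) \<le> C * cmod (z - w)"
proof -
  obtain C1 where C1: "0 < C1" "\<And>z t. \<lbrakk>cmod z \<le> R; t \<in> {0..T}\<rbrakk> \<Longrightarrow> cmod (p z t) + cmod (q z t) \<le> C1"
    using parameter_bounded by blast
  define E where "E = sqrt (exp (6 * ((1 + \<bar>R\<bar>) * integral {0..T} a)))"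
  show thesis
  proof (rule that[of "C1 * E"])
    show "0 < C1 * E" using C1 by (simp add: E_def)
    fix z w t assume z: "cmod z \<le> R" and w: "cmod w \<le> R" and t: "t \<in> {0..T}"
    show "cmod (p z t - p w t) \<le> C1 * E * cmod (z - w) \<and> cmod (q z t - q w t) \<le> C1 * E * cmod (z - w)"
    proof (cases "z = w")
      case False
      have R: "0 \<le> R" using z norm_ge_zero order_trans by blast
      define e where "e = cmod (z - w) * C1"
      have e: "0 < e" using False C1 by (simp add: e_def)
      define P where "P = (\<lambda>t. p z t - p w t)"
      define Q where "Q = (\<lambda>t. q z t - q w t)"
      have "(cmod (P t))\<^sup>2 + (cmod (Q t))\<^sup>2 \<le> ((cmod (P 0))\<^sup>2 + (cmod (Q 0))\<^sup>2 + e\<^sup>2) * exp (6 * integral {0..t} (\<lambda>t. (1 + R) * a t))"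
      proof (rule gronwall_pair)
        show "0 \<le> t" using t by simp
        show "abs_continuous_on {0..t} P" "abs_continuous_on {0..t} Q" unfolding P_def Q_def
          by (intro abs_continuous_on_diff row_solutionD[OF solution] order_refl)+
        show "0 < e" by fact
        show "(\<lambda>t. (1 + R) * a t) integrable_on {0..t}" by (intro integrable_on_mult_right integrable_a)
        show "0 \<le> (1 + R) * a t" for t using R a_nonneg[of t] by simp
        show "AE s in lebesgue. 0 < s \<and> s < t \<longrightarrow> (\<exists>P' Q'. (P has_vector_derivative P') (at s) \<and>
           (Q has_vector_derivative Q') (at s) \<and> cmod P' \<le> (1 + R) * a s * (cmod (P s) + cmod (Q s) + e) \<and>
           cmod Q' \<le> (1 + R) * a s * (cmod (P s) + cmod (Q s) + e))"
          using row_solutionD(3)[OF solution[of z]] row_solutionD(3)[OF solution[of w]]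
        proof eventually_elim
          case (elim s)
          show ?case
          proof (intro impI)
            assume s: "0 < s \<and> s < t"
            define N1 where "N1 = \<i> * z * a s * P s + (1 + \<i> * z) * cnj (b s) * Q s"
            define N2 where "N2 = (1 - \<i> * z) * b s * P s - \<i> * z * a s * Q s"
            define F1 where "F1 = (z - w) * (\<i> * (a s * p w s + cnj (b s) * q w s))"
            define F2 where "F2 = (z - w) * (- \<i> * (b s * p w s + a s * q w s))"
            have d1: "(P has_vector_derivative N1 + F1) (at s)" unfolding P_def
              by (rule has_vector_derivative_eq_rhs[OF has_vector_derivative_diff])
                 (use elim s in \<open>auto simp: N1_def F1_def P_def Q_def algebra_simps\<close>)
            have d2: "(Q has_vector_derivative N2 + F2) (at s)" unfolding Q_def
              by (rule has_vector_derivative_eq_rhs[OF has_vector_derivative_diff])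
                 (use elim s in \<open>auto simp: N2_def F2_def P_def Q_def algebra_simps\<close>)
            have lin: "cmod (a s * x + c * y) \<le> a s * (cmod x + cmod y)" "cmod (c * x + a s * y) \<le> a s * (cmod x + cmod y)"
              if "cmod c \<le> a s" for c x y :: complex
              using norm_triangle_ineq[of "a s * x" "c * y"] norm_triangle_ineq[of "c * x" "a s * y"]
                mult_right_mono[OF that, of "cmod x"] mult_right_mono[OF that, of "cmod y"] a_nonneg[of s]
              by (auto simp: norm_mult distrib_left)
            have X: "a s * (cmod (p w s) + cmod (q w s)) \<le> a s * C1"
              using C1(2)[OF w, of s] s t a_nonneg[of s] by (intro mult_left_mono) auto
            have F: "cmod F1 \<le> (1 + R) * a s * e" "cmod F2 \<le> (1 + R) * a s * e"
            proof -
              have "cmod (a s * p w s + cnj (b s) * q w s) \<le> a s * C1" "cmod (b s * p w s + a s * q w s) \<le> a s * C1"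
                using lin(1)[of "cnj (b s)" "p w s" "q w s"] lin(2)[of "b s" "p w s" "q w s"] X norm_b_le[of s] by auto
              then have "cmod F1 \<le> cmod (z - w) * (a s * C1)" "cmod F2 \<le> cmod (z - w) * (a s * C1)"
                by (auto simp: F1_def F2_def norm_mult intro!: mult_left_mono)
              moreover have "cmod (z - w) * (a s * C1) \<le> (1 + R) * a s * e"
              proof -
                have "cmod (z - w) * (a s * C1) = 1 * (a s * e)" by (simp add: e_def mult_ac)
                also have "\<dots> \<le> (1 + R) * (a s * e)" using R a_nonneg[of s] e by (intro mult_right_mono) auto
                finally show ?thesis by (simp only: mult.assoc)
              qed
              ultimately show "cmod F1 \<le> (1 + R) * a s * e" "cmod F2 \<le> (1 + R) * a s * e" by linarith+
            qed
            have "cmod (N1 + F1) \<le> (1 + R) * a s * (cmod (P s) + cmod (Q s) + e)"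
              using norm_triangle_ineq[of N1 F1] F(1) coefficient_bound(1)[OF z, of s "P s" "Q s"]
              by (simp add: N1_def distrib_left)
            moreover have "cmod (N2 + F2) \<le> (1 + R) * a s * (cmod (P s) + cmod (Q s) + e)"
              using norm_triangle_ineq[of N2 F2] F(2) coefficient_bound(2)[OF z, of s "P s" "Q s"]
              by (simp add: N2_def distrib_left)
            ultimately show "\<exists>P' Q'. (P has_vector_derivative P') (at s) \<and>
               (Q has_vector_derivative Q') (at s) \<and> cmod P' \<le> (1 + R) * a s * (cmod (P s) + cmod (Q s) + e) \<and>
               cmod Q' \<le> (1 + R) * a s * (cmod (P s) + cmod (Q s) + e)" using d1 d2 by blast
          qed
        qed
      qed
      also have "\<dots> = e\<^sup>2 * exp (6 * ((1 + R) * integral {0..t} a))" by (simp add: P_def Q_def initial)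
      also have "\<dots> \<le> e\<^sup>2 * exp (6 * ((1 + \<bar>R\<bar>) * integral {0..T} a))"
        using integral_a_mono[of t T] t R by (intro mult_left_mono) (auto intro!: mult_mono integral_a_nonneg)
      also have "\<dots> = (e * E)\<^sup>2" by (simp add: E_def power_mult_distrib)
      finally have le: "(cmod (P t))\<^sup>2 + (cmod (Q t))\<^sup>2 \<le> (e * E)\<^sup>2" .
      have eE: "0 \<le> e * E" using e by (simp add: E_def)
      have "(cmod (P t))\<^sup>2 \<le> (e * E)\<^sup>2" "(cmod (Q t))\<^sup>2 \<le> (e * E)\<^sup>2"
        using le zero_le_power2[of "cmod (P t)"] zero_le_power2[of "cmod (Q t)"] by linarith+
      then have "cmod (P t) \<le> e * E" "cmod (Q t) \<le> e * E" using eE by (auto intro: power2_le_imp_le)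
      then show ?thesis by (simp add: P_def Q_def e_def mult_ac)
    qed simp
  qed
qed

text \<open>The quotient \<open>(p (z + h) - p z) / h\<close> solves the system for \<open>z\<close>
  with the forcing \<open>\<i> (a p + cnj b q)\<close> taken at the parameter \<open>z + h\<close>,
  and similarly for \<open>q\<close>. Subtracting the quotients for \<open>h\<close> and
  \<open>k\<close> leaves differences of solutions as forcing, which
  \<open>parameter_lipschitz\<close> bounds by a multiple of \<open>|h - k|\<close>; the factor 2 in
  \<open>e\<close> counts the two components.\<close>

lemma difference_quotient_lipschitz:
  assumes T: "0 \<le> T"
  obtains L where "0 \<le> L" "\<And>h k. \<lbrakk>h \<noteq> 0; cmod h < 1; k \<noteq> 0; cmod k < 1\<rbrakk> \<Longrightarrow>
     cmod ((p (z + h) T - p z T) / h - (p (z + k) T - p z T) / k) \<le> L * cmod (h - k) \<and>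
     cmod ((q (z + h) T - q z T) / h - (q (z + k) T - q z T) / k) \<le> L * cmod (h - k)"
proof -
  define R where "R = cmod z + 1"
  have R: "0 \<le> R" by (simp add: R_def)
  obtain C where C: "0 < C" "\<And>z w t. \<lbrakk>cmod z \<le> R; cmod w \<le> R; t \<in> {0..T}\<rbrakk> \<Longrightarrow>
      cmod (p z t - p w t) \<le> C * cmod (z - w) \<and> cmod (q z t - q w t) \<le> C * cmod (z - w)"
    using parameter_lipschitz by blast
  define E where "E = sqrt (exp (6 * ((1 + R) * integral {0..T} a)))"
  show thesis
  proof (rule that[of "2 * C * E"])
    show "0 \<le> 2 * C * E" using C(1) by (simp add: E_def)
    fix h k assume h: "h \<noteq> 0" "cmod h < 1" and k: "k \<noteq> 0" "cmod k < 1"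
    show "cmod ((p (z + h) T - p z T) / h - (p (z + k) T - p z T) / k) \<le> 2 * C * E * cmod (h - k) \<and>
       cmod ((q (z + h) T - q z T) / h - (q (z + k) T - q z T) / k) \<le> 2 * C * E * cmod (h - k)"
    proof (cases "h = k")
      case False
      define e where "e = 2 * C * cmod (h - k)"
      have e: "0 < e" using False C by (simp add: e_def)
      have zR: "cmod z \<le> R" "cmod (z + h) \<le> R" "cmod (z + k) \<le> R"
        using norm_triangle_ineq[of z h] norm_triangle_ineq[of z k] h k by (auto simp: R_def)
      define P where "P = (\<lambda>t. inverse h * (p (z + h) t - p z t) - inverse k * (p (z + k) t - p z t))"
      define Q where "Q = (\<lambda>t. inverse h * (q (z + h) t - q z t) - inverse k * (q (z + k) t - q z t))"
      have m: "bounded_linear (\<lambda>x. c * x)" for c :: complex by (rule bounded_linear_mult_right)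
      have "(cmod (P T))\<^sup>2 + (cmod (Q T))\<^sup>2 \<le> ((cmod (P 0))\<^sup>2 + (cmod (Q 0))\<^sup>2 + e\<^sup>2) * exp (6 * integral {0..T} (\<lambda>t. (1 + R) * a t))"
      proof (rule gronwall_pair[OF T])
        show "abs_continuous_on {0..T} P" "abs_continuous_on {0..T} Q" unfolding P_def Q_def
          by (intro abs_continuous_on_diff abs_continuous_on_bounded_linear[OF m] row_solutionD[OF solution] order_refl)+
        show "0 < e" by fact
        show "(\<lambda>t. (1 + R) * a t) integrable_on {0..T}" by (intro integrable_on_mult_right integrable_a)
        show "0 \<le> (1 + R) * a t" for t using R a_nonneg[of t] by simp
        show "AE s in lebesgue. 0 < s \<and> s < T \<longrightarrow> (\<exists>P' Q'. (P has_vector_derivative P') (at s) \<and>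
           (Q has_vector_derivative Q') (at s) \<and> cmod P' \<le> (1 + R) * a s * (cmod (P s) + cmod (Q s) + e) \<and>
           cmod Q' \<le> (1 + R) * a s * (cmod (P s) + cmod (Q s) + e))"
          using row_solutionD(3)[OF solution[of z]] row_solutionD(3)[OF solution[of "z + h"]] row_solutionD(3)[OF solution[of "z + k"]]
        proof eventually_elim
          case (elim s)
          show ?case
          proof (intro impI)
            assume s: "0 < s \<and> s < T"
            define x where "x = p (z + h) s - p (z + k) s"
            define y where "y = q (z + h) s - q (z + k) s"
            define N1 where "N1 = \<i> * z * a s * P s + (1 + \<i> * z) * cnj (b s) * Q s"
            define N2 where "N2 = (1 - \<i> * z) * b s * P s - \<i> * z * a s * Q s"
            define F1 where "F1 = \<i> * (a s * x + cnj (b s) * y)"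
            define F2 where "F2 = - \<i> * (b s * x + a s * y)"
            have d1: "(P has_vector_derivative N1 + F1) (at s)" unfolding P_def
              by (rule has_vector_derivative_eq_rhs[OF has_vector_derivative_diff[OF
                    bounded_linear.has_vector_derivative[OF m has_vector_derivative_diff]
                    bounded_linear.has_vector_derivative[OF m has_vector_derivative_diff]]])
                 (use elim s h k in \<open>auto simp: N1_def F1_def P_def Q_def x_def y_def field_simps\<close>)
            have d2: "(Q has_vector_derivative N2 + F2) (at s)" unfolding Q_def
              by (rule has_vector_derivative_eq_rhs[OF has_vector_derivative_diff[OF
                    bounded_linear.has_vector_derivative[OF m has_vector_derivative_diff]
                    bounded_linear.has_vector_derivative[OF m has_vector_derivative_diff]]])
                 (use elim s h k in \<open>auto simp: N2_def F2_def P_def Q_def x_def y_def field_simps\<close>)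
            have lin: "cmod (a s * x + c * y) \<le> a s * (cmod x + cmod y)" "cmod (c * x + a s * y) \<le> a s * (cmod x + cmod y)"
              if "cmod c \<le> a s" for c x y :: complex
              using norm_triangle_ineq[of "a s * x" "c * y"] norm_triangle_ineq[of "c * x" "a s * y"]
                mult_right_mono[OF that, of "cmod x"] mult_right_mono[OF that, of "cmod y"] a_nonneg[of s]
              by (auto simp: norm_mult distrib_left)
            have "cmod x + cmod y \<le> e"
              using C(2)[OF zR(2,3), of s] s by (auto simp: x_def y_def e_def)
            then have X: "a s * (cmod x + cmod y) \<le> a s * e" using a_nonneg[of s] by (rule mult_left_mono)
            have "0 \<le> R * a s * e" using R a_nonneg[of s] e by simp
            then have F: "cmod F1 \<le> (1 + R) * a s * e" "cmod F2 \<le> (1 + R) * a s * e"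
              using lin(1)[of "cnj (b s)" x y] lin(2)[of "b s" x y] X norm_b_le[of s]
              by (auto simp: F1_def F2_def norm_mult distrib_right)
            have "cmod (N1 + F1) \<le> (1 + R) * a s * (cmod (P s) + cmod (Q s) + e)"
              using norm_triangle_ineq[of N1 F1] F(1) coefficient_bound(1)[OF zR(1), of s "P s" "Q s"]
              by (simp add: N1_def distrib_left)
            moreover have "cmod (N2 + F2) \<le> (1 + R) * a s * (cmod (P s) + cmod (Q s) + e)"
              using norm_triangle_ineq[of N2 F2] F(2) coefficient_bound(2)[OF zR(1), of s "P s" "Q s"]
              by (simp add: N2_def distrib_left)
            ultimately show "\<exists>P' Q'. (P has_vector_derivative P') (at s) \<and>
               (Q has_vector_derivative Q') (at s) \<and> cmod P' \<le> (1 + R) * a s * (cmod (P s) + cmod (Q s) + e) \<and>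
               cmod Q' \<le> (1 + R) * a s * (cmod (P s) + cmod (Q s) + e)" using d1 d2 by blast
          qed
        qed
      qed
      also have "\<dots> = e\<^sup>2 * exp (6 * ((1 + R) * integral {0..T} a))" by (simp add: P_def Q_def initial)
      also have "\<dots> = (e * E)\<^sup>2" by (simp add: E_def power_mult_distrib)
      finally have le: "(cmod (P T))\<^sup>2 + (cmod (Q T))\<^sup>2 \<le> (e * E)\<^sup>2" .
      have eE: "0 \<le> e * E" using e by (simp add: E_def)
      have "(cmod (P T))\<^sup>2 \<le> (e * E)\<^sup>2" "(cmod (Q T))\<^sup>2 \<le> (e * E)\<^sup>2"
        using le zero_le_power2[of "cmod (P T)"] zero_le_power2[of "cmod (Q T)"] by linarith+
      then have "cmod (P T) \<le> e * E" "cmod (Q T) \<le> e * E" using eE by (auto intro: power2_le_imp_le)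
      then show ?thesis by (simp add: P_def Q_def e_def mult_ac divide_inverse)
    qed simp
  qed
qed

lemma holomorphic_in_parameter:
  assumes T: "0 \<le> T"
  shows "(\<lambda>z. p z T) holomorphic_on S" "(\<lambda>z. q z T) holomorphic_on S"
proof -
  have "(\<lambda>z. p z T) field_differentiable at z \<and> (\<lambda>z. q z T) field_differentiable at z" for z
  proof -
    obtain L where "0 \<le> L" "\<And>h k. \<lbrakk>h \<noteq> 0; cmod h < 1; k \<noteq> 0; cmod k < 1\<rbrakk> \<Longrightarrow>
     cmod ((p (z + h) T - p z T) / h - (p (z + k) T - p z T) / k) \<le> L * cmod (h - k) \<and>
     cmod ((q (z + h) T - q z T) / h - (q (z + k) T - q z T) / k) \<le> L * cmod (h - k)"
      using difference_quotient_lipschitz[OF T] by blast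
    then show ?thesis by (intro conjI field_differentiable_lipschitz_quotient[of L]) auto
  qed
  then show "(\<lambda>z. p z T) holomorphic_on S" "(\<lambda>z. q z T) holomorphic_on S"
    by (auto simp: holomorphic_on_def intro: field_differentiable_at_within)
qed

end

section \<open>Growth along the imaginary axis\<close>

lemma Re_complex_of_real_mult: "Re (of_real c * z) = c * Re z"
  by simp

context canonical_coefficients
begin

text \<open>Here \<open>\<rho>\<close> is the exact root and \<open>\<sigma>\<close> a
  differentiable substitute for it. The squared distance of \<open>s\<close> from
  \<open>\<sigma>\<close> is dissipated at a rate proportional to \<open>y\<close>; replacing
  \<open>\<sigma>\<close> by \<open>\<rho>\<close> costs multiples of
  \<open>\<alpha> * |\<sigma> - \<rho>|\<close>, and the terms of the equation without
  \<open>y\<close> contribute \<open>8 \<alpha> + 4 L\<close>.\<close>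

lemma riccati_dissipation:
  fixes s \<sigma> \<sigma>' \<beta> \<rho> :: complex and \<alpha> y L :: real
  assumes \<beta>: "cmod \<beta> \<le> \<alpha>" and s: "cmod s \<le> 1" and \<sigma>: "cmod \<sigma> \<le> 1" and \<rho>: "cmod \<rho> \<le> 1"
    and root: "cnj \<beta> + 2 * \<alpha> * \<rho> + \<beta> * \<rho>\<^sup>2 = 0" and L: "cmod \<sigma>' \<le> L" and y: "0 \<le> y"
    and s': "s' = - y * (cnj \<beta> + 2 * \<alpha> * s + \<beta> * s\<^sup>2) + (cnj \<beta> - \<beta> * s\<^sup>2)"
  shows "2 * Re (cnj (s - \<sigma>) * (s' - \<sigma>')) \<le>
    - 2 * y * (Re (2 * \<alpha> + \<beta> * (s + \<rho>)) * (cmod (s - \<rho>))\<^sup>2) + 56 * y * (\<alpha> * cmod (\<sigma> - \<rho>)) + 8 * \<alpha> + 4 * L"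
proof -
  have \<alpha>: "0 \<le> \<alpha>" using \<beta> norm_ge_zero order_trans by blast
  define \<eta> where "\<eta> = cmod (\<sigma> - \<rho>)"
  have \<eta>: "0 \<le> \<eta>" by (simp add: \<eta>_def)
  define \<delta> where "\<delta> = s - \<sigma>"
  have \<delta>2: "cmod \<delta> \<le> 2" using norm_triangle_ineq4[of s \<sigma>] s \<sigma> by (simp add: \<delta>_def)
  have sr2: "cmod (s - \<rho>) \<le> 2" using norm_triangle_ineq4[of s \<rho>] s \<rho> by simp
  \<comment> \<open>The quadratic vanishes at \<open>\<rho>\<close>; \<open>e\<close> is its value
    at \<open>\<sigma>\<close>, and \<open>A * \<delta>\<close> is its increment from
    \<open>\<sigma>\<close> to \<open>s\<close>.\<close>
  define e where "e = (2 * \<alpha> + \<beta> * (\<sigma> + \<rho>)) * (\<sigma> - \<rho>)"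
  define w where "w = cnj \<beta> - \<beta> * s\<^sup>2 - \<sigma>'"
  define A where "A = 2 * \<alpha> + \<beta> * (s + \<sigma>)"
  have bnd: "cmod (2 * \<alpha> + \<beta> * (u + v)) \<le> 4 * \<alpha>" if "cmod u \<le> 1" "cmod v \<le> 1" for u v
  proof -
    have "cmod (u + v) \<le> 2" using norm_triangle_ineq[of u v] that by simp
    then have "cmod (\<beta> * (u + v)) \<le> \<alpha> * 2" unfolding norm_mult using \<beta> \<alpha> by (intro mult_mono) auto
    moreover have "cmod (2 * complex_of_real \<alpha>) = 2 * \<alpha>" using \<alpha> by (simp add: norm_mult)
    ultimately show ?thesis using norm_triangle_ineq[of "2 * complex_of_real \<alpha>" "\<beta> * (u + v)"] by simp
  qed
  have split: "s' - \<sigma>' = - y * (e + A * \<delta>) + w"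
  proof -
    have "cnj \<beta> + 2 * \<alpha> * s + \<beta> * s\<^sup>2 = (cnj \<beta> + 2 * \<alpha> * \<rho> + \<beta> * \<rho>\<^sup>2) + e + A * \<delta>"
      by (simp add: e_def A_def \<delta>_def algebra_simps power2_eq_square)
    then have "cnj \<beta> + 2 * \<alpha> * s + \<beta> * s\<^sup>2 = e + A * \<delta>" unfolding root by simp
    then show ?thesis unfolding s' w_def by (simp add: algebra_simps)
  qed
  have "Re (cnj \<delta> * (A * \<delta>)) = Re A * (cmod \<delta>)\<^sup>2"
    unfolding cmod_power2 by (simp add: power2_eq_square algebra_simps)
  then have main: "Re (cnj \<delta> * (s' - \<sigma>')) = - y * Re (cnj \<delta> * e) - y * (Re A * (cmod \<delta>)\<^sup>2) + Re (cnj \<delta> * w)"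
  proof -
    have "cnj \<delta> * (- y * (e + A * \<delta>) + w) = of_real (- y) * (cnj \<delta> * e) + of_real (- y) * (cnj \<delta> * (A * \<delta>)) + cnj \<delta> * w"
      by (simp add: algebra_simps)
    then have "Re (cnj \<delta> * (s' - \<sigma>')) = - y * Re (cnj \<delta> * e) + - y * Re (cnj \<delta> * (A * \<delta>)) + Re (cnj \<delta> * w)"
      unfolding split by (simp only: plus_complex.sel Re_complex_of_real_mult)
    then show ?thesis using \<open>Re (cnj \<delta> * (A * \<delta>)) = Re A * (cmod \<delta>)\<^sup>2\<close> by simp
  qed
  have e_le: "cmod e \<le> 4 * \<alpha> * \<eta>"
    unfolding e_def norm_mult \<eta>_def using bnd[OF \<sigma> \<rho>] by (intro mult_right_mono) auto
  have "- Re (cnj \<delta> * e) \<le> cmod \<delta> * cmod e" using abs_Re_le_cmod[of "cnj \<delta> * e"] by (simp add: norm_mult)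
  also have "\<dots> \<le> 2 * (4 * \<alpha> * \<eta>)" using \<delta>2 e_le by (intro mult_mono) auto
  finally have E: "- Re (cnj \<delta> * e) \<le> 8 * (\<alpha> * \<eta>)" by simp
  have "cmod w \<le> 2 * \<alpha> + L"
  proof -
    have "(cmod s)\<^sup>2 \<le> 1" using s by (simp add: power_le_one)
    then have "cmod (\<beta> * s\<^sup>2) \<le> \<alpha> * 1" unfolding norm_mult norm_power using \<beta> \<alpha> by (intro mult_mono) auto
    then show ?thesis unfolding w_def
      using norm_triangle_ineq4[of "cnj \<beta> - \<beta> * s\<^sup>2" \<sigma>'] norm_triangle_ineq4[of "cnj \<beta>" "\<beta> * s\<^sup>2"] \<beta> L by simp
  qed
  then have "cmod \<delta> * cmod w \<le> 2 * (2 * \<alpha> + L)" using \<delta>2 by (intro mult_mono) auto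
  then have W: "Re (cnj \<delta> * w) \<le> 2 * (2 * \<alpha> + L)"
    using complex_Re_le_cmod[of "cnj \<delta> * w"] by (simp add: norm_mult)
  \<comment> \<open>The dissipation is stated relative to the root. Exchanging
    \<open>\<sigma>\<close> for \<open>\<rho>\<close> costs 4 in the first factor and 16 in the
    squared distance; with the 8 from \<open>E\<close> and the outer factor 2 this makes 56.\<close>
  have G: "Re (2 * \<alpha> + \<beta> * (s + \<rho>)) * (cmod (s - \<rho>))\<^sup>2 \<le> Re A * (cmod \<delta>)\<^sup>2 + 20 * (\<alpha> * \<eta>)"
  proof -
    have 1: "Re (2 * \<alpha> + \<beta> * (s + \<rho>)) = Re A - Re (\<beta> * (\<sigma> - \<rho>))" by (simp add: A_def algebra_simps)
    have "\<bar>Re (\<beta> * (\<sigma> - \<rho>))\<bar> \<le> \<alpha> * \<eta>"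
      using abs_Re_le_cmod[of "\<beta> * (\<sigma> - \<rho>)"] mult_right_mono[OF \<beta> \<eta>] by (simp add: norm_mult \<eta>_def)
    moreover have "(cmod \<delta>)\<^sup>2 \<le> 2\<^sup>2" using \<delta>2 by (intro power_mono) auto
    ultimately have "\<bar>Re (\<beta> * (\<sigma> - \<rho>)) * (cmod \<delta>)\<^sup>2\<bar> \<le> (\<alpha> * \<eta>) * 2\<^sup>2"
      unfolding abs_mult by (intro mult_mono) auto
    then have first: "- (Re (\<beta> * (\<sigma> - \<rho>)) * (cmod \<delta>)\<^sup>2) \<le> 4 * (\<alpha> * \<eta>)" by simp
    have "\<bar>cmod (s - \<rho>) - cmod \<delta>\<bar> \<le> \<eta>"
      using norm_triangle_ineq3[of "s - \<rho>" \<delta>] by (simp add: \<delta>_def \<eta>_def)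
    then have "\<bar>cmod (s - \<rho>) - cmod \<delta>\<bar> * (cmod (s - \<rho>) + cmod \<delta>) \<le> \<eta> * 4"
      using sr2 \<delta>2 \<eta> by (intro mult_mono) auto
    moreover have "\<bar>(cmod (s - \<rho>))\<^sup>2 - (cmod \<delta>)\<^sup>2\<bar> = \<bar>cmod (s - \<rho>) - cmod \<delta>\<bar> * (cmod (s - \<rho>) + cmod \<delta>)"
      unfolding power2_eq_square square_diff_square_factored abs_mult by (simp add: mult.commute)
    ultimately have "\<bar>(cmod (s - \<rho>))\<^sup>2 - (cmod \<delta>)\<^sup>2\<bar> \<le> \<eta> * 4" by simp
    moreover have "\<bar>Re (2 * \<alpha> + \<beta> * (s + \<rho>))\<bar> \<le> 4 * \<alpha>"
      using abs_Re_le_cmod[of "2 * \<alpha> + \<beta> * (s + \<rho>)"] bnd[OF s \<rho>] by linarith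
    ultimately have "\<bar>Re (2 * \<alpha> + \<beta> * (s + \<rho>)) * ((cmod (s - \<rho>))\<^sup>2 - (cmod \<delta>)\<^sup>2)\<bar> \<le> (4 * \<alpha>) * (\<eta> * 4)"
      unfolding abs_mult using \<alpha> by (intro mult_mono) auto
    then have second: "Re (2 * \<alpha> + \<beta> * (s + \<rho>)) * (cmod (s - \<rho>))\<^sup>2 - Re (2 * \<alpha> + \<beta> * (s + \<rho>)) * (cmod \<delta>)\<^sup>2 \<le> 16 * (\<alpha> * \<eta>)"
      by (simp add: right_diff_distrib)
    have "Re (2 * \<alpha> + \<beta> * (s + \<rho>)) * (cmod \<delta>)\<^sup>2 = Re A * (cmod \<delta>)\<^sup>2 - Re (\<beta> * (\<sigma> - \<rho>)) * (cmod \<delta>)\<^sup>2"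
      unfolding 1 by (rule left_diff_distrib)
    then show ?thesis using first second by linarith
  qed
  have "2 * Re (cnj \<delta> * (s' - \<sigma>')) = 2 * y * (- Re (cnj \<delta> * e)) - 2 * y * (Re A * (cmod \<delta>)\<^sup>2) + 2 * Re (cnj \<delta> * w)"
  proof -
    have "2 * (- y * u - y * g + v) = 2 * y * (- u) - 2 * y * g + 2 * v" for u g v by (simp add: algebra_simps)
    then show ?thesis unfolding main .
  qed
  also have "\<dots> \<le> 2 * y * (8 * (\<alpha> * \<eta>)) - 2 * y * (Re (2 * \<alpha> + \<beta> * (s + \<rho>)) * (cmod (s - \<rho>))\<^sup>2 - 20 * (\<alpha> * \<eta>)) + 2 * (2 * (2 * \<alpha> + L))"
    using E W G y by (intro add_mono diff_mono mult_left_mono) auto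
  also have "\<dots> = - 2 * y * (Re (2 * \<alpha> + \<beta> * (s + \<rho>)) * (cmod (s - \<rho>))\<^sup>2) + 56 * y * (\<alpha> * \<eta>) + 8 * \<alpha> + 4 * L"
    by (simp add: algebra_simps)
  finally show ?thesis by (simp add: \<delta>_def \<eta>_def)
qed

text \<open>With \<open>x\<close> the quantity on the left and \<open>G = 2 l + x\<close> the
  dissipation coefficient, \<open>Re (\<beta> s) \<ge> - \<alpha>\<close> gives
  \<open>x \<ge> - l\<close>, hence \<open>|x| \<le> G\<close>. Either \<open>|x|\<close> is below
  \<open>\<kappa> \<alpha>\<close>, or \<open>s\<close> is at least \<open>\<kappa>\<close> away
  from the root and the dissipation controls \<open>G\<close>. The dichotomy is needed because
  \<open>G\<close> can degenerate, so the dissipation does not bound the distance to the root by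
  itself.\<close>

lemma defect_bound:
  fixes s \<rho> \<beta> :: complex and \<alpha> l \<kappa> :: real
  assumes \<beta>: "cmod \<beta> \<le> \<alpha>" and s: "cmod s \<le> 1" and r: "\<beta> * \<rho> = of_real (l - \<alpha>)" and l: "0 \<le> l" and \<kappa>: "0 < \<kappa>"
  shows "\<bar>Re (\<beta> * (s - \<rho>))\<bar> \<le> \<kappa> * \<alpha> + Re (2 * \<alpha> + \<beta> * (s + \<rho>)) * (cmod (s - \<rho>))\<^sup>2 / \<kappa>\<^sup>2"
proof -
  have \<alpha>: "0 \<le> \<alpha>" using \<beta> norm_ge_zero order_trans by blast
  define x where "x = Re (\<beta> * (s - \<rho>))"
  define G where "G = Re (2 * \<alpha> + \<beta> * (s + \<rho>))"
  have G: "G = 2 * l + x" using r by (simp add: G_def x_def algebra_simps complex_eq_iff)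
  have "- \<alpha> \<le> Re (\<beta> * s)"
    using abs_Re_le_cmod[of "\<beta> * s"] mult_mono[OF \<beta> s \<alpha>] by (simp add: norm_mult)
  moreover have "x = Re (\<beta> * s) + \<alpha> - l" using r by (simp add: x_def right_diff_distrib)
  ultimately have "- l \<le> x" by simp
  then have Gx: "\<bar>x\<bar> \<le> G" using G l by simp
  show ?thesis
  proof (cases "\<bar>x\<bar> \<le> \<kappa> * \<alpha>")
    case True
    have "0 \<le> G * (cmod (s - \<rho>))\<^sup>2 / \<kappa>\<^sup>2" using Gx by simp
    then show ?thesis using True unfolding x_def G_def by linarith
  next
    case False
    have "\<bar>x\<bar> \<le> \<alpha> * cmod (s - \<rho>)"
      using abs_Re_le_cmod[of "\<beta> * (s - \<rho>)"] mult_right_mono[OF \<beta>, of "cmod (s - \<rho>)"] by (simp add: norm_mult x_def)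
    then have "\<kappa> * \<alpha> < \<alpha> * cmod (s - \<rho>)" using False by simp
    then have "\<kappa> \<le> cmod (s - \<rho>)" using \<alpha> by (metis linorder_not_less mult.commute mult_left_mono order_less_imp_le)
    then have "\<kappa>\<^sup>2 \<le> (cmod (s - \<rho>))\<^sup>2" using \<kappa> by (intro power_mono) auto
    then have "G * \<kappa>\<^sup>2 \<le> G * (cmod (s - \<rho>))\<^sup>2" using Gx by (intro mult_left_mono) auto
    then have "G \<le> G * (cmod (s - \<rho>))\<^sup>2 / \<kappa>\<^sup>2" using \<kappa> by (simp add: pos_le_divide_eq)
    moreover have "0 \<le> \<kappa> * \<alpha>" using \<kappa> \<alpha> by simp
    ultimately show ?thesis using Gx unfolding x_def G_def by linarith
  qed
qed

text \<open>For \<open>s = p / q\<close> the derivative of \<open>ln (|q|^2)\<close> is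
  \<open>2 (y a + (1 + y) Re (b s))\<close>. Inserting the root for \<open>s\<close> gives the main
  term \<open>2 y lam\<close>; the errors are \<open>2 y Re (b (s - sroot))\<close>, bounded by
  \<open>defect_bound\<close>, and \<open>2 Re (b s)\<close>, bounded by \<open>2 a\<close>.
  Integrating the dissipation inequality bounds the integral of \<open>G\<close>, and its division
  by \<open>2 y\<close> turns 56 into 28.\<close>

lemma growth_estimate:
  assumes sol: "row_solution (\<i> * of_real y) p q" and init: "p 0 = 0" "q 0 = 1" and y: "0 < y" and T: "0 \<le> T"
    and h: "0 < h" and \<kappa>: "0 < \<kappa>"
  defines "I \<equiv> integral {0..T} a" and "\<epsilon> \<equiv> integral {0..T} (\<lambda>t. a t * cmod (avg h t - sroot t))"
  shows "\<bar>ln (cmod (q T)) / y - integral {0..T} lam\<bar> \<le>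
    \<kappa> * I + (28 * \<epsilon> + (2 + 4 * I + 2 * (2 / h) * T) / y) / \<kappa>\<^sup>2 + I / y"
proof -
  have q1: "1 \<le> (cmod (q t))\<^sup>2 - (cmod (p t))\<^sup>2" if "0 \<le> t" for t
    using energy_mono[OF sol _ order_refl that] init y by simp
  have qge: "1 \<le> cmod (q t)" and pq: "cmod (p t) \<le> cmod (q t)" if "0 \<le> t" for t
  proof -
    have "(cmod (p t))\<^sup>2 \<le> (cmod (q t))\<^sup>2" "1\<^sup>2 \<le> (cmod (q t))\<^sup>2"
      using q1[OF that] zero_le_power2[of "cmod (p t)"] unfolding one_power2 by linarith+
    then show "1 \<le> cmod (q t)" "cmod (p t) \<le> cmod (q t)" by (auto intro: power2_le_imp_le)
  qed
  have qnz: "q t \<noteq> 0" if "0 \<le> t" for t using qge[OF that] by auto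
  define s where "s = (\<lambda>t. p t * inverse (q t))"
  have s1: "cmod (s t) \<le> 1" if "0 \<le> t" for t
  proof -
    have "cmod (s t) = cmod (p t) / cmod (q t)" by (simp add: s_def norm_mult norm_inverse divide_inverse)
    then show ?thesis using pq[OF that] qge[OF that] by (simp add: divide_le_eq)
  qed
  have acs: "abs_continuous_on {0..T} s" unfolding s_def
    by (intro abs_continuous_on_mult abs_continuous_on_inverse[of _ _ _ 1] row_solutionD[OF sol] order_refl)
       (use qge in auto)
  have ders: "AE t in lebesgue. 0 < t \<longrightarrow> (s has_vector_derivative
     (- y * (cnj (b t) + 2 * a t * s t + b t * (s t)\<^sup>2) + (cnj (b t) - b t * (s t)\<^sup>2))) (at t)"
    using row_solutionD(3)[OF sol]
  proof eventually_elim
    case (elim t)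
    show ?case
    proof
      assume t: "0 < t"
      have nz: "q t \<noteq> 0" using qnz t by simp
      define p' where "p' = \<i> * (\<i> * of_real y) * a t * p t + (1 + \<i> * (\<i> * of_real y)) * cnj (b t) * q t"
      define q' where "q' = (1 - \<i> * (\<i> * of_real y)) * b t * p t - \<i> * (\<i> * of_real y) * a t * q t"
      have dp: "(p has_vector_derivative p') (at t)" and dq: "(q has_vector_derivative q') (at t)"
        using elim t by (auto simp: p'_def q'_def)
      have "((inverse \<circ> q) has_vector_derivative q' * - (inverse (q t) ^ Suc (Suc 0))) (at t)"
        by (rule field_vector_diff_chain_at[OF dq DERIV_inverse[OF nz]])
      then have "(s has_vector_derivative p t * (q' * - (inverse (q t) ^ Suc (Suc 0))) + p' * inverse (q t)) (at t)"
        unfolding s_def o_def by (rule has_vector_derivative_mult[OF dp])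
      moreover have "p t * (q' * - (inverse (q t) ^ Suc (Suc 0))) + p' * inverse (q t) =
         (- y * (cnj (b t) + 2 * a t * s t + b t * (s t)\<^sup>2) + (cnj (b t) - b t * (s t)\<^sup>2))"
        unfolding p'_def q'_def s_def using nz by (simp add: field_simps power2_eq_square)
      ultimately show "(s has_vector_derivative (- y * (cnj (b t) + 2 * a t * s t + b t * (s t)\<^sup>2) + (cnj (b t) - b t * (s t)\<^sup>2))) (at t)"
        by simp
    qed
  qed
  define G where "G = (\<lambda>t. Re (2 * a t + b t * (s t + sroot t)) * (cmod (s t - sroot t))\<^sup>2)"
  define \<eta> where "\<eta> = (\<lambda>t. a t * cmod (avg h t - sroot t))"
  have \<eta>_int: "\<eta> integrable_on {0..T}" unfolding \<eta>_def by (rule integrable_avg_error[OF h])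
  have G_int: "G integrable_on {0..T}"
  proof (rule measurable_bounded_integrable[of _ _ _ "\<lambda>t. 4 * a t * 4"])
    have [measurable]: "a \<in> borel_measurable (lebesgue_on {0..T})" "b \<in> borel_measurable (lebesgue_on {0..T})"
      "sroot \<in> borel_measurable (lebesgue_on {0..T})"
      by (auto intro: measurable_restrict_space1 measurable_sroot measurable_a measurable_b)
    have [measurable]: "s \<in> borel_measurable (lebesgue_on {0..T})"
      by (intro continuous_imp_measurable_on_sets_lebesgue abs_continuous_on_imp_continuous_on acs) auto
    have "G = (\<lambda>t. (2 * a t + Re (b t * (s t + sroot t))) * (cmod (s t - sroot t))\<^sup>2)" by (simp add: G_def)
    also have "\<dots> \<in> borel_measurable (lebesgue_on {0..T})" by measurable
    finally show "G \<in> borel_measurable (lebesgue_on {0..T})" .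
    show "(\<lambda>t. 4 * a t * 4) integrable_on {0..T}" by (intro integrable_on_mult_left integrable_on_mult_right integrable_a)
    fix t assume t: "t \<in> {0..T}"
    have st: "cmod (s t) \<le> 1" using s1 t by simp
    have "cmod (s t + sroot t) \<le> 2" "cmod (s t - sroot t) \<le> 2"
      using norm_triangle_ineq[of "s t" "sroot t"] norm_triangle_ineq4[of "s t" "sroot t"] st cmod_sroot_le[of t] by auto
    then have "cmod (b t * (s t + sroot t)) \<le> a t * 2" "(cmod (s t - sroot t))\<^sup>2 \<le> 2\<^sup>2"
      unfolding norm_mult using norm_b_le[of t] a_nonneg[of t] by (intro mult_mono power_mono; simp)+
    then have "\<bar>Re (2 * a t + b t * (s t + sroot t))\<bar> \<le> 4 * a t" "(cmod (s t - sroot t))\<^sup>2 \<le> 4"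
      using abs_Re_le_cmod[of "b t * (s t + sroot t)"] a_nonneg[of t] by auto
    then show "norm (G t) \<le> 4 * a t * 4"
      unfolding G_def real_norm_def abs_mult using a_nonneg[of t] by (intro mult_mono) auto
  qed
  have intG: "integral {0..T} G \<le> 28 * \<epsilon> + (2 + 4 * I + 2 * (2 / h) * T) / y"
  proof -
    have "(cmod (s T - avg h T))\<^sup>2 - (cmod (s 0 - avg h 0))\<^sup>2 \<le>
        integral {0..T} (\<lambda>t. - 2 * y * G t + 56 * y * \<eta> t + 8 * a t + 4 * (2 / h))"
    proof (rule abs_continuous_deriv_le[OF T])
      show "abs_continuous_on {0..T} (\<lambda>t. (cmod (s t - avg h t))\<^sup>2)"
        by (intro abs_continuous_on_cmod_square abs_continuous_on_diff acs avg_abs_continuous h)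
      show "(\<lambda>t. - 2 * y * G t + 56 * y * \<eta> t + 8 * a t + 4 * (2 / h)) integrable_on {0..T}"
        by (intro integrable_add integrable_on_mult_right G_int \<eta>_int integrable_a integrable_const_ivl)
      show "AE t in lebesgue. 0 < t \<and> t < T \<longrightarrow> (\<exists>d. ((\<lambda>t. (cmod (s t - avg h t))\<^sup>2) has_vector_derivative d) (at t) \<and>
          d \<le> - 2 * y * G t + 56 * y * \<eta> t + 8 * a t + 4 * (2 / h))"
        using ders avg_derivative[OF h]
      proof eventually_elim
        case (elim t)
        show ?case
        proof (intro impI)
          assume t: "0 < t \<and> t < T"
          define s' where "s' = - y * (cnj (b t) + 2 * a t * s t + b t * (s t)\<^sup>2) + (cnj (b t) - b t * (s t)\<^sup>2)"
          obtain \<sigma>' where \<sigma>': "(avg h has_vector_derivative \<sigma>') (at t)" "cmod \<sigma>' \<le> 2 / h" using elim t by blast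
          have "(s has_vector_derivative s') (at t)" using elim t by (simp add: s'_def)
          then have "((\<lambda>t. (cmod (s t - avg h t))\<^sup>2) has_vector_derivative 2 * Re (cnj (s t - avg h t) * (s' - \<sigma>'))) (at t)"
            by (intro has_vector_derivative_cmod_square has_vector_derivative_diff \<sigma>')
          moreover have "2 * Re (cnj (s t - avg h t) * (s' - \<sigma>')) \<le> - 2 * y * G t + 56 * y * \<eta> t + 8 * a t + 4 * (2 / h)"
            unfolding G_def \<eta>_def
            by (rule riccati_dissipation[OF norm_b_le _ avg_bound[OF h] cmod_sroot_le sroot_equation \<sigma>'(2) _ s'_def])
               (use s1 t y in auto)
          ultimately show "\<exists>d. ((\<lambda>t. (cmod (s t - avg h t))\<^sup>2) has_vector_derivative d) (at t) \<and>
              d \<le> - 2 * y * G t + 56 * y * \<eta> t + 8 * a t + 4 * (2 / h)" by blast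
        qed
      qed
    qed
    also have "integral {0..T} (\<lambda>t. - 2 * y * G t + 56 * y * \<eta> t + 8 * a t + 4 * (2 / h)) =
        - 2 * y * integral {0..T} G + 56 * y * integral {0..T} \<eta> + 8 * I + 4 * (2 / h) * T"
      unfolding I_def using T
      by (intro integral_unique has_integral_add has_integral_mult_right integrable_integral G_int \<eta>_int integrable_a)
         (use has_integral_const_real[of "4 * (2 / h)" 0 T] in \<open>simp add: mult.commute\<close>)
    finally have "(cmod (s T - avg h T))\<^sup>2 - (cmod (s 0 - avg h 0))\<^sup>2 \<le> - 2 * y * integral {0..T} G + 56 * y * \<epsilon> + 8 * I + 4 * (2 / h) * T"
      by (simp add: \<epsilon>_def \<eta>_def)
    moreover have "(cmod (s 0 - avg h 0))\<^sup>2 \<le> 1" using avg_bound[OF h, of 0] init by (simp add: s_def power_le_one)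
    moreover have "0 \<le> (cmod (s T - avg h T))\<^sup>2" by simp
    ultimately have "2 * y * integral {0..T} G \<le> 4 + 56 * y * \<epsilon> + 8 * I + 4 * (2 / h) * T" by linarith
    then have "integral {0..T} G \<le> (4 + 56 * y * \<epsilon> + 8 * I + 4 * (2 / h) * T) / (2 * y)"
      using y by (simp add: pos_le_divide_eq mult.commute)
    also have "\<dots> = 28 * \<epsilon> + (2 + 4 * I + 2 * (2 / h) * T) / y"
      using y by (simp add: add_divide_distrib)
    finally show ?thesis .
  qed
  define f where "f = (\<lambda>t. ln ((cmod (q t))\<^sup>2))"
  have acf: "abs_continuous_on {0..T} f" unfolding f_def
    by (rule abs_continuous_on_ln[of _ _ _ 1])
       (use qge in \<open>auto intro!: abs_continuous_on_cmod_square row_solutionD[OF sol] simp: one_le_power\<close>)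
  define E where "E = (\<lambda>t. 2 * (y * (\<kappa> * a t + G t / \<kappa>\<^sup>2) + a t))"
  have E_int: "(E has_integral 2 * (y * (\<kappa> * I + integral {0..T} G / \<kappa>\<^sup>2) + I)) {0..T}"
    unfolding E_def I_def
    by (intro has_integral_mult_right has_integral_add has_integral_divide integrable_integral G_int integrable_a)
  have L_int: "((\<lambda>t. 2 * (y * lam t)) has_integral 2 * (y * integral {0..T} lam)) {0..T}"
    by (intro has_integral_mult_right integrable_integral integrable_lam)
  have derf: "AE t in lebesgue. 0 < t \<longrightarrow> (\<exists>d. (f has_vector_derivative d) (at t) \<and> \<bar>d - 2 * (y * lam t)\<bar> \<le> E t)"
    using row_solutionD(3)[OF sol]
  proof eventually_elim
    case (elim t)
    show ?case
    proof
      assume t: "0 < t"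
      have nz: "q t \<noteq> 0" and q2: "0 < (cmod (q t))\<^sup>2" using qnz[of t] t by auto
      define q' where "q' = (1 - \<i> * (\<i> * of_real y)) * b t * p t - \<i> * (\<i> * of_real y) * a t * q t"
      define d where "d = 2 * Re (cnj (q t) * q') / (cmod (q t))\<^sup>2"
      have "(q has_vector_derivative q') (at t)" using elim t by (simp add: q'_def)
      then have df: "(f has_vector_derivative d) (at t)" unfolding f_def d_def
        using q2 by (intro has_vector_derivative_ln has_vector_derivative_cmod_square)
      have "q' = q t * of_real 1 * (y * a t + (1 + y) * (b t * s t))"
        unfolding q'_def s_def using nz by (simp add: field_simps)
      then have "cnj (q t) * q' = (q t * cnj (q t)) * (y * a t + (1 + y) * (b t * s t))" by simp
      also have "q t * cnj (q t) = of_real ((cmod (q t))\<^sup>2)" by (rule complex_norm_square[symmetric])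
      finally have "cnj (q t) * q' = of_real ((cmod (q t))\<^sup>2) * (y * a t + (1 + y) * (b t * s t))" .
      then have "Re (cnj (q t) * q') = (cmod (q t))\<^sup>2 * Re (y * a t + (1 + y) * (b t * s t))"
        by (simp only: Re_complex_of_real_mult)
      then have "d = 2 * Re (y * a t + (1 + y) * (b t * s t))" using q2 by (simp add: d_def)
      then have d1: "d = 2 * (y * a t + (1 + y) * Re (b t * s t))"
        by (simp only: plus_complex.sel Re_complex_of_real_mult Re_complex_of_real)
      define x where "x = Re (b t * (s t - sroot t))"
      have rx: "Re (b t * s t) + a t - lam t = x"
        using arg_cong[OF b_sroot[of t], of Re] by (simp add: x_def right_diff_distrib)
      have "2 * (y * A + (1 + y) * r) - 2 * (y * l) = 2 * (y * (r + A - l) + r)" for A r l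
        by (simp add: algebra_simps)
      then have d2: "d - 2 * (y * lam t) = 2 * (y * x + Re (b t * s t))" unfolding d1 rx[symmetric] .
      have "\<bar>x\<bar> \<le> \<kappa> * a t + G t / \<kappa>\<^sup>2"
        unfolding x_def G_def by (rule defect_bound[OF norm_b_le _ b_sroot lam_bounds(1) \<kappa>]) (use s1 t in auto)
      then have "\<bar>y * x\<bar> \<le> y * (\<kappa> * a t + G t / \<kappa>\<^sup>2)" using y by (simp add: abs_mult)
      moreover have "\<bar>2 * (u + v)\<bar> \<le> 2 * (U + V)" if "\<bar>u\<bar> \<le> U" "\<bar>v\<bar> \<le> V" for u v U V :: real
        using that by (auto simp: abs_le_iff)
      moreover have "\<bar>Re (b t * s t)\<bar> \<le> a t"
        using abs_Re_le_cmod[of "b t * s t"] mult_mono[OF norm_b_le[of t] s1[of t] a_nonneg[of t]] t by (simp add: norm_mult)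
      ultimately have "\<bar>d - 2 * (y * lam t)\<bar> \<le> E t" unfolding d2 E_def by blast
      then show "\<exists>d. (f has_vector_derivative d) (at t) \<and> \<bar>d - 2 * (y * lam t)\<bar> \<le> E t" using df by blast
    qed
  qed
  have up: "f T - f 0 \<le> integral {0..T} (\<lambda>t. 2 * (y * lam t) + E t)"
  proof (rule abs_continuous_deriv_le[OF T acf])
    show "AE t in lebesgue. 0 < t \<and> t < T \<longrightarrow> (\<exists>d. (f has_vector_derivative d) (at t) \<and> d \<le> 2 * (y * lam t) + E t)"
      using derf by eventually_elim (fastforce simp: abs_le_iff)
  qed (use has_integral_add[OF L_int E_int] in blast)
  have down: "- f T - - f 0 \<le> integral {0..T} (\<lambda>t. - (2 * (y * lam t)) + E t)"
  proof (rule abs_continuous_deriv_le[OF T abs_continuous_on_minus[OF acf]])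
    show "AE t in lebesgue. 0 < t \<and> t < T \<longrightarrow> (\<exists>d. ((\<lambda>t. - f t) has_vector_derivative d) (at t) \<and> d \<le> - (2 * (y * lam t)) + E t)"
      using derf
    proof eventually_elim
      case (elim t)
      show ?case
      proof
        assume "0 < t \<and> t < T"
        then obtain d where d: "(f has_vector_derivative d) (at t)" "\<bar>d - 2 * (y * lam t)\<bar> \<le> E t" using elim by blast
        show "\<exists>d. ((\<lambda>t. - f t) has_vector_derivative d) (at t) \<and> d \<le> - (2 * (y * lam t)) + E t"
          by (intro exI[of _ "- d"] conjI has_vector_derivative_minus d(1)) (use d(2) in linarith)
      qed
    qed
  qed (use has_integral_add[OF has_integral_neg[OF L_int] E_int] in blast)
  have f0: "f 0 = 0" using init by (simp add: f_def)
  have fT: "f T = 2 * ln (cmod (q T))" using qnz[OF T] by (simp add: f_def ln_realpow)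
  have "\<bar>ln (cmod (q T)) - y * integral {0..T} lam\<bar> \<le> y * (\<kappa> * I + integral {0..T} G / \<kappa>\<^sup>2) + I"
  proof -
    have "\<bar>l - u\<bar> \<le> v + I" if "2 * l - 0 \<le> 2 * u + 2 * (v + I)" "- (2 * l) - - 0 \<le> - (2 * u) + 2 * (v + I)" for l u v :: real
      using that by (auto simp: abs_le_iff)
    then show ?thesis
      using up down unfolding integral_unique[OF has_integral_add[OF L_int E_int]]
        integral_unique[OF has_integral_add[OF has_integral_neg[OF L_int] E_int]] f0 fT by blast
  qed
  then have "\<bar>ln (cmod (q T)) - y * integral {0..T} lam\<bar> / y \<le> (y * (\<kappa> * I + integral {0..T} G / \<kappa>\<^sup>2) + I) / y"
    using y by (intro divide_right_mono) auto
  moreover have "\<bar>ln (cmod (q T)) - y * integral {0..T} lam\<bar> / y = \<bar>ln (cmod (q T)) / y - integral {0..T} lam\<bar>"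
  proof -
    have "ln (cmod (q T)) / y - integral {0..T} lam = (ln (cmod (q T)) - y * integral {0..T} lam) / y"
      using y by (simp add: diff_divide_distrib)
    then show ?thesis using y by (simp only: abs_divide abs_of_pos)
  qed
  moreover have "(y * (\<kappa> * I + integral {0..T} G / \<kappa>\<^sup>2) + I) / y = \<kappa> * I + integral {0..T} G / \<kappa>\<^sup>2 + I / y"
    using y by (simp add: add_divide_distrib)
  moreover have "integral {0..T} G / \<kappa>\<^sup>2 \<le> (28 * \<epsilon> + (2 + 4 * I + 2 * (2 / h) * T) / y) / \<kappa>\<^sup>2"
    using intG by (rule divide_right_mono) simp
  ultimately show ?thesis by linarith
qed

text \<open>The parameters are chosen in order: \<open>\<kappa>\<close> makes
  \<open>\<kappa> I\<close> small, then \<open>h\<close> makes the averaging error small against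
  \<open>\<kappa>^2\<close>, and only then \<open>y\<close> is taken large enough to beat
  \<open>1 / h\<close>.\<close>

theorem growth_along_imaginary_axis:
  assumes sol: "\<And>y. 0 < y \<Longrightarrow> row_solution (\<i> * of_real y) (p y) (q y)"
    and init: "\<And>y. p y 0 = 0" "\<And>y. q y 0 = 1" and T: "0 \<le> T"
  shows "((\<lambda>y. ln (cmod (q y T)) / y) \<longlongrightarrow> integral {0..T} lam) at_top"
proof (rule tendstoI)
  fix e :: real assume e: "0 < e"
  define I where "I = integral {0..T} a"
  have I: "0 \<le> I" by (simp add: I_def integral_a_nonneg)
  define \<kappa> where "\<kappa> = e / (4 * (I + 1))"
  have \<kappa>: "0 < \<kappa>" using e I by (simp add: \<kappa>_def)
  have \<kappa>I: "\<kappa> * I \<le> e / 4"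
  proof -
    have "e / (4 * D) * D = e / 4" if "D \<noteq> 0" for D using that by simp
    then have "\<kappa> * (I + 1) = e / 4" unfolding \<kappa>_def using I by (metis add_nonneg_eq_0_iff zero_le_one zero_neq_one)
    then show ?thesis using \<kappa> by (simp add: distrib_left)
  qed
  have "(\<lambda>n. 28 * integral {0..T} (\<lambda>t. a t * cmod (avg (1 / real (Suc n)) t - sroot t)) / \<kappa>\<^sup>2) \<longlonglongrightarrow> 28 * 0 / \<kappa>\<^sup>2"
    using \<kappa> by (intro tendsto_intros avg_error_tendsto) auto
  then have "\<forall>\<^sub>F n in sequentially. 28 * integral {0..T} (\<lambda>t. a t * cmod (avg (1 / real (Suc n)) t - sroot t)) / \<kappa>\<^sup>2 < e / 4"
    using e by (intro order_tendstoD(2)) auto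
  then obtain n where n: "28 * integral {0..T} (\<lambda>t. a t * cmod (avg (1 / real (Suc n)) t - sroot t)) / \<kappa>\<^sup>2 < e / 4"
    by (auto simp: eventually_sequentially)
  define h where "h = 1 / real (Suc n)"
  have h: "0 < h" by (simp add: h_def)
  define \<epsilon> where "\<epsilon> = integral {0..T} (\<lambda>t. a t * cmod (avg h t - sroot t))"
  have "((\<lambda>y. (2 + 4 * I + 2 * (2 / h) * T) / y / \<kappa>\<^sup>2 + I / y) \<longlongrightarrow> 0) at_top"
  proof -
    have *: "((\<lambda>y::real. c / y) \<longlongrightarrow> 0) at_top" for c :: real
      by (rule tendsto_divide_0[OF tendsto_const filterlim_at_top_imp_at_infinity[OF filterlim_ident]])
    have "((\<lambda>y. (2 + 4 * I + 2 * (2 / h) * T) / y / \<kappa>\<^sup>2 + I / y) \<longlongrightarrow> 0 / \<kappa>\<^sup>2 + 0) at_top"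
      using \<kappa> by (intro tendsto_intros *) auto
    then show ?thesis by simp
  qed
  then have "\<forall>\<^sub>F y in at_top. (2 + 4 * I + 2 * (2 / h) * T) / y / \<kappa>\<^sup>2 + I / y < e / 4"
    using e by (intro order_tendstoD(2)) auto
  then show "\<forall>\<^sub>F y in at_top. dist (ln (cmod (q y T)) / y) (integral {0..T} lam) < e"
    using eventually_gt_at_top[of 0]
  proof eventually_elim
    case (elim y)
    have "\<bar>ln (cmod (q y T)) / y - integral {0..T} lam\<bar> \<le> \<kappa> * I + (28 * \<epsilon> + (2 + 4 * I + 2 * (2 / h) * T) / y) / \<kappa>\<^sup>2 + I / y"
      unfolding I_def \<epsilon>_def by (rule growth_estimate[OF sol init elim(2) T h \<kappa>]) (rule elim)
    also have "\<dots> = \<kappa> * I + 28 * \<epsilon> / \<kappa>\<^sup>2 + ((2 + 4 * I + 2 * (2 / h) * T) / y / \<kappa>\<^sup>2 + I / y)"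
      by (simp add: add_divide_distrib)
    also have "\<dots> < e" using \<kappa>I n elim(1) e unfolding \<epsilon>_def h_def by linarith
    finally show ?case by (simp add: dist_real_def)
  qed
qed

end

section \<open>Mean values of the logarithmic defect\<close>

text \<open>The Schwarz lemma transported by the Cayley transform; \<open>\<phi>\<close> maps the
  unit disc to the half plane and 0 to \<open>\<i>\<close>.\<close>

lemma schwarz_half_plane:
  assumes hol: "f holomorphic_on {z. 0 < Im z}" and lt: "\<And>z. 0 < Im z \<Longrightarrow> cmod (f z) < 1"
    and f0: "f \<i> = 0" and z: "0 < Im z"
  shows "cmod (f z) \<le> cmod ((z - \<i>) / (z + \<i>))"
proof -
  define \<phi> where "\<phi> = (\<lambda>\<zeta>. \<i> * (1 + \<zeta>) / (1 - \<zeta>))"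
  have up: "0 < Im (\<phi> \<zeta>)" if "cmod \<zeta> < 1" for \<zeta>
  proof -
    have nz: "1 - \<zeta> \<noteq> 0" using that by auto
    have "\<phi> \<zeta> = \<i> * ((1 + \<zeta>) * cnj (1 - \<zeta>)) / of_real ((cmod (1 - \<zeta>))\<^sup>2)"
      unfolding \<phi>_def complex_norm_square using nz by simp
    moreover have "Im (\<i> * ((1 + \<zeta>) * cnj (1 - \<zeta>))) = 1 - (cmod \<zeta>)\<^sup>2"
      unfolding cmod_power2 by (simp add: power2_eq_square algebra_simps)
    moreover have "(cmod \<zeta>)\<^sup>2 < 1" using that by (simp add: power_less_one_iff abs_square_less_1)
    ultimately show ?thesis using nz by (simp add: Im_divide_of_real)
  qed
  have hol\<phi>: "\<phi> holomorphic_on ball 0 1" unfolding \<phi>_def by (intro holomorphic_intros) auto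
  have "(f \<circ> \<phi>) holomorphic_on ball 0 1"
    by (rule holomorphic_on_compose_gen[OF hol\<phi> hol]) (use up in auto)
  moreover have "(f \<circ> \<phi>) 0 = 0" by (simp add: \<phi>_def f0)
  moreover have "cmod ((f \<circ> \<phi>) \<zeta>) < 1" if "cmod \<zeta> < 1" for \<zeta> using lt[OF up[OF that]] by simp
  ultimately have sch: "cmod ((f \<circ> \<phi>) \<zeta>) \<le> cmod \<zeta>" if "cmod \<zeta> < 1" for \<zeta>
    using Schwarz_Lemma(1)[of "f \<circ> \<phi>" \<zeta>] that by blast
  define \<zeta> where "\<zeta> = (z - \<i>) / (z + \<i>)"
  have zi: "z + \<i> \<noteq> 0" using z by (auto simp: complex_eq_iff)
  have "cmod (z - \<i>) < cmod (z + \<i>)" using z by (simp add: cmod_def power2_eq_square algebra_simps)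
  then have "cmod \<zeta> < 1" using zi by (simp add: \<zeta>_def norm_divide divide_less_eq)
  moreover have "\<phi> \<zeta> = z"
  proof -
    have "1 + \<zeta> = 2 * z / (z + \<i>)" "1 - \<zeta> = 2 * \<i> / (z + \<i>)" using zi by (auto simp: \<zeta>_def field_simps)
    then show ?thesis using zi by (simp add: \<phi>_def)
  qed
  ultimately show ?thesis using sch[of \<zeta>] by (simp add: \<zeta>_def)
qed

text \<open>After removal of the imaginary part at \<open>\<i>\<close>, a Moebius map sends the
  right half plane to the disc and \<open>g \<i>\<close> to 0, so the Schwarz bound applies;
  inverting the map gives the lower bound. It propagates the growth known at \<open>\<i>\<close> to
  the whole half plane.\<close>

lemma harnack_half_plane:
  assumes hol: "g holomorphic_on {z. 0 < Im z}" and pos: "\<And>z. 0 < Im z \<Longrightarrow> 0 < Re (g z)" and z: "0 < Im z"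
  defines "\<rho> \<equiv> cmod ((z - \<i>) / (z + \<i>))"
  shows "Re (g \<i>) * ((1 - \<rho>) / (1 + \<rho>)) \<le> Re (g z)"
proof -
  define G where "G = Re (g \<i>)"
  have G: "0 < G" using pos[of \<i>] by (simp add: G_def)
  define h where "h = (\<lambda>z. g z - \<i> * Im (g \<i>))"
  define F where "F = (\<lambda>z. (h z - G) / (h z + G))"
  have Re_h: "Re (h z) = Re (g z)" for z by (simp add: h_def)
  have nz: "h z + G \<noteq> 0" if "0 < Im z" for z
    using pos[OF that] G Re_h[of z] by (auto simp: complex_eq_iff)
  have "cmod (F z) \<le> \<rho>"
    unfolding \<rho>_def
  proof (rule schwarz_half_plane[OF _ _ _ z])
    show "F holomorphic_on {z. 0 < Im z}" unfolding F_def
      using nz by (intro holomorphic_intros) (auto simp: h_def intro!: holomorphic_intros hol)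
    show "cmod (F z) < 1" if "0 < Im z" for z
    proof -
      have "0 < Re (h z) * G" using pos[OF that] G Re_h[of z] by simp
      then have "cmod (h z - G) < cmod (h z + G)" by (simp add: cmod_def power2_eq_square algebra_simps)
      then show ?thesis using nz[OF that] by (simp add: F_def norm_divide divide_less_eq)
    qed
    have "h \<i> = of_real G" by (simp add: h_def G_def complex_eq_iff)
    then show "F \<i> = 0" by (simp add: F_def)
  qed
  define r where "r = cmod (F z)"
  have r: "r \<le> \<rho>" "0 \<le> r" using \<open>cmod (F z) \<le> \<rho>\<close> by (auto simp: r_def)
  have "cmod (z - \<i>) < cmod (z + \<i>)" using z by (simp add: cmod_def power2_eq_square algebra_simps)
  then have \<rho>: "\<rho> < 1" by (auto simp: \<rho>_def norm_divide divide_less_eq)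
  have F1: "1 - F z \<noteq> 0" using r \<rho> by (auto simp: r_def)
  have "h z = G * ((1 + F z) / (1 - F z))"
  proof -
    have "1 + F z = 2 * h z / (h z + G)" "1 - F z = 2 * of_real G / (h z + G)"
      using nz[OF z] by (auto simp: F_def field_simps)
    then show ?thesis using nz[OF z] G by simp
  qed
  also have "(1 + F z) / (1 - F z) = ((1 + F z) * cnj (1 - F z)) / of_real ((cmod (1 - F z))\<^sup>2)"
    unfolding complex_norm_square using F1 by simp
  finally have hz: "h z = of_real (G / (cmod (1 - F z))\<^sup>2) * ((1 + F z) * cnj (1 - F z))" by simp
  have "Re ((1 + F z) * cnj (1 - F z)) = 1 - r\<^sup>2"
    unfolding r_def cmod_power2 by (simp add: power2_eq_square algebra_simps)
  then have Reh: "Re (h z) = G / (cmod (1 - F z))\<^sup>2 * (1 - r\<^sup>2)"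
    unfolding hz by (simp only: times_complex.sel(1) Re_complex_of_real Im_complex_of_real mult_zero_left diff_zero)
  have d: "cmod (1 - F z) \<le> 1 + r" using norm_triangle_ineq4[of 1 "F z"] by (simp add: r_def)
  have c: "0 < cmod (1 - F z)" using F1 by simp
  have r1: "0 \<le> 1 - r\<^sup>2" using r \<rho> by (simp add: power_le_one)
  have "(1 - \<rho>) / (1 + \<rho>) \<le> (1 - r) / (1 + r)" using r \<rho> by (intro frac_le) auto
  also have "\<dots> = ((1 - r) * (1 + r)) / ((1 + r) * (1 + r))" using r by simp
  also have "(1 - r) * (1 + r) = 1 - r\<^sup>2" by (simp add: power2_eq_square algebra_simps)
  also have "(1 + r) * (1 + r) = (1 + r)\<^sup>2" by (simp add: power2_eq_square)
  also have "(1 - r\<^sup>2) / (1 + r)\<^sup>2 \<le> (1 - r\<^sup>2) / (cmod (1 - F z))\<^sup>2"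
    using d c r1 by (intro divide_left_mono power_mono mult_pos_pos) auto
  finally have "G * ((1 - \<rho>) / (1 + \<rho>)) \<le> G * ((1 - r\<^sup>2) / (cmod (1 - F z))\<^sup>2)" using G by (intro mult_left_mono) auto
  then show ?thesis using Reh Re_h[of z] by (simp add: G_def)
qed

section \<open>Continuity and subharmonicity of the logarithmic defect\<close>

lemma measurable_log_defect [measurable]: "log_defect \<in> borel_measurable borel"
  unfolding log_defect_def by measurable

text \<open>The value infinity outside the open disc is the limit from inside, so the defect is
  continuous into \<open>[0, \<infinity>]\<close>. Boundary points with \<open>|w| = 1\<close> need
  no separate treatment afterwards.\<close>

lemma tendsto_log_defect:
  assumes X: "(X \<longlongrightarrow> c) F"
  shows "((\<lambda>n. log_defect (X n)) \<longlongrightarrow> log_defect c) F"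
proof (cases "cmod c < 1")
  case True
  then have c2: "(cmod c)\<^sup>2 < 1" by (simp add: abs_square_less_1)
  have "\<forall>\<^sub>F n in F. cmod (X n) < 1" using order_tendstoD(2)[OF tendsto_norm[OF X] True] .
  then have "\<forall>\<^sub>F n in F. ennreal (ln (1 / (1 - (cmod (X n))\<^sup>2))) = log_defect (X n)"
    by eventually_elim (simp add: log_defect_def)
  moreover have "((\<lambda>n. ennreal (ln (1 / (1 - (cmod (X n))\<^sup>2)))) \<longlongrightarrow> ennreal (ln (1 / (1 - (cmod c)\<^sup>2)))) F"
    using c2 by (intro tendsto_ennrealI tendsto_intros X) auto
  ultimately show ?thesis using True by (simp add: log_defect_def tendsto_cong)
next
  case False
  show ?thesis
    unfolding log_defect_def[of c] using False
  proof (simp add: tendsto_top_iff_ennreal, intro allI impI)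
    fix M :: real assume M: "0 \<le> M"
    have "1 - exp (- M) < (cmod c)\<^sup>2"
    proof -
      have "1\<^sup>2 \<le> (cmod c)\<^sup>2" using False by (intro power_mono) auto
      then show ?thesis using exp_gt_zero[of "-M"] unfolding one_power2 by linarith
    qed
    then have "\<forall>\<^sub>F n in F. 1 - exp (- M) < (cmod (X n))\<^sup>2"
      by (intro order_tendstoD(1)[OF tendsto_power[OF tendsto_norm[OF X]]])
    then show "\<forall>\<^sub>F n in F. ennreal M < log_defect (X n)"
    proof eventually_elim
      case (elim n)
      show ?case
      proof (cases "cmod (X n) < 1")
        case True
        then have p: "0 < 1 - (cmod (X n))\<^sup>2" by (simp add: abs_square_less_1)
        have "exp M < 1 / (1 - (cmod (X n))\<^sup>2)"
        proof -
          have "(1 - (cmod (X n))\<^sup>2) * exp M < exp (- M) * exp M"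
            using elim by (intro mult_strict_right_mono) auto
          also have "\<dots> = 1" by (simp flip: exp_add)
          finally show ?thesis using p by (simp only: pos_less_divide_eq mult.commute)
        qed
        then have "ln (exp M) < ln (1 / (1 - (cmod (X n))\<^sup>2))"
          using p by (intro ln_less_cancel_iff[THEN iffD2]) auto
        then have "M < ln (1 / (1 - (cmod (X n))\<^sup>2))" by (simp only: ln_exp)
        then show ?thesis using True M by (simp add: log_defect_def ennreal_less_iff)
      qed (simp add: log_defect_def)
    qed
  qed
qed

lemma ennreal_integral_le_nn_integral:
  fixes f :: "'a \<Rightarrow> real"
  assumes "integrable M f"
  shows "ennreal (integral\<^sup>L M f) \<le> (\<integral>\<^sup>+x. ennreal (f x) \<partial>M)"
proof -
  have i: "integrable M (\<lambda>x. max 0 (f x))" using assms by (intro integrable_max) auto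
  have "ennreal (integral\<^sup>L M f) \<le> ennreal (integral\<^sup>L M (\<lambda>x. max 0 (f x)))"
    by (intro ennreal_leI integral_mono assms i) auto
  also have "\<dots> = (\<integral>\<^sup>+x. ennreal (max 0 (f x)) \<partial>M)" using i by (intro nn_integral_eq_integral[symmetric]) auto
  also have "\<dots> = (\<integral>\<^sup>+x. ennreal (f x) \<partial>M)" by (intro nn_integral_cong) (simp add: max_def ennreal_neg)
  finally show ?thesis .
qed

lemma disc_pairing_identity:
  "(1 - (cmod c)\<^sup>2) * (1 - (cmod w)\<^sup>2) \<le> (cmod (1 - cnj c * w))\<^sup>2"
proof -
  have "(cmod (1 - cnj c * w))\<^sup>2 - (1 - (cmod c)\<^sup>2) * (1 - (cmod w)\<^sup>2) = (cmod (c - w))\<^sup>2"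
    unfolding cmod_power2 by (simp add: power2_eq_square algebra_simps)
  then show ?thesis using zero_le_power2[of "cmod (c - w)"] by linarith
qed

text \<open>The defect is a supremum of real parts of holomorphic functions of \<open>w\<close>:
  \<open>- ln (1 - |w|\<^sup>2) = max\<^sub>c (ln (1 - |c|\<^sup>2) - 2 ln |1 - cnj c w|)\<close>, attained at \<open>c = w\<close>.\<close>

lemma log_defect_subharmonic:
  assumes cont: "continuous_on {z. 0 \<le> Im z} f" and hol: "f holomorphic_on {z. 0 < Im z}"
    and lt: "\<And>z. 0 \<le> Im z \<Longrightarrow> cmod (f z) < 1" and y: "0 < y"
  shows "log_defect (f (Complex x0 y)) \<le> (\<integral>\<^sup>+s. log_defect (f (of_real s)) * ennreal (poisson_kernel y (s - x0)) \<partial>lborel)"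
proof -
  define c where "c = f (Complex x0 y)"
  have c: "cmod c < 1" using lt[of "Complex x0 y"] y by (simp add: c_def)
  have c2: "0 < 1 - (cmod c)\<^sup>2" using c by (simp add: abs_square_less_1)
  \<comment> \<open>Because \<open>|cnj c * f| \<le> |c| < 1\<close>, the argument of
    \<open>Ln\<close> stays in the right half plane and away from zero; \<open>Re F\<close> is
    bounded, as the Poisson formula requires.\<close>
  define F where "F = (\<lambda>z. - 2 * Ln (1 - cnj c * f z))"
  have cf: "cmod (cnj c * f z) \<le> cmod c" if "0 \<le> Im z" for z
    using lt[OF that] mult_left_mono[of "cmod (f z)" 1 "cmod c"] by (simp add: norm_mult)
  have Re_pos: "0 < Re (1 - cnj c * f z)" if "0 \<le> Im z" for z
    using cf[OF that] c complex_Re_le_cmod[of "cnj c * f z"] by simp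
  then have nonpos: "1 - cnj c * f z \<notin> \<real>\<^sub>\<le>\<^sub>0" if "0 \<le> Im z" for z
    using that by (fastforce simp: complex_nonpos_Reals_iff)
  have contF: "continuous_on {z. 0 \<le> Im z} F" unfolding F_def
    by (intro continuous_intros cont continuous_on_Ln) (use nonpos in auto)
  have holF: "F holomorphic_on {z. 0 < Im z}" unfolding F_def
    by (intro holomorphic_intros hol) (use nonpos in auto)
  have nz: "1 - cnj c * f z \<noteq> 0" if "0 \<le> Im z" for z using Re_pos[OF that] by (metis less_irrefl zero_complex.sel(1))
  have ReF: "Re (F z) = - 2 * ln (cmod (1 - cnj c * f z))" if "0 \<le> Im z" for z
    using nz[OF that] by (simp add: F_def)
  define M where "M = 2 * (\<bar>ln (1 - cmod c)\<bar> + ln 2)"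
  have bdd: "\<bar>Re (F z)\<bar> \<le> M" if "0 \<le> Im z" for z
  proof -
    have "1 - cmod c \<le> cmod (1 - cnj c * f z)" "cmod (1 - cnj c * f z) \<le> 2"
      using norm_triangle_ineq2[of 1 "cnj c * f z"] norm_triangle_ineq4[of 1 "cnj c * f z"] cf[OF that] c by auto
    then have "ln (1 - cmod c) \<le> ln (cmod (1 - cnj c * f z))" "ln (cmod (1 - cnj c * f z)) \<le> ln 2"
      using c nz[OF that] by (auto intro!: ln_mono)
    moreover have "0 \<le> ln (2::real)" by simp
    moreover have "\<bar>- 2 * x\<bar> \<le> 2 * (\<bar>m\<bar> + L)" if "m \<le> x" "x \<le> L" "0 \<le> L" for x m L :: real
    proof -
      have "\<bar>x\<bar> \<le> \<bar>m\<bar> + L" using that by linarith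
      then show ?thesis by simp
    qed
    ultimately show ?thesis unfolding ReF[OF that] M_def by blast
  qed
  define l where "l = ln (1 - (cmod c)\<^sup>2)"
  have z0: "0 \<le> Im (Complex x0 y)" using y by simp
  have "1 - cnj c * c = of_real (1 - (cmod c)\<^sup>2)"
    using complex_norm_square[of c] by (simp add: mult.commute)
  then have "cmod (1 - cnj c * c) = 1 - (cmod c)\<^sup>2" using c2 by (metis abs_of_pos norm_of_real)
  then have "Re (F (Complex x0 y)) = - 2 * l" unfolding ReF[OF z0] by (simp add: l_def flip: c_def)
  then have "- l = Re (F (Complex x0 y)) + l * 1" by simp
  also have "Re (F (Complex x0 y)) = (\<integral>s. Re (F (of_real s)) * poisson_kernel y (s - x0) \<partial>lborel)"
    by (rule poisson_bounded(2)[OF contF holF bdd y])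
  also have "1 = (\<integral>s. poisson_kernel y (s - x0) \<partial>lborel)"
    by (rule poisson_kernel_mass(2)[OF y, symmetric])
  also have "(\<integral>s. Re (F (of_real s)) * poisson_kernel y (s - x0) \<partial>lborel) + l * (\<integral>s. poisson_kernel y (s - x0) \<partial>lborel)
      = (\<integral>s. Re (F (of_real s)) * poisson_kernel y (s - x0) + l * poisson_kernel y (s - x0) \<partial>lborel)"
    unfolding integral_mult_right_zero[symmetric]
    by (intro Bochner_Integration.integral_add[symmetric] integrable_mult_right
          poisson_bounded(1)[OF contF holF bdd y] poisson_kernel_mass(1) y)
  finally have eq: "- l = (\<integral>s. (Re (F (of_real s)) + l) * poisson_kernel y (s - x0) \<partial>lborel)"
    by (simp add: distrib_right)
  have int: "integrable lborel (\<lambda>s. (Re (F (of_real s)) + l) * poisson_kernel y (s - x0))"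
    unfolding distrib_right
    by (intro Bochner_Integration.integrable_add integrable_mult_right poisson_bounded(1)[OF contF holF bdd y] poisson_kernel_mass(1) y)
  have "log_defect (f (Complex x0 y)) = ennreal (- l)"
    using c c2 by (simp add: log_defect_def l_def ln_div flip: c_def)
  also have "\<dots> \<le> (\<integral>\<^sup>+s. ennreal ((Re (F (of_real s)) + l) * poisson_kernel y (s - x0)) \<partial>lborel)"
    unfolding eq by (rule ennreal_integral_le_nn_integral[OF int])
  also have "\<dots> \<le> (\<integral>\<^sup>+s. log_defect (f (of_real s)) * ennreal (poisson_kernel y (s - x0)) \<partial>lborel)"
  proof (rule nn_integral_mono)
    fix s :: real
    define w where "w = f (of_real s)"
    have w: "cmod w < 1" using lt[of "of_real s"] by (simp add: w_def)
    then have w2: "0 < 1 - (cmod w)\<^sup>2" by (simp add: abs_square_less_1)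
    have "ln ((1 - (cmod c)\<^sup>2) * (1 - (cmod w)\<^sup>2)) \<le> ln ((cmod (1 - cnj c * w))\<^sup>2)"
      using disc_pairing_identity c2 w2 nz[of "of_real s"] by (intro ln_mono) (auto simp: w_def)
    then have "l + ln (1 - (cmod w)\<^sup>2) \<le> 2 * ln (cmod (1 - cnj c * w))"
      using c2 w2 nz[of "of_real s"] by (simp add: ln_mult l_def ln_realpow w_def)
    then have le: "Re (F (of_real s)) + l \<le> ln (1 / (1 - (cmod w)\<^sup>2))"
      using ReF[of "of_real s"] w2 by (simp add: ln_div w_def)
    have P: "0 \<le> poisson_kernel y (s - x0)" using y by (simp add: poisson_kernel_nonneg)
    have "0 \<le> ln (1 / (1 - (cmod w)\<^sup>2))" using w2 by (simp add: ln_div)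
    then have "ennreal ((Re (F (of_real s)) + l) * poisson_kernel y (s - x0)) \<le> ennreal (ln (1 / (1 - (cmod w)\<^sup>2))) * ennreal (poisson_kernel y (s - x0))"
      using mult_right_mono[OF le P] by (simp add: ennreal_leI flip: ennreal_mult''[OF P])
    then show "ennreal ((Re (F (of_real s)) + l) * poisson_kernel y (s - x0)) \<le> log_defect (f (of_real s)) * ennreal (poisson_kernel y (s - x0))"
      using w by (simp add: log_defect_def flip: w_def)
  qed
  finally show ?thesis .
qed

text \<open>The real part of \<open>\<i> / (pi (z + \<i>))\<close> at \<open>Complex x y\<close> is
  the Poisson kernel of height \<open>1 + y\<close>. Its Poisson representation shows that kernels
  of heights \<open>h\<close> and 1 convolve to the kernel of height \<open>1 + h\<close>, which is
  at most \<open>1 + h\<close> times that of height 1.\<close>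

lemma poisson_kernel_semigroup_le:
  assumes h: "0 < h"
  shows "(\<integral>\<^sup>+x. ennreal (poisson_kernel h (s - x)) * ennreal (poisson_kernel 1 x) \<partial>lborel) \<le> ennreal (1 + h) * ennreal (poisson_kernel 1 s)"
proof -
  define g where "g = (\<lambda>z. \<i> / (of_real pi * (z + \<i>)))"
  have nz: "z + \<i> \<noteq> 0" if "0 \<le> Im z" for z using that by (auto simp: complex_eq_iff)
  have g: "continuous_on {z. 0 \<le> Im z} g" "g holomorphic_on {z. 0 < Im z}"
    unfolding g_def using nz by (auto intro!: continuous_intros holomorphic_intros)
  have b: "\<bar>Re (g z)\<bar> \<le> 1 / pi" if "0 \<le> Im z" for z
  proof -
    have "1 \<le> cmod (z + \<i>)" using abs_Im_le_cmod[of "z + \<i>"] that by simp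
    then have "cmod (g z) \<le> 1 / pi" by (simp add: g_def norm_divide norm_mult divide_simps)
    then show ?thesis using abs_Re_le_cmod[of "g z"] by linarith
  qed
  have Re_g: "Re (g (Complex x y)) = poisson_kernel (1 + y) x" for x y
  proof -
    have "Complex x y + \<i> = Complex x (1 + y)" by (simp add: complex_eq_iff)
    then have "g (Complex x y) = of_real (1 / pi) * (\<i> / Complex x (1 + y))" by (simp add: g_def)
    then have "Re (g (Complex x y)) = 1 / pi * Re (\<i> / Complex x (1 + y))"
      by (simp only: times_complex.sel Re_complex_of_real Im_complex_of_real mult_zero_left diff_zero)
    also have "Re (\<i> / Complex x (1 + y)) = (1 + y) / (x\<^sup>2 + (1 + y)\<^sup>2)" by (simp add: Re_divide)
    finally show ?thesis by (simp add: poisson_kernel_def)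
  qed
  have e: "Re (g (of_real x)) * poisson_kernel h (x - s) = poisson_kernel h (s - x) * poisson_kernel 1 x" for x
  proof -
    have "Re (g (of_real x)) = poisson_kernel 1 x" using Re_g[of x 0] by (simp add: complex_of_real_def)
    then show ?thesis by (simp add: poisson_kernel_def power2_commute)
  qed
  have nn: "0 \<le> poisson_kernel h (s - x) * poisson_kernel 1 x" for x using h by (simp add: poisson_kernel_nonneg)
  have "(\<integral>\<^sup>+x. ennreal (poisson_kernel h (s - x)) * ennreal (poisson_kernel 1 x) \<partial>lborel) = (\<integral>\<^sup>+x. ennreal (poisson_kernel h (s - x) * poisson_kernel 1 x) \<partial>lborel)"
    using h by (intro nn_integral_cong) (simp add: ennreal_mult poisson_kernel_nonneg)
  also have "\<dots> = ennreal (\<integral>x. poisson_kernel h (s - x) * poisson_kernel 1 x \<partial>lborel)"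
    using poisson_bounded(1)[OF g b h, of s] nn unfolding e by (intro nn_integral_eq_integral) auto
  also have "(\<integral>x. poisson_kernel h (s - x) * poisson_kernel 1 x \<partial>lborel) = poisson_kernel (1 + h) s"
    using poisson_bounded(2)[OF g b h, of s] unfolding e Re_g by simp
  also have "poisson_kernel (1 + h) s \<le> (1 + h) * poisson_kernel 1 s"
  proof -
    have "s\<^sup>2 + 1 \<le> s\<^sup>2 + (1 + h)\<^sup>2" using h by (simp add: power2_eq_square algebra_simps)
    moreover have "0 < s\<^sup>2 + 1" "0 < s\<^sup>2 + (1 + h)\<^sup>2" using h by (auto simp: add_nonneg_pos)
    ultimately have "1 / (s\<^sup>2 + (1 + h)\<^sup>2) \<le> 1 / (s\<^sup>2 + 1)" by (intro divide_left_mono) auto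
    then have "(1 + h) / pi * (1 / (s\<^sup>2 + (1 + h)\<^sup>2)) \<le> (1 + h) / pi * (1 / (s\<^sup>2 + 1))"
      using h by (intro mult_left_mono) auto
    then show ?thesis by (simp add: poisson_kernel_def)
  qed
  finally show ?thesis using h by (simp add: ennreal_leI ennreal_mult poisson_kernel_nonneg)
qed

text \<open>Subharmonicity at each point of the line at height \<open>h\<close>, integrated against
  the kernel of height 1, with Tonelli and the semigroup bound. The factor \<open>1 + h\<close>
  disappears when \<open>h\<close> tends to 0.\<close>

lemma log_defect_mean_le:
  assumes cont: "continuous_on {z. 0 \<le> Im z} f" and hol: "f holomorphic_on {z. 0 < Im z}"
    and lt: "\<And>z. 0 \<le> Im z \<Longrightarrow> cmod (f z) < 1" and h: "0 < h"
  shows "(\<integral>\<^sup>+x. log_defect (f (Complex x h)) * ennreal (poisson_kernel 1 x) \<partial>lborel)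
    \<le> ennreal (1 + h) * (\<integral>\<^sup>+x. log_defect (f (of_real x)) * ennreal (poisson_kernel 1 x) \<partial>lborel)"
proof -
  have "continuous_on UNIV (\<lambda>x. f (of_real x))"
    by (rule continuous_on_compose2[OF cont]) (auto intro!: continuous_intros)
  then have [measurable]: "(\<lambda>x. f (of_real x)) \<in> borel_measurable borel" by (rule borel_measurable_continuous_onI)
  have [measurable]: "(\<lambda>x. log_defect (f (of_real x))) \<in> borel_measurable borel" by measurable
  have "(\<integral>\<^sup>+x. log_defect (f (Complex x h)) * ennreal (poisson_kernel 1 x) \<partial>lborel)
    \<le> (\<integral>\<^sup>+x. (\<integral>\<^sup>+s. log_defect (f (of_real s)) * ennreal (poisson_kernel h (s - x)) \<partial>lborel) * ennreal (poisson_kernel 1 x) \<partial>lborel)"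
    by (intro nn_integral_mono mult_right_mono log_defect_subharmonic assms) auto
  also have "\<dots> = (\<integral>\<^sup>+x. (\<integral>\<^sup>+s. log_defect (f (of_real s)) * (ennreal (poisson_kernel h (s - x)) * ennreal (poisson_kernel 1 x)) \<partial>lborel) \<partial>lborel)"
    by (intro nn_integral_cong) (simp add: nn_integral_multc[symmetric] mult.assoc)
  also have "\<dots> = (\<integral>\<^sup>+s. (\<integral>\<^sup>+x. log_defect (f (of_real s)) * (ennreal (poisson_kernel h (s - x)) * ennreal (poisson_kernel 1 x)) \<partial>lborel) \<partial>lborel)"
    by (rule lborel_pair.Fubini') measurable
  also have "\<dots> = (\<integral>\<^sup>+s. log_defect (f (of_real s)) * (\<integral>\<^sup>+x. ennreal (poisson_kernel h (s - x)) * ennreal (poisson_kernel 1 x) \<partial>lborel) \<partial>lborel)"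
    by (intro nn_integral_cong) (simp add: nn_integral_cmult)
  also have "\<dots> \<le> (\<integral>\<^sup>+s. log_defect (f (of_real s)) * (ennreal (1 + h) * ennreal (poisson_kernel 1 s)) \<partial>lborel)"
    by (intro nn_integral_mono mult_left_mono poisson_kernel_semigroup_le h) auto
  also have "\<dots> = ennreal (1 + h) * (\<integral>\<^sup>+x. log_defect (f (of_real x)) * ennreal (poisson_kernel 1 x) \<partial>lborel)"
    by (simp add: nn_integral_cmult[symmetric] mult_ac)
  finally show ?thesis .
qed

section \<open>Weyl discs\<close>

locale canonical_system = canonical_coefficients +
  fixes a11 a12 a21 a22 :: "complex \<Rightarrow> real \<Rightarrow> complex"
  assumes row1: "\<And>z. row_solution z (a11 z) (a12 z)" and init1: "\<And>z. a11 z 0 = 1" "\<And>z. a12 z 0 = 0"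
    and row2: "\<And>z. row_solution z (a21 z) (a22 z)" and init2: "\<And>z. a21 z 0 = 0" "\<And>z. a22 z 0 = 1"
    and infinite_trace: "filterlim (\<lambda>T. integral {0..T} a) at_top at_top"
begin

lemma parametrized1: "parametrized_solution a b a11 a12 1 0"
  by unfold_locales (auto intro: row1 init1)

lemma parametrized2: "parametrized_solution a b a21 a22 0 1"
  by unfold_locales (auto intro: row2 init2)

lemma holomorphic_entries:
  assumes "0 \<le> T"
  shows "(\<lambda>z. a11 z T) holomorphic_on S" "(\<lambda>z. a12 z T) holomorphic_on S"
    "(\<lambda>z. a21 z T) holomorphic_on S" "(\<lambda>z. a22 z T) holomorphic_on S"
  using parametrized_solution.holomorphic_in_parameter[OF parametrized1 assms]
    parametrized_solution.holomorphic_in_parameter[OF parametrized2 assms] by auto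

lemma isCont_entries:
  assumes "0 \<le> T"
  shows "isCont (\<lambda>z. a11 z T) z" "isCont (\<lambda>z. a12 z T) z" "isCont (\<lambda>z. a21 z T) z" "isCont (\<lambda>z. a22 z T) z"
  using holomorphic_entries[OF assms, of UNIV]
  by (auto dest!: holomorphic_on_imp_continuous_on simp: continuous_on_eq_continuous_at)

lemma det_one:
  assumes "0 \<le> T" shows "a11 z T * a22 z T - a21 z T * a12 z T = 1"
  using row_solution_det[OF row1[of z] row2[of z] assms] init1 init2 by simp

lemma a22_energy:
  assumes "0 \<le> Im z" "0 \<le> T" shows "1 \<le> (cmod (a22 z T))\<^sup>2 - (cmod (a21 z T))\<^sup>2"
  using energy_mono[OF row2[of z] assms(1) order_refl assms(2)] init2 by simp

lemma a22_ge:
  assumes "0 \<le> Im z" "0 \<le> T"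
  shows "1 \<le> cmod (a22 z T)" "cmod (a21 z T) < cmod (a22 z T)" "a22 z T \<noteq> 0"
proof -
  have "1\<^sup>2 \<le> (cmod (a22 z T))\<^sup>2" "(cmod (a21 z T))\<^sup>2 < (cmod (a22 z T))\<^sup>2"
    using a22_energy[OF assms] zero_le_power2[of "cmod (a21 z T)"] unfolding one_power2 by linarith+
  then show "1 \<le> cmod (a22 z T)" "cmod (a21 z T) < cmod (a22 z T)" by (auto intro: power2_le_imp_le power2_less_imp_less)
  then show "a22 z T \<noteq> 0" by auto
qed

text \<open>Together with \<open>Qw\<close> this is the row \<open>(1, - w)\<close> times the matrix
  solution, hence itself a row solution. The parameter \<open>e\<close> that the Moebius
  transformation sends to \<open>w\<close> is \<open>- Qw / Pw\<close>.\<close>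

definition Pw :: "real \<Rightarrow> complex \<Rightarrow> complex \<Rightarrow> complex"
  where "Pw T z w = a11 z T - w * a21 z T"

definition Qw :: "real \<Rightarrow> complex \<Rightarrow> complex \<Rightarrow> complex"
  where "Qw T z w = a12 z T - w * a22 z T"

lemma PQ_row_solution: "row_solution z (\<lambda>T. Pw T z w) (\<lambda>T. Qw T z w)"
  using row_solution_lincomb[OF row1[of z] row2[of z], of 1 "- w"] by (simp add: Pw_def Qw_def)

lemma PQ_mono:
  "\<lbrakk>0 \<le> Im z; 0 \<le> s; s \<le> t\<rbrakk> \<Longrightarrow>
    (cmod (Qw s z w))\<^sup>2 - (cmod (Pw s z w))\<^sup>2 \<le> (cmod (Qw t z w))\<^sup>2 - (cmod (Pw t z w))\<^sup>2"
  using energy_mono[OF PQ_row_solution[of z w]] by blast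

lemma PQ_energy:
  assumes "0 \<le> Im z" "0 \<le> T"
  shows "(cmod w)\<^sup>2 - 1 \<le> (cmod (Qw T z w))\<^sup>2 - (cmod (Pw T z w))\<^sup>2"
  using PQ_mono[OF assms(1) order_refl assms(2), of w] by (simp add: Pw_def Qw_def init1 init2)

lemma PQ_energy_real:
  assumes "0 \<le> T"
  shows "(cmod w)\<^sup>2 - 1 = (cmod (Qw T (of_real x) w))\<^sup>2 - (cmod (Pw T (of_real x) w))\<^sup>2"
  using energy_const[OF PQ_row_solution[of "of_real x" w] _ assms] by (simp add: Pw_def Qw_def init1 init2)

lemma PQ_det:
  assumes "0 \<le> T" shows "Pw T z w * a22 z T - Qw T z w * a21 z T = 1"
  using det_one[OF assms, of z] by (simp add: Pw_def Qw_def algebra_simps)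

text \<open>For \<open>Im z \<ge> 0\<close> and \<open>T \<ge> 0\<close> this is the image of the
  closed unit disc under the Moebius transformation of the matrix at time \<open>T\<close>. Written
  as an inequality, its monotonicity in \<open>T\<close> becomes the monotonicity of the
  energy.\<close>

definition weyl_disc :: "real \<Rightarrow> complex \<Rightarrow> complex set"
  where "weyl_disc T z = {w. cmod (Qw T z w) \<le> cmod (Pw T z w)}"

lemma weyl_disc_antimono:
  assumes "0 \<le> Im z" "0 \<le> s" "s \<le> t" shows "weyl_disc t z \<subseteq> weyl_disc s z"
proof
  fix w assume "w \<in> weyl_disc t z"
  then have "(cmod (Qw t z w))\<^sup>2 \<le> (cmod (Pw t z w))\<^sup>2" by (simp add: weyl_disc_def power_mono)
  then have "(cmod (Qw s z w))\<^sup>2 \<le> (cmod (Pw s z w))\<^sup>2" using PQ_mono[OF assms, of w] by linarith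
  then have "cmod (Qw s z w) \<le> cmod (Pw s z w)" by (rule power2_le_imp_le) simp
  then show "w \<in> weyl_disc s z" by (simp add: weyl_disc_def)
qed

lemma closed_weyl_disc: "closed (weyl_disc T z)"
  unfolding weyl_disc_def Pw_def Qw_def by (intro closed_Collect_le continuous_intros)

lemma weyl_disc_cmod_le:
  assumes "0 \<le> Im z" "0 \<le> T" "w \<in> weyl_disc T z" shows "cmod w \<le> 1"
  using weyl_disc_antimono[OF assms(1) order_refl assms(2)] assms(3) by (auto simp: weyl_disc_def Pw_def Qw_def init1 init2)

definition transform :: "real \<Rightarrow> complex \<Rightarrow> complex \<Rightarrow> complex"
  where "transform T e z = (a11 z T * e + a12 z T) / (a21 z T * e + a22 z T)"

lemma transform_denominator:
  assumes "0 \<le> Im z" "0 \<le> T" "cmod e \<le> 1" shows "a21 z T * e + a22 z T \<noteq> 0"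
proof
  assume "a21 z T * e + a22 z T = 0"
  then have "a22 z T = - (a21 z T * e)" by (simp add: eq_neg_iff_add_eq_0 add.commute)
  then have "cmod (a22 z T) = cmod (a21 z T) * cmod e" by (simp add: norm_mult)
  also have "\<dots> \<le> cmod (a21 z T)" using assms(3) by (simp add: mult_left_le)
  finally show False using a22_ge(2)[OF assms(1,2)] by simp
qed

lemma transform_PQ:
  assumes "0 \<le> Im z" "0 \<le> T" "cmod e \<le> 1"
  shows "Pw T z (transform T e z) = 1 / (a21 z T * e + a22 z T)" "Qw T z (transform T e z) = - e / (a21 z T * e + a22 z T)"
proof -
  define d where "d = a21 z T * e + a22 z T"
  have d: "d \<noteq> 0" using transform_denominator[OF assms] by (simp add: d_def)
  have "Pw T z (transform T e z) = (a11 z T * d - (a11 z T * e + a12 z T) * a21 z T) / d"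
    using d by (simp add: Pw_def transform_def diff_divide_distrib flip: d_def)
  also have "a11 z T * d - (a11 z T * e + a12 z T) * a21 z T = 1"
    using det_one[OF assms(2), of z] by (simp add: d_def algebra_simps)
  finally show "Pw T z (transform T e z) = 1 / (a21 z T * e + a22 z T)" by (simp add: d_def)
  have "Qw T z (transform T e z) = (a12 z T * d - (a11 z T * e + a12 z T) * a22 z T) / d"
    using d by (simp add: Qw_def transform_def diff_divide_distrib flip: d_def)
  also have "a12 z T * d - (a11 z T * e + a12 z T) * a22 z T = - e * (a11 z T * a22 z T - a21 z T * a12 z T)"
    by (simp add: d_def algebra_simps)
  finally show "Qw T z (transform T e z) = - e / (a21 z T * e + a22 z T)"
    unfolding det_one[OF assms(2)] by (simp add: d_def)
qed

lemma transform_in_weyl_disc: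
  assumes "0 \<le> Im z" "0 \<le> T" "cmod e \<le> 1" shows "transform T e z \<in> weyl_disc T z"
  using transform_PQ[OF assms] assms(3) by (simp add: weyl_disc_def norm_divide divide_right_mono)

text \<open>The pseudohyperbolic distance of \<open>z\<close> from \<open>\<i>\<close>.\<close>

definition rho :: "complex \<Rightarrow> real"
  where "rho z = cmod ((z - \<i>) / (z + \<i>))"

lemma rho_bounds:
  assumes "0 < Im z" shows "0 \<le> rho z" "rho z < 1"
proof -
  have "cmod (z - \<i>) < cmod (z + \<i>)" using assms by (simp add: cmod_def power2_eq_square algebra_simps)
  then show "0 \<le> rho z" "rho z < 1" by (auto simp: rho_def norm_divide divide_less_eq)
qed

text \<open>The quotient \<open>a21 / a22\<close> maps the half plane into the unit disc and
  vanishes at \<open>\<i>\<close>.\<close>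

lemma a21_a22_schwarz:
  assumes z: "0 < Im z" and T: "0 \<le> T"
  shows "cmod (a21 z T) \<le> rho z * cmod (a22 z T)"
proof -
  have nz: "a22 z T \<noteq> 0" if "0 < Im z" for z using a22_ge(3)[of z T] that T by simp
  have "cmod (a21 z T / a22 z T) \<le> rho z"
    unfolding rho_def
  proof (rule schwarz_half_plane[OF _ _ _ z, of "\<lambda>z. a21 z T / a22 z T"])
    show "(\<lambda>z. a21 z T / a22 z T) holomorphic_on {z. 0 < Im z}"
      using nz by (intro holomorphic_intros holomorphic_entries T) auto
    show "cmod (a21 z T / a22 z T) < 1" if "0 < Im z" for z
      using a22_ge[of z T] that T by (simp add: norm_divide)
    show "a21 \<i> T / a22 \<i> T = 0"
      using row_solution_zero_at_i(1)[OF row2 init2(1) init2(2) T] by simp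
  qed
  then show ?thesis using nz[OF z] by (simp add: norm_divide divide_le_eq)
qed

text \<open>Harnack's inequality for \<open>ln |a22| + 1\<close>, whose value at \<open>\<i>\<close>
  is the integral of \<open>a\<close> plus 1. The added 1 supplies strict positivity, since
  \<open>ln |a22|\<close> is only known to be nonnegative.\<close>

lemma a22_growth:
  assumes z: "0 < Im z" and T: "0 \<le> T"
  shows "(integral {0..T} a + 1) * ((1 - rho z) / (1 + rho z)) \<le> ln (cmod (a22 z T)) + 1"
proof -
  have nz: "a22 z T \<noteq> 0" if "0 < Im z" for z using a22_ge(3)[of z T] that T by simp
  have "open {z. 0 < Im z}" "convex {z. 0 < Im z}" by (auto simp: open_halfspace_Im_gt convex_halfspace_Im_gt)
  then obtain g where g: "g holomorphic_on {z. 0 < Im z}" "\<And>z. 0 < Im z \<Longrightarrow> a22 z T = exp (g z)"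
    using simply_connected_eq_holomorphic_log[of "{z. 0 < Im z}"] holomorphic_entries(4)[OF T] nz
      convex_imp_simply_connected by (metis (no_types, lifting) mem_Collect_eq)
  have Re_g: "Re (g z) = ln (cmod (a22 z T))" if "0 < Im z" for z using g(2)[OF that] by simp
  have "Re (g \<i> + 1) * ((1 - rho z) / (1 + rho z)) \<le> Re (g z + 1)"
    unfolding rho_def
  proof (rule harnack_half_plane[OF _ _ z])
    show "(\<lambda>z. g z + 1) holomorphic_on {z. 0 < Im z}" by (intro holomorphic_intros g)
    show "0 < Re (g z + 1)" if "0 < Im z" for z
      using a22_ge(1)[of z T] that T Re_g[OF that] by (simp add: add_nonneg_pos)
  qed
  moreover have "Re (g \<i>) = integral {0..T} a"
    using row_solution_zero_at_i(2)[OF row2 init2(1) init2(2) T] Re_g[of \<i>] by simp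
  ultimately show ?thesis using Re_g[OF z] by simp
qed

text \<open>A convenient upper bound for the size of the Weyl disc rather than its exact
  radius.\<close>

definition radius :: "real \<Rightarrow> complex \<Rightarrow> real"
  where "radius T z = 1 / (cmod (a22 z T) * (1 - rho z))"

text \<open>From \<open>P a22 - Q a21 = 1\<close>, \<open>|Q| \<le> |P|\<close> and
  \<open>|a21| \<le> rho |a22|\<close> follows \<open>|P| |a22| (1 - rho) \<le> 1\<close>. The
  deviation from the image of 0 is \<open>|Q| / |a22|\<close>, which is at most
  \<open>|P|\<close>.\<close>

lemma weyl_disc_center:
  assumes z: "0 < Im z" and T: "0 \<le> T" and w: "w \<in> weyl_disc T z"
  shows "cmod (w - a12 z T / a22 z T) \<le> radius T z"
proof -
  have a22: "1 \<le> cmod (a22 z T)" "a22 z T \<noteq> 0" using a22_ge[of z T] z T by auto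
  define r where "r = rho z"
  have r: "0 \<le> r" "r < 1" using rho_bounds[OF z] by (auto simp: r_def)
  define P where "P = cmod (Pw T z w)"
  have QP: "cmod (Qw T z w) \<le> P" using w by (simp add: weyl_disc_def P_def)
  have "P * cmod (a22 z T) - P * (r * cmod (a22 z T)) \<le> 1"
  proof -
    have "cmod (Qw T z w) * cmod (a21 z T) \<le> P * (r * cmod (a22 z T))"
      using QP a21_a22_schwarz[OF z T] by (intro mult_mono) (auto simp: r_def P_def)
    moreover have "P * cmod (a22 z T) - cmod (Qw T z w) * cmod (a21 z T) \<le> cmod (Pw T z w * a22 z T - Qw T z w * a21 z T)"
      using norm_triangle_ineq2[of "Pw T z w * a22 z T" "Qw T z w * a21 z T"] by (simp add: norm_mult P_def)
    ultimately show ?thesis unfolding PQ_det[OF T] by simp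
  qed
  then have "P * (cmod (a22 z T) * (1 - r)) \<le> 1" by (simp add: algebra_simps)
  moreover have "0 < cmod (a22 z T) * (1 - r)" using a22 r by simp
  ultimately have P: "P \<le> radius T z" by (simp add: radius_def r_def pos_le_divide_eq)
  have "w - a12 z T / a22 z T = - Qw T z w / a22 z T" using a22(2) by (simp add: Qw_def field_simps)
  then have "cmod (w - a12 z T / a22 z T) = cmod (Qw T z w) / cmod (a22 z T)" by (simp add: norm_divide)
  also have "\<dots> \<le> cmod (Qw T z w) / 1" using a22(1) by (intro divide_left_mono) auto
  also have "\<dots> \<le> radius T z" using QP P by simp
  finally show ?thesis .
qed

lemma weyl_disc_diameter:
  assumes "0 < Im z" "0 \<le> T" "w \<in> weyl_disc T z" "w' \<in> weyl_disc T z"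
  shows "cmod (w - w') \<le> 2 * radius T z"
  using weyl_disc_center[OF assms(1,2,3)] weyl_disc_center[OF assms(1,2,4)]
    norm_triangle_ineq4[of "w - a12 z T / a22 z T" "w' - a12 z T / a22 z T"] by simp

text \<open>The bound depends on \<open>z\<close> only through \<open>r0\<close>, so it is uniform
  on sets where \<open>rho\<close> is at most \<open>r0\<close>.\<close>

lemma radius_bound:
  assumes z: "0 < Im z" and T: "0 \<le> T" and r0: "rho z \<le> r0" "r0 < 1"
  shows "radius T z \<le> exp (1 - (integral {0..T} a + 1) * ((1 - r0) / (1 + r0))) / (1 - r0)"
proof -
  have r: "0 \<le> rho z" using rho_bounds[OF z] by simp
  have a22: "1 \<le> cmod (a22 z T)" using a22_ge[of z T] z T by auto
  have I: "0 \<le> integral {0..T} a" by (rule integral_a_nonneg)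
  have "(1 - r0) / (1 + r0) \<le> (1 - rho z) / (1 + rho z)" using r0 r by (intro frac_le) auto
  then have "(integral {0..T} a + 1) * ((1 - r0) / (1 + r0)) \<le> (integral {0..T} a + 1) * ((1 - rho z) / (1 + rho z))"
    using I by (intro mult_left_mono) auto
  then have "(integral {0..T} a + 1) * ((1 - r0) / (1 + r0)) - 1 \<le> ln (cmod (a22 z T))"
    using a22_growth[OF z T] by linarith
  then have "exp ((integral {0..T} a + 1) * ((1 - r0) / (1 + r0)) - 1) \<le> exp (ln (cmod (a22 z T)))" by simp
  then have le: "exp ((integral {0..T} a + 1) * ((1 - r0) / (1 + r0)) - 1) \<le> cmod (a22 z T)"
  proof -
    have "exp (ln (cmod (a22 z T))) = cmod (a22 z T)" using a22 by (intro exp_ln) linarith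
    then show ?thesis using \<open>exp _ \<le> exp (ln (cmod (a22 z T)))\<close> by (simp only:)
  qed
  have "radius T z \<le> 1 / (exp ((integral {0..T} a + 1) * ((1 - r0) / (1 + r0)) - 1) * (1 - r0))"
    unfolding radius_def using le r0 r by (intro divide_left_mono mult_mono mult_pos_pos) auto
  also have "\<dots> = exp (1 - (integral {0..T} a + 1) * ((1 - r0) / (1 + r0))) / (1 - r0)"
  proof -
    have "1 / (exp (A - 1) * c) = exp (1 - A) / c" for A c :: real
    proof -
      have "exp (1 - A) = inverse (exp (A - 1))" by (simp flip: exp_minus)
      then show ?thesis by (simp add: divide_inverse)
    qed
    then show ?thesis .
  qed
  finally show ?thesis .
qed

lemma radius_bound_tendsto:
  assumes r0: "0 \<le> r0" "r0 < 1"
  shows "((\<lambda>T. exp (1 - (integral {0..T} a + 1) * ((1 - r0) / (1 + r0))) / (1 - r0)) \<longlongrightarrow> 0) at_top"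
proof -
  define c where "c = (1 - r0) / (1 + r0)"
  have c: "0 < c" using r0 by (simp add: c_def)
  have "((\<lambda>x. exp (1 - (x + 1) * c)) \<longlongrightarrow> 0) at_top" using c by real_asymp
  then have "((\<lambda>T. exp (1 - (integral {0..T} a + 1) * c)) \<longlongrightarrow> 0) at_top"
    by (rule filterlim_compose[OF _ infinite_trace])
  then have "((\<lambda>T. exp (1 - (integral {0..T} a + 1) * c) / (1 - r0)) \<longlongrightarrow> 0 / (1 - r0)) at_top"
    using r0 by (intro tendsto_intros) auto
  then show ?thesis by (simp add: c_def)
qed

lemma radius_nonneg: "0 < Im z \<Longrightarrow> 0 \<le> radius T z"
  using rho_bounds[of z] by (simp add: radius_def)

lemma radius_tendsto:
  assumes z: "0 < Im z" shows "((\<lambda>T. radius T z) \<longlongrightarrow> 0) at_top"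
proof (rule tendsto_sandwich[OF _ _ tendsto_const radius_bound_tendsto[OF rho_bounds[OF z]]])
  show "\<forall>\<^sub>F T in at_top. 0 \<le> radius T z" using radius_nonneg[OF z] by simp
  show "\<forall>\<^sub>F T in at_top. radius T z \<le> exp (1 - (integral {0..T} a + 1) * ((1 - rho z) / (1 + rho z))) / (1 - rho z)"
    using eventually_ge_at_top[of 0]
    by eventually_elim (rule radius_bound[OF z _ order_refl rho_bounds(2)[OF z]])
qed

lemma weyl_point_exists:
  assumes z: "0 < Im z"
  shows "\<exists>w. \<forall>T\<ge>0. w \<in> weyl_disc T z"
proof -
  define X where "X = (\<lambda>n::nat. transform (real n) 0 z)"
  have X: "X m \<in> weyl_disc (real n) z" if "n \<le> m" for m n
    using transform_in_weyl_disc[of z "real m" 0] weyl_disc_antimono[of z "real n" "real m"] that z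
    by (auto simp: X_def)
  have "Cauchy X"
  proof (rule metric_CauchyI)
    fix e :: real assume e: "0 < e"
    have "(\<lambda>n. radius (real n) z) \<longlonglongrightarrow> 0"
      by (rule filterlim_compose[OF radius_tendsto[OF z] filterlim_real_sequentially])
    then have "\<forall>\<^sub>F n in sequentially. radius (real n) z < e / 2" using e by (intro order_tendstoD(2)) auto
    then obtain N where N: "radius (real N) z < e / 2" by (auto simp: eventually_sequentially)
    show "\<exists>M. \<forall>m\<ge>M. \<forall>n\<ge>M. dist (X m) (X n) < e"
      using weyl_disc_diameter[OF z _ X X, of N] N by (intro exI[of _ N]) (fastforce simp: dist_norm)
  qed
  obtain w where w: "X \<longlonglongrightarrow> w" using \<open>Cauchy X\<close> by (metis Cauchy_convergent convergent_def)
  have "w \<in> weyl_disc T z" if T: "0 \<le> T" for T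
  proof (rule Lim_in_closed_set[OF closed_weyl_disc _ _ w])
    show "\<forall>\<^sub>F n in sequentially. X n \<in> weyl_disc T z"
      using eventually_ge_at_top[of "nat \<lceil>T\<rceil>"]
    proof eventually_elim
      case (elim n)
      then have "T \<le> real n" by linarith
      then show ?case using X[of n n] weyl_disc_antimono[of z T "real n"] T z by auto
    qed
  qed simp
  then show ?thesis by blast
qed

text \<open>For \<open>Im z > 0\<close> the diameters of the discs tend to zero, so the point is
  unique; nothing is claimed for other \<open>z\<close>.\<close>

definition weyl :: "complex \<Rightarrow> complex"
  where "weyl z = (SOME w. \<forall>T\<ge>0. w \<in> weyl_disc T z)"

lemma weyl_in_disc: "\<lbrakk>0 < Im z; 0 \<le> T\<rbrakk> \<Longrightarrow> weyl z \<in> weyl_disc T z"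
  unfolding weyl_def using someI_ex[OF weyl_point_exists[of z]] by blast

lemma cmod_weyl_le: "0 < Im z \<Longrightarrow> cmod (weyl z) \<le> 1"
  using weyl_disc_cmod_le[OF _ order_refl weyl_in_disc, of z] by simp

lemma transform_tendsto:
  assumes z: "0 < Im z" and e: "cmod e \<le> 1"
  shows "((\<lambda>T. transform T e z) \<longlongrightarrow> weyl z) at_top"
proof -
  have "((\<lambda>T. 2 * radius T z) \<longlongrightarrow> 2 * 0) at_top" by (intro tendsto_intros radius_tendsto z)
  then have "((\<lambda>T. 2 * radius T z) \<longlongrightarrow> 0) at_top" by simp
  then have "((\<lambda>T. transform T e z - weyl z) \<longlongrightarrow> 0) at_top"
  proof (rule Lim_null_comparison[rotated])
    show "\<forall>\<^sub>F T in at_top. norm (transform T e z - weyl z) \<le> 2 * radius T z"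
      using eventually_ge_at_top[of 0]
      by eventually_elim (use z e in \<open>auto intro!: weyl_disc_diameter transform_in_weyl_disc weyl_in_disc\<close>)
  qed
  then show ?thesis by (simp add: LIM_zero_iff)
qed

lemma holomorphic_transform:
  assumes T: "0 \<le> T" shows "transform T 0 holomorphic_on {z. 0 < Im z}" "continuous_on {z. 0 \<le> Im z} (transform T 0)"
proof -
  have "transform T 0 = (\<lambda>z. a12 z T / a22 z T)" by (simp add: transform_def fun_eq_iff)
  moreover have nz: "a22 z T \<noteq> 0" if "0 \<le> Im z" for z using a22_ge(3)[OF that T] .
  ultimately show "transform T 0 holomorphic_on {z. 0 < Im z}" "continuous_on {z. 0 \<le> Im z} (transform T 0)"
    by (auto intro!: holomorphic_intros holomorphic_entries T continuous_intros holomorphic_on_imp_continuous_on)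
qed

text \<open>On a compact disc \<open>rho\<close> attains a maximum below 1, so the radius bound
  makes the convergence of the truncated functions uniform there.\<close>

lemma holomorphic_weyl: "weyl holomorphic_on {z. 0 < Im z}"
proof (rule holomorphic_uniform_sequence[of _ "\<lambda>n::nat. transform (real n) 0"])
  show op: "open {z. 0 < Im z}" by (rule open_halfspace_Im_gt)
  show "transform (real n) 0 holomorphic_on {z. 0 < Im z}" for n by (rule holomorphic_transform) simp
  fix x assume "x \<in> {z. 0 < Im z}"
  then obtain d where d: "0 < d" "cball x d \<subseteq> {z. 0 < Im z}" using op open_contains_cball by metis
  have nz: "z + \<i> \<noteq> 0" if "z \<in> cball x d" for z
  proof
    assume "z + \<i> = 0"
    then have "Im (z + \<i>) = 0" by (simp only: zero_complex.sel)
    moreover have "0 < Im z" using subsetD[OF d(2) that] by simp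
    ultimately show False by simp
  qed
  have "continuous_on (cball x d) rho" unfolding rho_def
    using nz by (intro continuous_intros) simp
  then obtain y where y: "y \<in> cball x d" "\<And>z. z \<in> cball x d \<Longrightarrow> rho z \<le> rho y"
    using continuous_attains_sup[of "cball x d" rho] d(1) by auto
  have r0: "0 \<le> rho y" "rho y < 1" using rho_bounds[of y] y(1) d(2) by auto
  define R where "R = (\<lambda>T. exp (1 - (integral {0..T} a + 1) * ((1 - rho y) / (1 + rho y))) / (1 - rho y))"
  have "(\<lambda>n. R (real n)) \<longlonglongrightarrow> 0" unfolding R_def
    by (rule filterlim_compose[OF radius_bound_tendsto[OF r0] filterlim_real_sequentially])
  have "uniform_limit (cball x d) (\<lambda>n. transform (real n) 0) weyl sequentially"
  proof (rule uniform_limitI)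
    fix e :: real assume e: "0 < e"
    have "\<forall>\<^sub>F n in sequentially. R (real n) < e / 2"
      using \<open>(\<lambda>n. R (real n)) \<longlonglongrightarrow> 0\<close> e by (intro order_tendstoD(2)) auto
    then show "\<forall>\<^sub>F n in sequentially. \<forall>z\<in>cball x d. dist (transform (real n) 0 z) (weyl z) < e"
    proof eventually_elim
      case (elim n)
      show ?case
      proof
        fix z assume z: "z \<in> cball x d"
        then have z': "0 < Im z" using d(2) by auto
        have "cmod (transform (real n) 0 z - weyl z) \<le> 2 * radius (real n) z"
          using z' by (intro weyl_disc_diameter transform_in_weyl_disc weyl_in_disc) auto
        also have "\<dots> \<le> 2 * R (real n)" unfolding R_def
          using radius_bound[OF z' _ y(2)[OF z] r0(2), of "real n"] by simp
        finally show "dist (transform (real n) 0 z) (weyl z) < e" using elim by (simp add: dist_norm)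
      qed
    qed
  qed
  then show "\<exists>d>0. cball x d \<subseteq> {z. 0 < Im z} \<and> uniform_limit (cball x d) (\<lambda>n. transform (real n) 0) weyl sequentially"
    using d by blast
qed

end

section \<open>The entropy identity\<close>

text \<open>Boundary values are approached along a fixed sequence of heights, so that lower limits
  are measurable and Fatou's lemma for sequences applies.\<close>

definition height :: "nat \<Rightarrow> real"
  where "height n = 1 / real (Suc n)"

lemma height_pos: "0 < height n"
  by (simp add: height_def)

lemma height_tendsto: "height \<longlonglongrightarrow> 0"
  unfolding height_def by real_asymp

lemma filterlim_vertical:
  assumes "0 < \<alpha>"
  shows "filterlim (\<lambda>n. Complex x (height n)) (at (of_real x) within stolz_cone \<alpha> x) sequentially"
proof -
  have "(\<lambda>n. Complex x (height n)) \<longlonglongrightarrow> Complex x 0"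
    by (intro tendsto_intros height_tendsto)
  moreover have "\<forall>n. Complex x (height n) \<in> stolz_cone \<alpha> x" "\<forall>n. Complex x (height n) \<noteq> of_real x"
    using assms height_pos by (auto simp: stolz_cone_def complex_eq_iff intro!: mult_pos_pos less_imp_neq[symmetric])
  ultimately show ?thesis by (simp add: filterlim_at complex_of_real_def)
qed

lemma nontangential_value_eq:
  assumes "\<And>\<alpha>. 0 < \<alpha> \<Longrightarrow> (w \<longlongrightarrow> c) (at (of_real x) within stolz_cone \<alpha> x)"
  shows "nontangential_value w x = c" "(\<lambda>n. w (Complex x (height n))) \<longlonglongrightarrow> c"
proof -
  have lim: "(\<lambda>n. w (Complex x (height n))) \<longlonglongrightarrow> c'" if "\<And>\<alpha>. 0 < \<alpha> \<Longrightarrow> (w \<longlongrightarrow> c') (at (of_real x) within stolz_cone \<alpha> x)" for c'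
    using filterlim_compose[OF that[of 1] filterlim_vertical[of 1 x]] by simp
  show "(\<lambda>n. w (Complex x (height n))) \<longlonglongrightarrow> c" using lim assms by blast
  show "nontangential_value w x = c"
    unfolding nontangential_value_def
    by (rule the_equality) (use assms lim LIMSEQ_unique in blast)+
qed

lemma nontangential_value_cong:
  assumes "\<And>z. 0 < Im z \<Longrightarrow> w z = w' z"
  shows "nontangential_value w = nontangential_value w'"
proof -
  have "(w \<longlongrightarrow> c) (at (of_real x) within stolz_cone \<alpha> x) \<longleftrightarrow> (w' \<longlongrightarrow> c) (at (of_real x) within stolz_cone \<alpha> x)" for c x \<alpha>
    by (rule tendsto_cong) (use assms in \<open>auto simp: eventually_at_filter stolz_cone_def intro!: always_eventually\<close>)
  then show ?thesis unfolding nontangential_value_def by (simp add: fun_eq_iff)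
qed

lemma measurable_horizontal:
  assumes "w holomorphic_on {z. 0 < Im z}" "0 < h"
  shows "(\<lambda>x. w (Complex x h)) \<in> borel_measurable borel"
proof (rule borel_measurable_continuous_onI)
  have "continuous_on UNIV (\<lambda>x. Complex x h)" by (intro continuous_intros)
  then show "continuous_on UNIV (\<lambda>x. w (Complex x h))"
    by (rule continuous_on_compose2[OF holomorphic_on_imp_continuous_on[OF assms(1)]]) (use assms(2) in auto)
qed

lemma AE_vertical_limit:
  assumes "w holomorphic_on {z. 0 < Im z}" "\<And>z. 0 < Im z \<Longrightarrow> cmod (w z) \<le> 1"
  shows "AE x in lebesgue. (\<lambda>n. w (Complex x (height n))) \<longlonglongrightarrow> nontangential_value w x"
proof -
  have "AE x in lebesgue. \<exists>c. \<forall>\<alpha>>0. (w \<longlongrightarrow> c) (at (of_real x) within stolz_cone \<alpha> x)"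
    by (rule fatou_nontangential[OF assms(1)]) (rule assms(2))
  then show ?thesis
  proof eventually_elim
    case (elim x)
    then obtain c where "\<And>\<alpha>. 0 < \<alpha> \<Longrightarrow> (w \<longlongrightarrow> c) (at (of_real x) within stolz_cone \<alpha> x)" by blast
    from nontangential_value_eq[OF this] show ?case by simp
  qed
qed

lemma poisson_kernel_1: "poisson_kernel 1 x = (1 / pi) * (1 / (1 + x\<^sup>2))"
  by (simp add: poisson_kernel_def add.commute)

text \<open>The nontangential value is given by a definite description, which does not show its
  measurability. The lower limit along the vertical sequence is measurable by construction and
  agrees with it almost everywhere.\<close>

lemma entropy_functional_eq:
  assumes hol: "w holomorphic_on {z. 0 < Im z}" and bdd: "\<And>z. 0 < Im z \<Longrightarrow> cmod (w z) \<le> 1"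
  shows "entropy_functional w =
    (\<integral>\<^sup>+x. liminf (\<lambda>n. log_defect (w (Complex x (height n))) * ennreal (poisson_kernel 1 x)) \<partial>lebesgue)"
proof -
  define B where "B = (\<lambda>x. liminf (\<lambda>n. log_defect (w (Complex x (height n)))))"
  have [measurable]: "(\<lambda>x. w (Complex x (height n))) \<in> borel_measurable borel" for n
    by (rule measurable_horizontal[OF hol height_pos])
  have "B \<in> borel_measurable lborel" unfolding B_def by measurable
  then have [measurable]: "B \<in> borel_measurable lebesgue" by (rule measurable_completion)
  have [measurable]: "(\<lambda>x. ennreal (1 / (1 + x\<^sup>2))) \<in> borel_measurable lebesgue"
    by (rule measurable_completion) measurable
  have lim: "AE x in lebesgue. (\<lambda>n. log_defect (w (Complex x (height n)))) \<longlonglongrightarrow> log_defect (nontangential_value w x)"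
    using AE_vertical_limit[OF hol, OF bdd] by (rule AE_mp) (auto intro: tendsto_log_defect)
  have "entropy_functional w = ennreal (1 / pi) * (\<integral>\<^sup>+x. B x * ennreal (1 / (1 + x\<^sup>2)) \<partial>lebesgue)"
    unfolding entropy_functional_def
    by (intro arg_cong[where f = "(*) (ennreal (1 / pi))"] nn_integral_cong_AE)
       (use lim in eventually_elim, simp add: B_def lim_imp_Liminf)
  also have "\<dots> = (\<integral>\<^sup>+x. ennreal (1 / pi) * (B x * ennreal (1 / (1 + x\<^sup>2))) \<partial>lebesgue)"
    by (rule nn_integral_cmult[symmetric]) measurable
  also have "\<dots> = (\<integral>\<^sup>+x. liminf (\<lambda>n. log_defect (w (Complex x (height n))) * ennreal (poisson_kernel 1 x)) \<partial>lebesgue)"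
  proof (rule nn_integral_cong_AE, use lim in eventually_elim)
    case (elim x)
    have "(\<lambda>n. ennreal (poisson_kernel 1 x) * log_defect (w (Complex x (height n)))) \<longlonglongrightarrow> ennreal (poisson_kernel 1 x) * log_defect (nontangential_value w x)"
      by (rule ennreal_tendsto_cmult[OF _ elim]) simp
    then have "liminf (\<lambda>n. log_defect (w (Complex x (height n))) * ennreal (poisson_kernel 1 x)) = ennreal (poisson_kernel 1 x) * log_defect (nontangential_value w x)"
      by (simp add: lim_imp_Liminf mult.commute)
    moreover have "ennreal (poisson_kernel 1 x) = ennreal (1 / pi) * ennreal (1 / (1 + x\<^sup>2))"
      unfolding poisson_kernel_1 by (rule ennreal_mult) auto
    ultimately show ?case using elim by (simp add: B_def lim_imp_Liminf mult_ac)
  qed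
  finally show ?thesis .
qed

text \<open>The real part of \<open>(X + Y) * cnj (X - Y)\<close> is \<open>|X|^2 - |Y|^2\<close>,
  and here the second factor is 1.\<close>

lemma Re_sum_of_unit_difference:
  assumes "X - Y = (1::complex)" shows "Re (X + Y) = (cmod X)\<^sup>2 - (cmod Y)\<^sup>2"
proof -
  have "X = 1 + Y" using assms by (simp add: algebra_simps)
  then show ?thesis unfolding cmod_power2 by (simp add: power2_eq_square algebra_simps)
qed

lemma nn_integral_half_line_SUP:
  fixes f :: "real \<Rightarrow> ennreal"
  assumes meas: "f \<in> borel_measurable lebesgue"
  shows "(\<integral>\<^sup>+t. f t * indicator {0..} t \<partial>lebesgue) = (SUP n. \<integral>\<^sup>+t. f t * indicator {0..real n} t \<partial>lebesgue)"
proof -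
  have sup: "f t * indicator {0..} t = (SUP n. f t * indicator {0..real n} t)" for t
  proof (rule antisym)
    obtain n where "t \<le> real n" using real_arch_simple by blast
    then have "f t * indicator {0..} t = f t * indicator {0..real n} t" by (simp add: indicator_def)
    then show "f t * indicator {0..} t \<le> (SUP n. f t * indicator {0..real n} t)"
      by (intro SUP_upper2[of n]) auto
    show "(SUP n. f t * indicator {0..real n} t) \<le> f t * indicator {0..} t"
      by (rule SUP_least) (simp add: indicator_def)
  qed
  show ?thesis
    unfolding sup
  proof (rule nn_integral_monotone_convergence_SUP)
    show "incseq (\<lambda>n t. f t * indicator {0..real n} t)"
      by (auto simp: incseq_def le_fun_def indicator_def)
    show "(\<lambda>t. f t * indicator {0..real n} t) \<in> borel_measurable lebesgue" for n
      by (intro borel_measurable_times_ennreal borel_measurable_indicator meas) auto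
  qed
qed

section \<open>The two inequalities between entropy and coefficients\<close>

context canonical_system
begin

lemma defect_integral_nonneg: "0 \<le> integral {0..T} a - integral {0..T} lam"
  using integral_le[OF integrable_lam integrable_a, of 0 T] lam_bounds(2) by simp

lemma a22_boundary_mean:
  assumes T: "0 \<le> T"
  shows "(\<integral>\<^sup>+x. ennreal (ln (cmod (a22 (of_real x) T)) * poisson_kernel 1 x) \<partial>lborel) = ennreal (integral {0..T} a - integral {0..T} lam)"
proof -
  have u: "harmonic_half_plane (\<lambda>z. ln (cmod (a22 z T)))"
    by (rule harmonic_half_plane_ln_cmod[OF holomorphic_entries(4)[OF T]]) (rule a22_ge(3)[OF _ T])
  have nn: "0 \<le> ln (cmod (a22 z T))" if "0 \<le> Im z" for z using a22_ge(1)[OF that T] by simp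
  have lim: "((\<lambda>y. ln (cmod (a22 (\<i> * of_real y) T)) / y) \<longlongrightarrow> integral {0..T} lam) at_top"
    by (rule growth_along_imaginary_axis[OF row2 init2(1) init2(2) T])
  have "ln (cmod (a22 \<i> T)) = integral {0..T} a"
    using row_solution_zero_at_i(2)[OF row2 init2(1) init2(2) T] by simp
  then show ?thesis using half_plane_mean_growth[OF u nn lim] by simp
qed

lemma transform_zero:
  assumes "0 \<le> Im z" "0 \<le> T" shows "cmod (transform T 0 z) < 1"
proof -
  have P: "Pw T z (transform T 0 z) = 1 / a22 z T" and Q: "Qw T z (transform T 0 z) = 0"
    using transform_PQ[OF assms, of 0] by auto
  have "(cmod (transform T 0 z))\<^sup>2 - 1 \<le> - (cmod (1 / a22 z T))\<^sup>2"
    using PQ_energy[OF assms, of "transform T 0 z"] unfolding P Q by simp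
  moreover have "0 < (cmod (1 / a22 z T))\<^sup>2" using a22_ge(3)[OF assms] by simp
  ultimately have "(cmod (transform T 0 z))\<^sup>2 < 1" by linarith
  then show ?thesis by (simp add: abs_square_less_1)
qed

text \<open>For \<open>w = a12 / a22\<close> the combined row at time \<open>T\<close> is
  \<open>(1 / a22, 0)\<close>. Conservation of the energy on the real line then gives
  \<open>1 - |w|^2 = 1 / |a22|^2\<close>.\<close>

lemma log_defect_transform_zero:
  assumes T: "0 \<le> T"
  shows "log_defect (transform T 0 (of_real x)) = ennreal (2 * ln (cmod (a22 (of_real x) T)))"
proof -
  have z: "0 \<le> Im (of_real x)" by simp
  have P: "Pw T (of_real x) (transform T 0 (of_real x)) = 1 / a22 (of_real x) T" and Q: "Qw T (of_real x) (transform T 0 (of_real x)) = 0"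
    using transform_PQ[OF z T, of 0] by auto
  have nz: "a22 (of_real x) T \<noteq> 0" by (rule a22_ge(3)[OF z T])
  have "(cmod (transform T 0 (of_real x)))\<^sup>2 - 1 = - (cmod (1 / a22 (of_real x) T))\<^sup>2"
    using PQ_energy_real[OF T, of "transform T 0 (of_real x)" x] unfolding P Q by simp
  then have "1 / (1 - (cmod (transform T 0 (of_real x)))\<^sup>2) = 1 / (cmod (1 / a22 (of_real x) T))\<^sup>2" by simp
  also have "\<dots> = (cmod (a22 (of_real x) T))\<^sup>2" by (simp add: norm_divide power_divide)
  finally show ?thesis using transform_zero[OF z T] nz by (simp add: log_defect_def ln_realpow)
qed

lemma transform_zero_mean:
  assumes T: "0 \<le> T"
  shows "(\<integral>\<^sup>+x. log_defect (transform T 0 (of_real x)) * ennreal (poisson_kernel 1 x) \<partial>lborel) = ennreal (2 * (integral {0..T} a - integral {0..T} lam))"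
proof -
  have nn: "0 \<le> ln (cmod (a22 (of_real x) T))" for x using a22_ge(1)[of "of_real x" T] T by simp
  have "isCont (\<lambda>x. cmod (a22 (of_real x) T)) x" for x
    by (intro continuous_intros isCont_o2[OF _ isCont_entries(4)[OF T], of x of_real])
  then have "continuous_on UNIV (\<lambda>x. cmod (a22 (of_real x) T))" by (simp add: continuous_on_eq_continuous_at)
  then have [measurable]: "(\<lambda>x. cmod (a22 (of_real x) T)) \<in> borel_measurable borel" by (rule borel_measurable_continuous_onI)
  have "(\<integral>\<^sup>+x. log_defect (transform T 0 (of_real x)) * ennreal (poisson_kernel 1 x) \<partial>lborel) =
      (\<integral>\<^sup>+x. 2 * ennreal (ln (cmod (a22 (of_real x) T)) * poisson_kernel 1 x) \<partial>lborel)"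
    using nn by (intro nn_integral_cong) (simp add: log_defect_transform_zero[OF T] ennreal_mult poisson_kernel_nonneg mult.assoc)
  also have "\<dots> = 2 * ennreal (integral {0..T} a - integral {0..T} lam)"
    unfolding a22_boundary_mean[OF T, symmetric] by (rule nn_integral_cmult) measurable
  also have "\<dots> = ennreal (2 * (integral {0..T} a - integral {0..T} lam))"
    using defect_integral_nonneg[of T] by (subst ennreal_mult) auto
  finally show ?thesis .
qed

text \<open>The truncated functions converge at height \<open>h > 0\<close>, so Fatou's lemma
  applies on that line, while each of their means is bounded by the boundary mean, which is
  explicit. The bound \<open>R\<close> may be infinite.\<close>

lemma weyl_horizontal_mean_le:
  assumes h: "0 < h" and R: "\<And>T. 0 \<le> T \<Longrightarrow> ennreal (2 * (integral {0..T} a - integral {0..T} lam)) \<le> R"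
  shows "(\<integral>\<^sup>+x. log_defect (weyl (Complex x h)) * ennreal (poisson_kernel 1 x) \<partial>lborel) \<le> ennreal (1 + h) * R"
proof -
  have lim: "(\<lambda>n. ennreal (poisson_kernel 1 x) * log_defect (transform (real n) 0 (Complex x h))) \<longlonglongrightarrow> ennreal (poisson_kernel 1 x) * log_defect (weyl (Complex x h))" for x
    by (intro ennreal_tendsto_cmult tendsto_log_defect filterlim_compose[OF transform_tendsto filterlim_real_sequentially])
       (use h in auto)
  have eq: "liminf (\<lambda>n. log_defect (transform (real n) 0 (Complex x h)) * ennreal (poisson_kernel 1 x)) = log_defect (weyl (Complex x h)) * ennreal (poisson_kernel 1 x)" for x
    using lim_imp_Liminf[OF _ lim] by (simp add: mult.commute)
  have [measurable]: "(\<lambda>x. transform (real n) 0 (Complex x h)) \<in> borel_measurable borel" for n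
    by (rule measurable_horizontal[OF holomorphic_transform(1) h]) simp
  have "(\<integral>\<^sup>+x. log_defect (weyl (Complex x h)) * ennreal (poisson_kernel 1 x) \<partial>lborel) =
      (\<integral>\<^sup>+x. liminf (\<lambda>n. log_defect (transform (real n) 0 (Complex x h)) * ennreal (poisson_kernel 1 x)) \<partial>lborel)"
    by (simp add: eq)
  also have "\<dots> \<le> liminf (\<lambda>n. \<integral>\<^sup>+x. log_defect (transform (real n) 0 (Complex x h)) * ennreal (poisson_kernel 1 x) \<partial>lborel)"
    by (rule nn_integral_liminf) measurable
  also have "\<dots> \<le> liminf (\<lambda>n. ennreal (1 + h) * R)"
  proof (intro Liminf_mono always_eventually allI)
    fix n :: nat
    have "(\<integral>\<^sup>+x. log_defect (transform (real n) 0 (Complex x h)) * ennreal (poisson_kernel 1 x) \<partial>lborel)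
        \<le> ennreal (1 + h) * (\<integral>\<^sup>+x. log_defect (transform (real n) 0 (of_real x)) * ennreal (poisson_kernel 1 x) \<partial>lborel)"
      by (intro log_defect_mean_le holomorphic_transform transform_zero h) auto
    also have "\<dots> \<le> ennreal (1 + h) * R"
      unfolding transform_zero_mean[OF of_nat_0_le_iff] by (intro mult_left_mono R) auto
    finally show "(\<integral>\<^sup>+x. log_defect (transform (real n) 0 (Complex x h)) * ennreal (poisson_kernel 1 x) \<partial>lborel) \<le> ennreal (1 + h) * R" .
  qed
  finally show ?thesis by (simp add: Liminf_const)
qed

lemma entropy_functional_weyl:
  "entropy_functional weyl = (\<integral>\<^sup>+x. liminf (\<lambda>n. log_defect (weyl (Complex x (height n))) * ennreal (poisson_kernel 1 x)) \<partial>lborel)"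
  using entropy_functional_eq[OF holomorphic_weyl cmod_weyl_le] by (simp add: nn_integral_completion)

lemma AE_vertical_limit_weyl: "AE x in lebesgue. (\<lambda>n. weyl (Complex x (height n))) \<longlonglongrightarrow> nontangential_value weyl x"
  by (rule AE_vertical_limit[OF holomorphic_weyl]) (rule cmod_weyl_le)

lemma entropy_weyl_le:
  assumes R: "\<And>T. 0 \<le> T \<Longrightarrow> ennreal (2 * (integral {0..T} a - integral {0..T} lam)) \<le> R"
  shows "entropy_functional weyl \<le> R"
proof -
  have [measurable]: "(\<lambda>x. weyl (Complex x (height n))) \<in> borel_measurable borel" for n
    by (rule measurable_horizontal[OF holomorphic_weyl height_pos])
  have "entropy_functional weyl = (\<integral>\<^sup>+x. liminf (\<lambda>n. log_defect (weyl (Complex x (height n))) * ennreal (poisson_kernel 1 x)) \<partial>lborel)"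
    by (rule entropy_functional_weyl)
  also have "\<dots> \<le> liminf (\<lambda>n. \<integral>\<^sup>+x. log_defect (weyl (Complex x (height n))) * ennreal (poisson_kernel 1 x) \<partial>lborel)"
    by (rule nn_integral_liminf) measurable
  also have "\<dots> \<le> liminf (\<lambda>n. ennreal (1 + height n) * R)"
    by (intro Liminf_mono always_eventually allI weyl_horizontal_mean_le height_pos R)
  also have "\<dots> = R"
  \<comment> \<open>Multiplication in \<open>[0, \<infinity>]\<close> by a constant commutes with
    limits directly only for a finite constant.\<close>
  proof (cases "R = \<infinity>")
    case True
    have "ennreal (1 + height n) * R = \<infinity>" for n using True height_pos[of n] by (simp add: ennreal_mult_top)
    then show ?thesis using True by (simp add: Liminf_const)
  next
    case False
    have "(\<lambda>n. ennreal (1 + height n)) \<longlonglongrightarrow> ennreal (1 + 0)" by (intro tendsto_ennrealI tendsto_intros height_tendsto)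
    then have "(\<lambda>n. R * ennreal (1 + height n)) \<longlonglongrightarrow> R * ennreal (1 + 0)"
      using False by (intro ennreal_tendsto_cmult) (auto simp: less_top)
    then show ?thesis by (simp add: lim_imp_Liminf mult.commute)
  qed
  finally show ?thesis .
qed

definition herglotz_fn :: "real \<Rightarrow> complex \<Rightarrow> complex \<Rightarrow> complex"
  where "herglotz_fn T z w = Pw T z w * a22 z T + Qw T z w * a21 z T"

lemma Re_herglotz_fn:
  assumes "0 \<le> T"
  shows "Re (herglotz_fn T z w) = (cmod (Pw T z w * a22 z T))\<^sup>2 - (cmod (Qw T z w * a21 z T))\<^sup>2"
  unfolding herglotz_fn_def by (rule Re_sum_of_unit_difference[OF PQ_det[OF assms]])

lemma Re_herglotz_fn_nonneg:
  assumes "0 \<le> Im z" "0 \<le> T" "cmod (Qw T z w) \<le> cmod (Pw T z w)"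
  shows "0 \<le> Re (herglotz_fn T z w)"
proof -
  have "cmod (Qw T z w * a21 z T) \<le> cmod (Pw T z w * a22 z T)"
    unfolding norm_mult using assms(3) a22_ge(2)[OF assms(1,2)] by (intro mult_mono) auto
  then have "(cmod (Qw T z w * a21 z T))\<^sup>2 \<le> (cmod (Pw T z w * a22 z T))\<^sup>2" by (intro power_mono) auto
  then show ?thesis unfolding Re_herglotz_fn[OF assms(2)] by simp
qed

text \<open>This is \<open>ln X \<le> X - 1\<close> for \<open>X = (1 - |w|^2) |a22|^2\<close>, with
  the 1 moved to the left so that all terms lie in \<open>[0, \<infinity>]\<close>. If
  \<open>|w| = 1\<close> the right side is infinite.\<close>

lemma entropy_pointwise:
  assumes T: "0 \<le> T" and w: "cmod w \<le> 1"
  shows "ennreal (2 * ln (cmod (a22 (of_real x) T)) + 1) \<le> log_defect w + ennreal (Re (herglotz_fn T (of_real x) w))"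
proof (cases "cmod w < 1")
  case True
  then have w2: "0 < 1 - (cmod w)\<^sup>2" by (simp add: abs_square_less_1)
  define P where "P = (cmod (Pw T (of_real x) w))\<^sup>2"
  define Q where "Q = (cmod (Qw T (of_real x) w))\<^sup>2"
  define A where "A = (cmod (a22 (of_real x) T))\<^sup>2"
  have PQ: "P - Q = 1 - (cmod w)\<^sup>2" using PQ_energy_real[OF T, of w x] by (simp add: P_def Q_def)
  have nz: "a22 (of_real x) T \<noteq> 0" by (rule a22_ge(3)[OF _ T]) simp
  have A: "0 < A" using nz by (simp add: A_def)
  have "(cmod (a21 (of_real x) T))\<^sup>2 \<le> A" using a22_energy[of "of_real x" T] T unfolding A_def by (simp del: abs_le_square_iff power_mono_iff)
  then have "Q * (cmod (a21 (of_real x) T))\<^sup>2 \<le> Q * A" by (intro mult_left_mono) (auto simp: Q_def)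
  then have "(1 - (cmod w)\<^sup>2) * A \<le> Re (herglotz_fn T (of_real x) w)"
    unfolding Re_herglotz_fn[OF T] PQ[symmetric] by (simp add: norm_mult power_mult_distrib P_def Q_def A_def left_diff_distrib)
  moreover have "ln ((1 - (cmod w)\<^sup>2) * A) \<le> (1 - (cmod w)\<^sup>2) * A - 1"
    using w2 A by (intro ln_le_minus_one) simp
  moreover have "ln ((1 - (cmod w)\<^sup>2) * A) = ln (1 - (cmod w)\<^sup>2) + 2 * ln (cmod (a22 (of_real x) T))"
    using w2 A nz by (simp add: ln_mult A_def ln_realpow)
  ultimately have "2 * ln (cmod (a22 (of_real x) T)) + 1 \<le> ln (1 / (1 - (cmod w)\<^sup>2)) + Re (herglotz_fn T (of_real x) w)"
    using w2 by (simp add: ln_div)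
  moreover have "0 \<le> ln (1 / (1 - (cmod w)\<^sup>2))" using w2 by (simp add: ln_div)
  moreover have "0 \<le> Re (herglotz_fn T (of_real x) w)"
  proof (rule Re_herglotz_fn_nonneg[OF _ T])
    have "Q \<le> P" using PQ w2 by simp
    then show "cmod (Qw T (of_real x) w) \<le> cmod (Pw T (of_real x) w)" unfolding P_def Q_def by (rule power2_le_imp_le) simp
  qed simp
  ultimately show ?thesis using True by (simp add: log_defect_def ennreal_leI flip: ennreal_plus)
qed (simp add: log_defect_def)

text \<open>The pointwise inequality holds almost everywhere on the real line for the boundary
  values of \<open>weyl\<close>. In the mean, \<open>Re g\<close> contributes at most
  \<open>g \<i> = 1\<close>, and the \<open>+ 1\<close> on the left contributes exactly 1.\<close>

lemma entropy_weyl_ge: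
  assumes T: "0 \<le> T"
  shows "ennreal (2 * (integral {0..T} a - integral {0..T} lam)) \<le> entropy_functional weyl"
proof -
  define g where "g = (\<lambda>z. herglotz_fn T z (weyl z))"
  have holg: "g holomorphic_on {z. 0 < Im z}" unfolding g_def herglotz_fn_def Pw_def Qw_def
    by (intro holomorphic_intros holomorphic_entries T holomorphic_weyl)
  have g_nonneg: "0 \<le> Re (g z)" if "0 < Im z" for z
    unfolding g_def using that T weyl_in_disc[OF that T] by (intro Re_herglotz_fn_nonneg) (auto simp: weyl_disc_def)
  have gi: "g \<i> = 1"
    using PQ_det[OF T, of \<i> "weyl \<i>"] row_solution_zero_at_i(1)[OF row2 init2(1) init2(2) T]
    by (simp add: g_def herglotz_fn_def)
  define f1 where "f1 = (\<lambda>n x. log_defect (weyl (Complex x (height n))) * ennreal (poisson_kernel 1 x))"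
  define f2 where "f2 = (\<lambda>n x. ennreal (Re (g (Complex x (height n))) * poisson_kernel 1 x))"
  have [measurable]: "(\<lambda>x. weyl (Complex x (height n))) \<in> borel_measurable borel" "(\<lambda>x. g (Complex x (height n))) \<in> borel_measurable borel" for n
    by (rule measurable_horizontal[OF _ height_pos], fact holomorphic_weyl holg)+
  have [measurable]: "f1 n \<in> borel_measurable borel" "f2 n \<in> borel_measurable borel" for n
    unfolding f1_def f2_def by measurable
  have mean: "(\<integral>\<^sup>+x. f2 n x \<partial>lborel) \<le> ennreal (Re (g (Complex 0 (1 + height n))))" for n
  proof -
    \<comment> \<open>\<open>g\<close> is defined through \<open>weyl\<close>, hence meaningful only
      above the real line; the upward shift makes it holomorphic across that line, so the mean
      inequality applies. The price is evaluation at \<open>\<i> (1 + height n)\<close>, which tends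
      to \<open>\<i>\<close>.\<close>
    define G where "G = (\<lambda>z. g (z + \<i> * height n))"
    have sub: "0 < Im (z + \<i> * height n)" if "0 \<le> Im z" for z using that height_pos[of n] by simp
    have holG: "G holomorphic_on {z. - height n < Im z}" unfolding G_def
      by (rule holomorphic_on_compose_gen[OF _ holg, unfolded o_def]) (auto intro!: holomorphic_intros)
    have "harmonic_half_plane (\<lambda>z. Re (G z))"
      by (rule harmonic_half_plane_Re)
         (use height_pos[of n] in \<open>auto intro!: holomorphic_on_imp_continuous_on holomorphic_on_subset[OF holG]\<close>)
    then have "(\<integral>\<^sup>+x. ennreal (Re (G (of_real x)) * poisson_kernel 1 x) \<partial>lborel) \<le> ennreal (Re (G \<i>))"
      by (rule half_plane_mean_nonneg_le) (unfold G_def, rule g_nonneg[OF sub])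
    moreover have "of_real x + \<i> * height n = Complex x (height n)" for x by (simp add: complex_eq_iff)
    moreover have "\<i> + \<i> * height n = Complex 0 (1 + height n)" by (simp add: complex_eq_iff)
    ultimately show ?thesis by (simp add: f2_def G_def)
  qed
  have "isCont g \<i>" using holg open_halfspace_Im_gt[of 0] by (simp add: holomorphic_on_imp_continuous_on continuous_on_eq_continuous_at[symmetric] holomorphic_on_imp_differentiable_at field_differentiable_imp_continuous_at)
  moreover have "(\<lambda>n. Complex 0 (1 + height n)) \<longlonglongrightarrow> Complex 0 (1 + 0)" by (intro tendsto_intros height_tendsto)
  moreover have "Complex 0 (1 + 0) = \<i>" by (simp add: complex_eq_iff)
  ultimately have "(\<lambda>n. g (Complex 0 (1 + height n))) \<longlonglongrightarrow> g \<i>" using isCont_tendsto_compose by metis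
  then have "(\<lambda>n. ennreal (Re (g (Complex 0 (1 + height n))))) \<longlonglongrightarrow> ennreal (Re (g \<i>))"
    by (intro tendsto_ennrealI tendsto_intros)
  then have lim1: "liminf (\<lambda>n. ennreal (Re (g (Complex 0 (1 + height n))))) = 1"
    by (simp add: gi lim_imp_Liminf)
  have "(\<integral>\<^sup>+x. liminf (\<lambda>n. f2 n x) \<partial>lborel) \<le> liminf (\<lambda>n. \<integral>\<^sup>+x. f2 n x \<partial>lborel)"
    by (rule nn_integral_liminf) measurable
  also have "\<dots> \<le> liminf (\<lambda>n. ennreal (Re (g (Complex 0 (1 + height n)))))"
    by (intro Liminf_mono always_eventually allI mean)
  finally have G1: "(\<integral>\<^sup>+x. liminf (\<lambda>n. f2 n x) \<partial>lborel) \<le> 1" unfolding lim1 .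
  have ent: "entropy_functional weyl = (\<integral>\<^sup>+x. liminf (\<lambda>n. f1 n x) \<partial>lborel)"
    unfolding f1_def by (rule entropy_functional_weyl)
  have "isCont (\<lambda>x. cmod (a22 (of_real x) T)) x" for x
    by (intro continuous_intros isCont_o2[OF _ isCont_entries(4)[OF T], of x of_real])
  then have "continuous_on UNIV (\<lambda>x. cmod (a22 (of_real x) T))" by (simp add: continuous_on_eq_continuous_at)
  then have [measurable]: "(\<lambda>x. cmod (a22 (of_real x) T)) \<in> borel_measurable borel" by (rule borel_measurable_continuous_onI)
  have nn: "0 \<le> ln (cmod (a22 (of_real x) T))" for x using a22_ge(1)[of "of_real x" T] T by simp
  \<comment> \<open>The 1 is the mass of the Poisson kernel. It stays on both sides until the end,
    where it is finite and can be cancelled.\<close>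
  have "ennreal (2 * (integral {0..T} a - integral {0..T} lam)) + 1 =
      2 * (\<integral>\<^sup>+x. ennreal (ln (cmod (a22 (of_real x) T)) * poisson_kernel 1 x) \<partial>lborel) + (\<integral>\<^sup>+x. ennreal (poisson_kernel 1 (x - 0)) \<partial>lborel)"
    unfolding a22_boundary_mean[OF T] poisson_kernel_mass(3)[OF zero_less_one]
    using defect_integral_nonneg[of T] by (subst ennreal_mult) auto
  also have "\<dots> = (\<integral>\<^sup>+x. 2 * ennreal (ln (cmod (a22 (of_real x) T)) * poisson_kernel 1 x) + ennreal (poisson_kernel 1 x) \<partial>lborel)"
    by (simp add: nn_integral_add nn_integral_cmult)
  also have "\<dots> = (\<integral>\<^sup>+x. ennreal (2 * ln (cmod (a22 (of_real x) T)) + 1) * ennreal (poisson_kernel 1 x) \<partial>lborel)"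
    using nn by (intro nn_integral_cong) (simp add: ennreal_mult poisson_kernel_nonneg distrib_right mult.assoc)
  also have "\<dots> = (\<integral>\<^sup>+x. ennreal (2 * ln (cmod (a22 (of_real x) T)) + 1) * ennreal (poisson_kernel 1 x) \<partial>lebesgue)"
    by (simp add: nn_integral_completion)
  also have "\<dots> \<le> (\<integral>\<^sup>+x. liminf (\<lambda>n. f1 n x) + liminf (\<lambda>n. f2 n x) \<partial>lebesgue)"
  proof (rule nn_integral_mono_AE, use AE_vertical_limit_weyl in eventually_elim)
    case (elim x)
    define c where "c = nontangential_value weyl x"
    have lw: "(\<lambda>n. weyl (Complex x (height n))) \<longlonglongrightarrow> c" using elim by (simp add: c_def)
    have "cmod c \<le> 1"
      by (rule LIMSEQ_le_const2[OF tendsto_norm[OF lw]]) (use height_pos in \<open>auto intro!: cmod_weyl_le\<close>)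
    have lz: "(\<lambda>n. Complex x (height n)) \<longlonglongrightarrow> of_real x"
      unfolding complex_of_real_def by (intro tendsto_intros height_tendsto)
    have l1: "(\<lambda>n. ennreal (poisson_kernel 1 x) * log_defect (weyl (Complex x (height n)))) \<longlonglongrightarrow> ennreal (poisson_kernel 1 x) * log_defect c"
      by (intro ennreal_tendsto_cmult tendsto_log_defect lw) simp
    have "(\<lambda>n. g (Complex x (height n))) \<longlonglongrightarrow> herglotz_fn T (of_real x) c"
      unfolding g_def herglotz_fn_def Pw_def Qw_def
      by (intro tendsto_intros lw isCont_tendsto_compose[OF isCont_entries(1)[OF T] lz] isCont_tendsto_compose[OF isCont_entries(2)[OF T] lz]
            isCont_tendsto_compose[OF isCont_entries(3)[OF T] lz] isCont_tendsto_compose[OF isCont_entries(4)[OF T] lz])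
    then have l2: "(\<lambda>n. f2 n x) \<longlonglongrightarrow> ennreal (Re (herglotz_fn T (of_real x) c) * poisson_kernel 1 x)"
      unfolding f2_def by (intro tendsto_ennrealI tendsto_intros)
    have "ennreal (2 * ln (cmod (a22 (of_real x) T)) + 1) * ennreal (poisson_kernel 1 x) \<le>
        (log_defect c + ennreal (Re (herglotz_fn T (of_real x) c))) * ennreal (poisson_kernel 1 x)"
      by (intro mult_right_mono entropy_pointwise T \<open>cmod c \<le> 1\<close>) simp
    also have "\<dots> = liminf (\<lambda>n. f1 n x) + liminf (\<lambda>n. f2 n x)"
      using lim_imp_Liminf[OF _ l1] lim_imp_Liminf[OF _ l2]
      by (simp add: f1_def distrib_left ennreal_mult'' poisson_kernel_nonneg mult.commute[of _ "ennreal (poisson_kernel 1 x)"])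
    finally show ?case .
  qed
  also have "\<dots> = (\<integral>\<^sup>+x. liminf (\<lambda>n. f1 n x) + liminf (\<lambda>n. f2 n x) \<partial>lborel)" by (simp add: nn_integral_completion)
  also have "\<dots> = entropy_functional weyl + (\<integral>\<^sup>+x. liminf (\<lambda>n. f2 n x) \<partial>lborel)"
    unfolding ent by (rule nn_integral_add) measurable
  also have "\<dots> \<le> entropy_functional weyl + 1" using G1 by (rule add_left_mono)
  finally show ?thesis by (simp add: add.commute[of _ 1] ennreal_add_left_cancel_le)
qed

lemma nn_integral_defect:
  "(\<integral>\<^sup>+t. ennreal (2 * (a t - lam t)) * indicator {0..T} t \<partial>lebesgue) = ennreal (2 * (integral {0..T} a - integral {0..T} lam))"
proof -
  have "((\<lambda>t. 2 * (a t - lam t)) has_integral 2 * (integral {0..T} a - integral {0..T} lam)) {0..T}"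
    by (intro has_integral_mult_right has_integral_diff integrable_integral integrable_a integrable_lam)
  then show ?thesis
    using nn_integral_has_integral_lebesgue'[of "{0..T}" "\<lambda>t. 2 * (a t - lam t)"] lam_bounds(2)
    by (simp add: nn_integral_completion)
qed

theorem entropy_weyl:
  "entropy_functional weyl = (\<integral>\<^sup>+t. ennreal (2 * (a t - lam t)) * indicator {0..} t \<partial>lebesgue)"
proof (rule antisym)
  show "entropy_functional weyl \<le> (\<integral>\<^sup>+t. ennreal (2 * (a t - lam t)) * indicator {0..} t \<partial>lebesgue)"
    by (rule entropy_weyl_le, subst nn_integral_defect[symmetric], rule nn_integral_mono) (auto simp: indicator_def)
  have "(\<integral>\<^sup>+t. ennreal (2 * (a t - lam t)) * indicator {0..} t \<partial>lebesgue) =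
      (SUP n. \<integral>\<^sup>+t. ennreal (2 * (a t - lam t)) * indicator {0..real n} t \<partial>lebesgue)"
    by (rule nn_integral_half_line_SUP) measurable
  also have "\<dots> \<le> entropy_functional weyl"
    unfolding nn_integral_defect by (intro SUP_least entropy_weyl_ge) simp
  finally show "(\<integral>\<^sup>+t. ennreal (2 * (a t - lam t)) * indicator {0..} t \<partial>lebesgue) \<le> entropy_functional weyl" .
qed

end

section \<open>Matrix coefficients\<close>

no_notation fps_nth (infixl "$" 75)

lemma sig_j_entries: "sig_j $ 1 $ 1 = -1" "sig_j $ 1 $ 2 = 0" "sig_j $ 2 $ 1 = 0" "sig_j $ 2 $ 2 = 1"
  by (simp_all add: sig_j_def vector_2)

text \<open>The trace condition equates the two diagonal entries. Testing positivity with the vector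
  \<open>(sgn b, -1)\<close> aligns the phase of the off-diagonal entry \<open>b\<close> and leaves
  \<open>2 m - 2 |b| \<ge> 0\<close>.\<close>

lemma pos_semidef_entries:
  assumes M: "pos_semidef M" and tr: "trace (M ** sig_j) = 0"
  shows "M $ 1 $ 1 = of_real (Re (M $ 1 $ 1))" "M $ 2 $ 2 = M $ 1 $ 1" "M $ 2 $ 1 = cnj (M $ 1 $ 2)"
    "cmod (M $ 1 $ 2) \<le> Re (M $ 1 $ 1)"
proof -
  define b where "b = M $ 1 $ 2"
  have herm: "adj M = M" and pos: "\<And>v. 0 \<le> Re (\<Sum>i\<in>UNIV. cnj (v $ i) * (M *v v) $ i)"
    using M by (auto simp: pos_semidef_def)
  have entry: "adj M $ i $ k = cnj (M $ k $ i)" for i k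
    by (simp add: adj_def map_matrix_def transpose_def)
  have c: "cnj (M $ k $ i) = M $ i $ k" for i k using entry[of i k] unfolding herm by simp
  have "Im (M $ 1 $ 1) = 0" using arg_cong[OF c[of 1 1], of Im] by simp
  then show m11: "M $ 1 $ 1 = of_real (Re (M $ 1 $ 1))" by (simp add: complex_eq_iff)
  show m22: "M $ 2 $ 2 = M $ 1 $ 1"
    using tr by (simp add: trace_def matrix_matrix_mult_def sum_2 sig_j_entries)
  show m21: "M $ 2 $ 1 = cnj (M $ 1 $ 2)" using c[of 1 2] by simp
  define m where "m = Re (M $ 1 $ 1)"
  have M11: "M $ 1 $ 1 = of_real m" and M22: "M $ 2 $ 2 = of_real m" and M12: "M $ 1 $ 2 = b" and M21: "M $ 2 $ 1 = cnj b"
    using m11 m22 m21 by (simp_all add: m_def b_def)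
  have q: "0 \<le> Re (cnj x * (of_real m * x + b * y) + cnj y * (cnj b * x + of_real m * y))" for x y
    using pos[of "vector [x, y]"] by (simp add: sum_2 matrix_vector_mult_def vector_2 M11 M22 M12 M21)
  show "cmod (M $ 1 $ 2) \<le> Re (M $ 1 $ 1)"
  proof (cases "b = 0")
    case True
    then show ?thesis using q[of 1 0] by (simp add: M11 M12)
  next
    case False
    have bb: "b * cnj b = of_real (cmod b) * of_real (cmod b)"
      using complex_norm_square[of b] by (simp add: power2_eq_square)
    have s: "cnj (sgn b) * b = of_real (cmod b)" "cnj b * sgn b = of_real (cmod b)" "cnj (sgn b) * sgn b = 1"
      using False bb by (simp_all add: sgn_eq field_simps)
    have "cnj (sgn b) * (of_real m * sgn b + b * - 1) + cnj (- 1) * (cnj b * sgn b + of_real m * - 1) =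
        of_real m * (cnj (sgn b) * sgn b) - cnj (sgn b) * b - cnj b * sgn b + of_real m"
      by (simp add: algebra_simps)
    also have "\<dots> = of_real (2 * m - 2 * cmod b)" unfolding s by simp
    finally have "0 \<le> 2 * m - 2 * cmod b" using q[of "sgn b" "- 1"] by (simp only: Re_complex_of_real)
    then show ?thesis by (simp add: M11 M12)
  qed
qed

text \<open>The two trace conditions concern the sum and the difference of the diagonal entries, so
  both vanish; skew-adjointness relates the others.\<close>

lemma arov_gauge_entries:
  assumes "adj M = - M" "trace (M ** sig_j) = 0" "trace M = 0"
  shows "M $ 1 $ 1 = 0" "M $ 2 $ 2 = 0" "M $ 1 $ 2 = - cnj (M $ 2 $ 1)"
proof -
  have "M $ 1 $ 1 + M $ 2 $ 2 = 0" "M $ 2 $ 2 - M $ 1 $ 1 = 0"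
    using assms(2,3) by (simp_all add: trace_def matrix_matrix_mult_def sum_2 sig_j_entries)
  then show "M $ 1 $ 1 = 0" "M $ 2 $ 2 = 0" by (simp_all add: algebra_simps)
  have "adj M $ 1 $ 2 = cnj (M $ 2 $ 1)"
    by (simp add: adj_def map_matrix_def transpose_def)
  then show "M $ 1 $ 2 = - cnj (M $ 2 $ 1)" unfolding assms(1) by (metis minus_minus vector_uminus_component)
qed

lemma measurable_of_locally_integrable:
  fixes f :: "real \<Rightarrow> complex"
  assumes "\<And>T. 0 \<le> T \<Longrightarrow> f absolutely_integrable_on {0..T}"
  shows "(\<lambda>t. if 0 \<le> t then f t else 0) \<in> borel_measurable lebesgue"
proof (rule borel_measurable_LIMSEQ_metric)
  show "(\<lambda>t. indicat_real {0..real n} t *\<^sub>R f t) \<in> borel_measurable lebesgue" for n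
    using assms[of "real n"] unfolding set_integrable_def by (rule borel_measurable_integrable) simp
  show "(\<lambda>n. indicat_real {0..real n} t *\<^sub>R f t) \<longlonglongrightarrow> (if 0 \<le> t then f t else 0)" for t
  proof (rule tendsto_eventually)
    show "\<forall>\<^sub>F n in sequentially. indicat_real {0..real n} t *\<^sub>R f t = (if 0 \<le> t then f t else 0)"
      using eventually_ge_at_top[of "nat \<lceil>t\<rceil>"] by eventually_elim (auto simp: indicator_def nat_le_iff ceiling_le_iff)
  qed
qed

lemma norm_max_Re_cmod_le: "norm (max (Re z) (cmod w)) \<le> norm (cmod z + cmod w)"
proof -
  have "\<bar>max (Re z) (cmod w)\<bar> \<le> \<bar>Re z\<bar> + \<bar>cmod w\<bar>" by (simp add: max_def)
  then show ?thesis using abs_Re_le_cmod[of z] by simp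
qed

lemma canonical_coefficients_of_matrix:
  fixes A :: "real \<Rightarrow> complex^2^2"
  assumes A: "locally_integrable_entries A"
  shows "canonical_coefficients (\<lambda>t. if 0 \<le> t then max (Re (A t $ 1 $ 1)) (cmod (A t $ 1 $ 2)) else 0)
    (\<lambda>t. if 0 \<le> t then A t $ 1 $ 2 else 0)"
proof
  define f where "f = (\<lambda>k t. if 0 \<le> t then A t $ 1 $ k else 0)"
  have int: "(\<lambda>t. A t $ i $ k) absolutely_integrable_on {0..T}" if "0 \<le> T" for i k T
    using A that by (simp add: locally_integrable_entries_def)
  have meas [measurable]: "f k \<in> borel_measurable lebesgue" for k
    unfolding f_def by (rule measurable_of_locally_integrable) (rule int)
  have a_eq: "(\<lambda>t. if 0 \<le> t then max (Re (A t $ 1 $ 1)) (cmod (A t $ 1 $ 2)) else 0) = (\<lambda>t. max (Re (f 1 t)) (cmod (f 2 t)))"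
    by (auto simp: f_def)
  show "(\<lambda>t. if 0 \<le> t then A t $ 1 $ 2 else 0) \<in> borel_measurable lebesgue"
    using meas[of 2] by (simp add: f_def)
  show ma: "(\<lambda>t. if 0 \<le> t then max (Re (A t $ 1 $ 1)) (cmod (A t $ 1 $ 2)) else 0) \<in> borel_measurable lebesgue"
    unfolding a_eq by measurable
  show "cmod (if 0 \<le> t then A t $ 1 $ 2 else 0) \<le> (if 0 \<le> t then max (Re (A t $ 1 $ 1)) (cmod (A t $ 1 $ 2)) else 0)" for t
    by simp
  show "(\<lambda>t. if 0 \<le> t then max (Re (A t $ 1 $ 1)) (cmod (A t $ 1 $ 2)) else 0) integrable_on {u..v}" for u v
  proof -
    \<comment> \<open>Integrability is given on intervals starting at 0 only; the part of
      \<open>{u..v}\<close> below 0 contributes nothing because of the cutoff.\<close>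
    define T where "T = max v 0"
    have T: "0 \<le> T" "v \<le> T" by (auto simp: T_def)
    have "integrable lebesgue (\<lambda>t. indicat_real {0..T} t *\<^sub>R A t $ 1 $ k)" for k
      using int[OF T(1)] unfolding set_integrable_def .
    then have "integrable lebesgue (\<lambda>t. cmod (indicat_real {0..T} t *\<^sub>R A t $ 1 $ 1) + cmod (indicat_real {0..T} t *\<^sub>R A t $ 1 $ 2))"
      by (intro Bochner_Integration.integrable_add integrable_norm)
    then have "integrable lebesgue (\<lambda>t. indicat_real {u..v} t *\<^sub>R max (Re (f 1 t)) (cmod (f 2 t)))"
    proof (rule Bochner_Integration.integrable_bound)
      show "(\<lambda>t. indicat_real {u..v} t *\<^sub>R max (Re (f 1 t)) (cmod (f 2 t))) \<in> borel_measurable lebesgue"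
        using ma unfolding a_eq by (intro borel_measurable_scaleR borel_measurable_indicator) auto
      show "AE t in lebesgue. norm (indicat_real {u..v} t *\<^sub>R max (Re (f 1 t)) (cmod (f 2 t))) \<le>
          norm (cmod (indicat_real {0..T} t *\<^sub>R A t $ 1 $ 1) + cmod (indicat_real {0..T} t *\<^sub>R A t $ 1 $ 2))"
        using T by (intro AE_I2) (auto simp: indicator_def f_def norm_max_Re_cmod_le simp del: real_norm_def)
    qed
    then have "(\<lambda>t. max (Re (f 1 t)) (cmod (f 2 t))) absolutely_integrable_on {u..v}"
      unfolding set_integrable_def .
    then show ?thesis unfolding a_eq by (rule set_lebesgue_integral_eq_integral(1))
  qed
qed

lemma at_within_nonneg: "0 < t \<Longrightarrow> at t within {0..} = at (t::real)"
  by (rule at_within_interior) (simp add: interior_real_atLeast)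

lemma bounded_linear_matrix_entry: "bounded_linear (\<lambda>X::complex^2^2. X $ i $ k)"
  by (rule bounded_linear_compose[OF bounded_linear_vec_nth bounded_linear_vec_nth])

lemma infinite_integral_at_top:
  fixes a :: "real \<Rightarrow> real"
  assumes nn: "\<And>t. 0 \<le> a t" and int: "\<And>T. a integrable_on {0..T}"
    and inf: "(\<integral>\<^sup>+t. ennreal (a t) * indicator {0..} t \<partial>lebesgue) = \<infinity>"
    and meas [measurable]: "a \<in> borel_measurable lebesgue"
  shows "filterlim (\<lambda>T. integral {0..T} a) at_top at_top"
  unfolding filterlim_at_top
proof
  fix Z
  have fin: "(\<integral>\<^sup>+t. ennreal (a t) * indicator {0..real n} t \<partial>lebesgue) = ennreal (integral {0..real n} a)" for n
    using nn_integral_has_integral_lebesgue'[of "{0..real n}" a, OF nn integrable_integral[OF int]]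
    by (simp add: nn_integral_completion)
  have "(\<integral>\<^sup>+t. ennreal (a t) * indicator {0..} t \<partial>lebesgue) = (SUP n. ennreal (integral {0..real n} a))"
    unfolding fin[symmetric] by (rule nn_integral_half_line_SUP) measurable
  then have "ennreal \<bar>Z\<bar> < (SUP n. ennreal (integral {0..real n} a))" unfolding inf by (metis ennreal_less_top infinity_ennreal_def)
  then obtain n where "ennreal \<bar>Z\<bar> < ennreal (integral {0..real n} a)" by (auto simp: less_SUP_iff)
  then have Z: "\<bar>Z\<bar> < integral {0..real n} a" by (simp add: ennreal_less_iff)
  show "\<forall>\<^sub>F T in at_top. Z \<le> integral {0..T} a"
    using eventually_ge_at_top[of "real n"]
  proof eventually_elim
    case (elim T)
    have "integral {0..real n} a \<le> integral {0..T} a"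
      using elim nn by (intro integral_subset_le int) auto
    then show ?case using Z by linarith
  qed
qed

theorem theorem2p1:
  fixes A B :: "real \<Rightarrow> complex^2^2"
    and \<AA> :: "complex \<Rightarrow> real \<Rightarrow> complex^2^2"
    and E :: "complex \<Rightarrow> complex"
  assumes "locally_integrable_entries A" and "locally_integrable_entries B"
    and "AE t in lebesgue. 0 \<le> t \<longrightarrow> pos_semidef (A t)"
    and "AE t in lebesgue. 0 \<le> t \<longrightarrow> adj (B t) = - B t"
    and "AE t in lebesgue. 0 \<le> t \<longrightarrow> trace (A t ** sig_j) = 0 \<and> trace (B t ** sig_j) = 0"
    and "(\<integral>\<^sup>+ t\<in>{0..}. ennreal (Re (trace (A t))) \<partial>lebesgue) = \<infinity>"
    and A_gauge: "AE t in lebesgue. 0 \<le> t \<longrightarrow> (A t + B t) $ 2 $ 1 = 0 \<and> trace (B t) = 0"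
    and "\<And>z. canonical_solution A B z (\<AA> z)"
    and "E \<in> schur_class"
  shows "entropy_functional (schur_spectral_function \<AA> E) =
    (\<integral>\<^sup>+ t\<in>{0..}. ennreal (Re (trace (A t)) - 2 * sqrt (Re (det (A t)))) \<partial>lebesgue)"
proof -
  text \<open>The maximum and the cutoff alter the coefficient on a null set only and make
    \<open>cmod (b t) \<le> a t\<close> hold for every \<open>t\<close>.\<close>
  define a where "a = (\<lambda>t. if 0 \<le> t then max (Re (A t $ 1 $ 1)) (cmod (A t $ 1 $ 2)) else 0)"
  define b where "b = (\<lambda>t. if 0 \<le> t then A t $ 1 $ 2 else 0)"
  interpret canonical_coefficients a b
    unfolding a_def b_def by (rule canonical_coefficients_of_matrix[OF assms(1)])
  have A_entries: "AE t in lebesgue. 0 \<le> t \<longrightarrow> A t $ 1 $ 1 = of_real (a t) \<and> A t $ 2 $ 2 = of_real (a t) \<and>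
      A t $ 1 $ 2 = b t \<and> A t $ 2 $ 1 = cnj (b t)"
    using assms(3,5)
  proof eventually_elim
    case (elim t)
    show ?case
    proof
      assume t: "0 \<le> t"
      note e = pos_semidef_entries[of "A t"]
      have p: "pos_semidef (A t)" "trace (A t ** sig_j) = 0" using elim t by auto
      have "a t = Re (A t $ 1 $ 1)" using e(4)[OF p] t by (simp add: a_def)
      moreover have "b t = A t $ 1 $ 2" using t by (simp add: b_def)
      ultimately show "A t $ 1 $ 1 = of_real (a t) \<and> A t $ 2 $ 2 = of_real (a t) \<and>
          A t $ 1 $ 2 = b t \<and> A t $ 2 $ 1 = cnj (b t)"
        using e(1-3)[OF p] by metis
    qed
  qed
  have B_entries: "AE t in lebesgue. 0 \<le> t \<longrightarrow> B t $ 1 $ 1 = 0 \<and> B t $ 2 $ 2 = 0 \<and>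
      B t $ 1 $ 2 = b t \<and> B t $ 2 $ 1 = - cnj (b t)"
    using A_entries assms(4,5) A_gauge
  proof eventually_elim
    case (elim t)
    show ?case
    proof
      assume t: "0 \<le> t"
      have p: "adj (B t) = - B t" "trace (B t ** sig_j) = 0" "trace (B t) = 0" using elim t by auto
      have "B t $ 2 $ 1 = - cnj (b t)" using elim t by (simp add: add_eq_0_iff2)
      then show "B t $ 1 $ 1 = 0 \<and> B t $ 2 $ 2 = 0 \<and> B t $ 1 $ 2 = b t \<and> B t $ 2 $ 1 = - cnj (b t)"
        using arov_gauge_entries[OF p] by simp
    qed
  qed
  \<comment> \<open>\<open>A\<close> and \<open>B\<close> share the upper right entry
    \<open>b\<close>, while their lower left entries are \<open>cnj b\<close> and
    \<open>- cnj b\<close>; this produces the factors \<open>1 - \<i> z\<close> and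
    \<open>1 + \<i> z\<close>. Right multiplication by \<open>sig_j\<close> changes the sign of the
    first column.\<close>
  have row: "row_solution z (\<lambda>t. \<AA> z t $ i $ 1) (\<lambda>t. \<AA> z t $ i $ 2)" for z i
    unfolding row_solution_def
  proof (intro conjI allI)
    fix T :: real
    have "abs_continuous_on {0..T} (\<AA> z)"
    proof (cases "0 \<le> T")
      case True
      then show ?thesis using assms(8)[of z] by (simp add: canonical_solution_def)
    next
      case False
      have "abs_continuous_on {0..0} (\<AA> z)"
        using assms(8)[of z] unfolding canonical_solution_def by blast
      then show ?thesis by (rule abs_continuous_on_subset) (use False in auto)
    qed
    then show "abs_continuous_on {0..T} (\<lambda>t. \<AA> z t $ i $ 1)" "abs_continuous_on {0..T} (\<lambda>t. \<AA> z t $ i $ 2)"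
      by (rule abs_continuous_on_bounded_linear[OF bounded_linear_matrix_entry])+
    have der: "AE t in lebesgue. 0 \<le> t \<longrightarrow>
       (\<exists>X'. (\<AA> z has_vector_derivative X') (at t within {0..}) \<and>
             X' ** sig_j = \<AA> z t ** (map_matrix (\<lambda>a. - \<i> * z * a) (A t) + B t))"
      using assms(8)[of z] unfolding canonical_solution_def by blast
    show "AE t in lebesgue. 0 < t \<longrightarrow>
      ((\<lambda>t. \<AA> z t $ i $ 1) has_vector_derivative (\<i> * z * a t * \<AA> z t $ i $ 1 + (1 + \<i> * z) * cnj (b t) * \<AA> z t $ i $ 2)) (at t) \<and>
      ((\<lambda>t. \<AA> z t $ i $ 2) has_vector_derivative ((1 - \<i> * z) * b t * \<AA> z t $ i $ 1 - \<i> * z * a t * \<AA> z t $ i $ 2)) (at t)"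
      using der A_entries B_entries
    proof eventually_elim
      case (elim t)
      show ?case
      proof
        assume t: "0 < t"
        then obtain X' where X': "(\<AA> z has_vector_derivative X') (at t)"
          and eq: "X' ** sig_j = \<AA> z t ** (map_matrix (\<lambda>a. - \<i> * z * a) (A t) + B t)"
          using elim by (auto simp: at_within_nonneg)
        have en: "A t $ 1 $ 1 = of_real (a t)" "A t $ 2 $ 2 = of_real (a t)" "A t $ 1 $ 2 = b t" "A t $ 2 $ 1 = cnj (b t)"
          "B t $ 1 $ 1 = 0" "B t $ 2 $ 2 = 0" "B t $ 1 $ 2 = b t" "B t $ 2 $ 1 = - cnj (b t)"
          using elim t by auto
        have c: "(X' ** sig_j) $ i $ k = (\<AA> z t ** (map_matrix (\<lambda>a. - \<i> * z * a) (A t) + B t)) $ i $ k" for k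
          by (simp only: eq)
        have X1: "X' $ i $ 1 = \<i> * z * a t * \<AA> z t $ i $ 1 + (1 + \<i> * z) * cnj (b t) * \<AA> z t $ i $ 2"
          using c[of 1] by (simp add: matrix_matrix_mult_def sum_2 sig_j_entries map_matrix_def en algebra_simps minus_equation_iff[of "X' $ i $ 1"])
        have X2: "X' $ i $ 2 = (1 - \<i> * z) * b t * \<AA> z t $ i $ 1 - \<i> * z * a t * \<AA> z t $ i $ 2"
          using c[of 2] by (simp add: matrix_matrix_mult_def sum_2 sig_j_entries map_matrix_def en algebra_simps)
        show "((\<lambda>t. \<AA> z t $ i $ 1) has_vector_derivative (\<i> * z * a t * \<AA> z t $ i $ 1 + (1 + \<i> * z) * cnj (b t) * \<AA> z t $ i $ 2)) (at t) \<and>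
          ((\<lambda>t. \<AA> z t $ i $ 2) has_vector_derivative ((1 - \<i> * z) * b t * \<AA> z t $ i $ 1 - \<i> * z * a t * \<AA> z t $ i $ 2)) (at t)"
          using bounded_linear.has_vector_derivative[OF bounded_linear_matrix_entry[of i 1] X']
            bounded_linear.has_vector_derivative[OF bounded_linear_matrix_entry[of i 2] X'] unfolding X1 X2 by blast
      qed
    qed
  qed
  have trace_eq: "AE t in lebesgue. 0 \<le> t \<longrightarrow> Re (trace (A t)) = 2 * a t \<and> Re (det (A t)) = (a t)\<^sup>2 - (cmod (b t))\<^sup>2"
    using A_entries
  proof eventually_elim
    case (elim t)
    have "Re (b t * cnj (b t)) = (cmod (b t))\<^sup>2"
      unfolding cmod_power2 by (simp add: power2_eq_square)
    with elim show ?case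
      by (auto simp only: trace_def sum_2 det_2 minus_complex.sel plus_complex.sel Re_complex_of_real power2_eq_square of_real_mult[symmetric])
  qed
  have a_nonneg: "0 \<le> a t" for t using norm_b_le[of t] norm_ge_zero[of "b t"] by linarith
  have "(\<integral>\<^sup>+t. ennreal 2 * (ennreal (a t) * indicator {0..} t) \<partial>lebesgue) = \<infinity>"
    unfolding assms(6)[symmetric]
    by (rule nn_integral_cong_AE, use trace_eq in eventually_elim) (auto simp: indicator_def ennreal_mult' a_nonneg)
  moreover have "(\<lambda>t. ennreal (a t) * indicator {0..} t) \<in> borel_measurable lebesgue"
    using measurable_a by (intro borel_measurable_times_ennreal borel_measurable_indicator measurable_compose[OF _ measurable_ennreal]) auto
  ultimately have inf: "(\<integral>\<^sup>+t. ennreal (a t) * indicator {0..} t \<partial>lebesgue) = \<infinity>"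
    by (simp add: nn_integral_cmult ennreal_mult_eq_top_iff)
  have init: "\<AA> z 0 = mat 1" for z using assms(8)[of z] by (simp add: canonical_solution_def)
  interpret canonical_system a b "\<lambda>z t. \<AA> z t $ 1 $ 1" "\<lambda>z t. \<AA> z t $ 1 $ 2" "\<lambda>z t. \<AA> z t $ 2 $ 1" "\<lambda>z t. \<AA> z t $ 2 $ 2"
  proof
    show "filterlim (\<lambda>T. integral {0..T} a) at_top at_top"
      by (rule infinite_integral_at_top[OF a_nonneg integrable_a inf measurable_a])
  qed (rule row, simp_all add: init mat_def row)
  have "schur_spectral_function \<AA> E z = weyl z" if z: "0 < Im z" for z
  proof -
    \<comment> \<open>For fixed \<open>z\<close> the parameter function enters only through a number
      in the closed unit disc, and the truncated transforms have the same limit for all such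
      numbers.\<close>
    have "cmod (E z) \<le> 1" using assms(9) z by (simp add: schur_class_def)
    from transform_tendsto[OF z this] show ?thesis
      unfolding schur_spectral_function_def transform_def by (intro tendsto_Lim) auto
  qed
  then have "nontangential_value (schur_spectral_function \<AA> E) = nontangential_value weyl"
    by (rule nontangential_value_cong)
  then have "entropy_functional (schur_spectral_function \<AA> E) = entropy_functional weyl"
    by (simp only: entropy_functional_def)
  also have "\<dots> = (\<integral>\<^sup>+t. ennreal (2 * (a t - lam t)) * indicator {0..} t \<partial>lebesgue)" by (rule entropy_weyl)
  also have "\<dots> = (\<integral>\<^sup>+ t\<in>{0..}. ennreal (Re (trace (A t)) - 2 * sqrt (Re (det (A t)))) \<partial>lebesgue)"
    by (rule nn_integral_cong_AE, use trace_eq in eventually_elim) (auto simp: indicator_def lam_def right_diff_distrib)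
  finally show ?thesis .
qed

end
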